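(* Let $p>3$ be a prime, and let $A_p(x)=[x+a_{ij}]_{1\leqslant i,j\leqslant (p-1)/2}$ (a matrix with entries in $\mathbb{Z}[x]$), where $$a_{ij}=\begin{cases}\left(\frac{j}{p}\right) & \text{if } i=1,\\ \left(\frac{i+j}{p}\right) & \text{if } i>1.\end{cases}$$ Then $$\det A_p(x)=\begin{cases}2^{(p-3)/2}\left(\frac{2}{p}\right)\bigl(a_p-b_p+(a_p-pb_p)x\bigr) & \text{if } p\equiv 1\pmod 4,\\ 2^{(p-3)/2}(x-1) & \text{if } p\equiv 3\pmod 4,\end{cases}$$ where $a_p,b_p\in\mathbb{Q}$ are defined by $\varepsilon_p^{h(p)}=a_p+b_p\sqrt{p}$.
   Context: $\left(\frac{\cdot}{p}\right)$ denotes the Legendre symbol modulo $p$. For an odd prime $p$, $\varepsilon_p$ denotes the fundamental unit (taken $>1$) and $h(p)$ the class number of the real quadratic field $\mathbb{Q}(\sqrt{p})$; the rationals $a_p,b_p$ are defined by $\varepsilon_p^{h(p)}=a_p+b_p\sqrt{p}$. *)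

theory Defs
  imports
    "HOL-Algebra.Ideal"
    "Jordan_Normal_Form.Determinant"
    "HOL-Number_Theory.Number_Theory"
begin

(* For a positive non-square d, the field Q(sqrt d) as a subfield of the reals, so that
   "fundamental unit > 1" refers to the usual order. *)
definition quad_field :: "nat \<Rightarrow> real set" where
  "quad_field d = {of_rat a + of_rat b * sqrt (real d) | a b. True}"

definition quad_integers :: "nat \<Rightarrow> real ring" where
  "quad_integers d =
     \<lparr>carrier = {x \<in> quad_field d. algebraic_int x},
      monoid.mult = (*), monoid.one = 1, ring.zero = 0, ring.add = (+)\<rparr>"

definition nonzero_ideals :: "nat \<Rightarrow> real set set" where
  "nonzero_ideals d = {I. ideal I (quad_integers d) \<and> I \<noteq> {0}}"

(* Two nonzero integral ideals are in the same class iff they agree up to nonzero principal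
   factors; every class of fractional ideals modulo principal ones contains an integral ideal. *)
definition ideal_class_rel :: "nat \<Rightarrow> (real set \<times> real set) set" where
  "ideal_class_rel d =
     {(I, J). I \<in> nonzero_ideals d \<and> J \<in> nonzero_ideals d \<and>
        (\<exists>a \<in> carrier (quad_integers d) - {0}. \<exists>b \<in> carrier (quad_integers d) - {0}.
           (*) a ` I = (*) b ` J)}"

definition class_number :: "nat \<Rightarrow> nat" where
  "class_number d = card (nonzero_ideals d // ideal_class_rel d)"

definition fundamental_unit :: "nat \<Rightarrow> real" where
  "fundamental_unit d =
     (THE u. u \<in> Units (quad_integers d) \<and> u > 1 \<and>
        (\<forall>v \<in> Units (quad_integers d). \<exists>k::int. v = u powi k \<or> v = - (u powi k)))"

definition unit_coeffs :: "nat \<Rightarrow> rat \<times> rat" where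
  "unit_coeffs d =
     (THE c. fundamental_unit d ^ class_number d =
        of_rat (fst c) + of_rat (snd c) * sqrt (real d))"

definition a_coeff :: "nat \<Rightarrow> rat" where
  "a_coeff d = fst (unit_coeffs d)"

definition b_coeff :: "nat \<Rightarrow> rat" where
  "b_coeff d = snd (unit_coeffs d)"

definition a_entry :: "nat \<Rightarrow> nat \<Rightarrow> nat \<Rightarrow> int" where
  "a_entry p i j =
     (if i = 1 then Legendre (int j) (int p) else Legendre (int (i + j)) (int p))"

(* Matrix indices start at 0, hence the shift; [:c, 1:] is the polynomial x + c. *)
definition A_mat :: "nat \<Rightarrow> int poly mat" where
  "A_mat p = mat ((p - 1) div 2) ((p - 1) div 2)
     (\<lambda>(i, j). [:a_entry p (i + 1) (j + 1), 1:])"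

end

theory Submission
  imports
    "HOL-Analysis.Interval_Integral"
    "HOL-Analysis.Complex_Transcendental"
    "HOL-Computational_Algebra.Nth_Powers"
    "Jordan_Normal_Form.Char_Poly"
    Defs
begin

text \<open>
  Let \<open>\<chi>\<close> be the Legendre symbol, \<open>\<zeta>\<close> a primitive \<open>p\<close>-th root of unity, \<open>g\<close> the quadratic Gauss sum
  and \<open>m = (p - 1) / 2\<close>. If \<open>p\<close> does not divide \<open>i + j\<close>, then \<open>g \<chi>(i + j) - 1\<close> is twice the sum of
  \<open>\<zeta>^(r i) \<zeta>^(r j)\<close> over the quadratic residues \<open>r\<close>. At \<open>x = - 1 / g\<close> the matrix is therefore a product
  of two generalized Vandermonde matrices in the \<open>\<zeta>^r\<close>. Counting differences of residues, its determinant
  there is \<open>2^(m - 1) (- 1 / g - 1)\<close> if \<open>p\<close> is 3 modulo 4, and \<open>(2/p) 2^(m - 1) (g - 1) / F\<close> with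
  \<open>F = \<Prod> (1 - \<zeta>^r)\<close> if \<open>p\<close> is 1 modulo 4. The determinant is linear in \<open>x\<close> with integer coefficients and
  \<open>g\<close> is irrational, so this single value determines it, provided that \<open>\<epsilon>^h = sqrt p / F\<close>.

  The latter is the class number formula \<open>2 h ln \<epsilon> = sqrt p L(1, \<chi>)\<close> together with
  \<open>sqrt p L(1, \<chi>) = - \<Sum> \<chi>(k) ln |1 - \<zeta>^k|\<close>. The number of ideals of norm \<open>k\<close> is \<open>\<Sum> \<chi>(d)\<close> over the divisors
  \<open>d\<close> of \<open>k\<close>, so there are asymptotically \<open>L(1, \<chi>) n\<close> ideals of norm at most \<open>n\<close>. Those in a given class
  correspond to the points of a lattice in a hyperbolic sector that is a fundamental domain for the units, and
  there are asymptotically \<open>2 n ln \<epsilon> / sqrt p\<close> of them. The same count yields the existence of a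
  nontrivial unit and the finiteness of the class number.
\<close>

section \<open>The Legendre symbol and Gauss sums\<close>

text \<open>The point \<open>- 1 / g\<close> is forced: there an entry \<open>x + chi n\<close>
  becomes \<open>(g * chi n - 1) / g\<close>, and subtracting 1 is exactly what turns
  \<open>g * chi n\<close> into a power sum over residues alone. The exceptional first row replaces
  the exponent 1 by 0; this gap in the exponents produces an extra symmetric function of the nodes
  and thereby the factor \<open>g - 1\<close> or \<open>- g - 1\<close>. Both Vandermonde factors
  have the same nodes, so only a squared Vandermonde determinant occurs. It is a product over
  ordered pairs of residues up to sign, hence independent of the enumeration of the residues. The
  analytic half must assume neither a unit nor a finite class group. The lattice count is therefore
  made for an arbitrary sector constant \<open>E\<close>, which is specialised afterwards: to a huge
  value in order to produce a unit, and to the square of the fundamental unit for the class number.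
  Logarithms only see absolute values, so it also matters that \<open>F\<close> is a positive real
  number.\<close>

locale odd_prime =
  fixes p :: nat
  assumes prime_p: "prime p" and p_gt_2: "p > 2"
begin

definition chi :: "int \<Rightarrow> int" where "chi k = Legendre k (int p)"

abbreviation P :: "int set" where "P \<equiv> {0..<int p}"

abbreviation m :: nat where "m \<equiv> (p - 1) div 2"

lemma odd_p: "odd p"
  using prime_p p_gt_2 prime_odd_nat by blast

lemma p_eq: "p = 2 * m + 1"
  using odd_p by (auto elim: oddE)

lemma prime_int_p: "prime (int p)"
  using prime_p by simp

lemma bij_betw_affine_mod:
  assumes "\<not> int p dvd k"
  shows "bij_betw (\<lambda>x. (k * x + c) mod int p) P P"
proof -
  have inj: "inj_on (\<lambda>x. (k * x + c) mod int p) P"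
  proof (rule inj_onI)
    fix x y assume xy: "x \<in> P" "y \<in> P" "(k * x + c) mod int p = (k * y + c) mod int p"
    then have "int p dvd (k * x + c) - (k * y + c)"
      by (simp add: mod_eq_dvd_iff)
    then have "int p dvd k * (x - y)"
      by (simp add: algebra_simps)
    then have "int p dvd x - y"
      using assms prime_int_p by (simp add: prime_dvd_mult_iff)
    then have "x mod int p = y mod int p"
      by (simp add: mod_eq_dvd_iff)
    with xy show "x = y" by simp
  qed
  moreover have "(\<lambda>x. (k * x + c) mod int p) ` P \<subseteq> P"
    using p_gt_2 by auto
  ultimately have "(\<lambda>x. (k * x + c) mod int p) ` P = P"
    by (intro endo_inj_surj) auto
  with inj show ?thesis by (simp add: bij_betw_def)
qed

text \<open>Periodicity of the summand is stated as invariance under reduction modulo p, a form that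
  simplification proves for \<open>chi\<close> and \<open>e\<close>. These substitution rules drive
  the character sums below.\<close>

lemma sum_affine:
  fixes F :: "int \<Rightarrow> 'a :: comm_monoid_add"
  assumes "\<not> int p dvd k" and "\<And>x. F (x mod int p) = F x"
  shows "(\<Sum>x\<in>P. F (k * x + c)) = (\<Sum>x\<in>P. F x)"
  using sum.reindex_bij_betw[OF bij_betw_affine_mod[OF assms(1), of c], of F]
  by (simp add: assms(2))

lemma sum_shift:
  fixes F :: "int \<Rightarrow> 'a :: comm_monoid_add"
  assumes "\<And>x. F (x mod int p) = F x"
  shows "(\<Sum>x\<in>P. F (x + c)) = (\<Sum>x\<in>P. F x)"
  using sum_affine[of 1 F c] assms p_gt_2 by simp

lemma sum_scale:
  fixes F :: "int \<Rightarrow> 'a :: comm_monoid_add"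
  assumes "\<not> int p dvd k" and "\<And>x. F (x mod int p) = F x"
  shows "(\<Sum>x\<in>P. F (k * x)) = (\<Sum>x\<in>P. F x)"
  using sum_affine[of k F 0] assms by simp

lemma chi_mod [simp]: "chi (k mod int p) = chi k"
  by (simp add: chi_def Legendre_def QuadRes_def cong_def)

lemma chi_mod_add [simp]: "chi (k mod int p + c) = chi (k + c)"
  by (metis chi_mod mod_add_left_eq)

lemma chi_eq_0_iff: "chi k = 0 \<longleftrightarrow> int p dvd k"
  by (auto simp: chi_def Legendre_def cong_0_iff)

lemma chi_cases: "chi k = 1 \<or> chi k = -1 \<or> chi k = 0"
  by (auto simp: chi_def Legendre_def)

lemma abs_chi_le: "\<bar>chi k\<bar> \<le> 1"
  using chi_cases[of k] by auto

lemma chi_euler: "[chi k = k ^ m] (mod int p)"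
  using euler_criterion[OF prime_p p_gt_2] by (simp add: chi_def)

text \<open>Two values of absolute value at most 1 differ by at most 2, which is less than p.
  Euler's congruence thus becomes an equality, and identities between powers pass to
  \<open>chi\<close>.\<close>

lemma cong_small_eq:
  assumes "[a = b] (mod int p)" "\<bar>a\<bar> \<le> 1" "\<bar>b\<bar> \<le> 1"
  shows "a = b"
proof (rule ccontr)
  assume "a \<noteq> b"
  moreover have "int p dvd a - b"
    using assms(1) by (simp add: cong_iff_dvd_diff)
  ultimately have "int p \<le> \<bar>a - b\<bar>"
    by (intro zdvd_imp_le) auto
  moreover have "\<bar>a - b\<bar> \<le> 2" using assms by linarith
  ultimately show False using p_gt_2 by linarith
qed

lemma chi_mult: "chi (a * b) = chi a * chi b"
proof (rule cong_small_eq)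
  have "[chi (a * b) = a ^ m * b ^ m] (mod int p)"
    using chi_euler[of "a * b"] by (simp add: power_mult_distrib)
  also have "[a ^ m * b ^ m = chi a * chi b] (mod int p)"
    using chi_euler cong_mult cong_sym by blast
  finally show "[chi (a * b) = chi a * chi b] (mod int p)" .
  show "\<bar>chi (a * b)\<bar> \<le> 1" by (rule abs_chi_le)
  show "\<bar>chi a * chi b\<bar> \<le> 1"
    using chi_cases[of a] chi_cases[of b] by auto
qed

lemma chi_minus_1: "chi (-1) = (-1) ^ m"
proof (rule cong_small_eq)
  show "[chi (-1) = (-1) ^ m] (mod int p)" by (rule chi_euler)
qed (auto simp: abs_chi_le power_abs)

lemma chi_uminus: "chi (- k) = (-1) ^ m * chi k"
  using chi_mult[of "-1" k] chi_minus_1 by simp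

lemma chi_1 [simp]: "chi 1 = 1"
  using p_gt_2 by (auto simp: chi_def Legendre_def QuadRes_def cong_0_iff intro!: exI[of _ 1])

lemma chi_0 [simp]: "chi 0 = 0"
  by (simp add: chi_eq_0_iff)

lemma chi_p [simp]: "chi (int p) = 0"
  by (simp add: chi_eq_0_iff)

lemma chi_square: "\<not> int p dvd k \<Longrightarrow> chi k * chi k = 1"
  using chi_cases[of k] by (auto simp: chi_eq_0_iff)

text \<open>Otherwise squaring would be surjective on the finite set of residue classes, hence
  injective, although 1 and p - 1 have the same square.\<close>

lemma exists_nonresidue: "\<exists>n\<in>P. chi n = -1"
proof (rule ccontr)
  assume *: "\<not> ?thesis"
  have "y \<in> (\<lambda>x. x\<^sup>2 mod int p) ` P" if y: "y \<in> P" for y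
  proof -
    have "chi y = 0 \<or> chi y = 1" using * y chi_cases[of y] by auto
    then have "\<exists>x. [x\<^sup>2 = y] (mod int p)"
    proof
      assume "chi y = 0"
      then have "[0\<^sup>2 = y] (mod int p)" by (simp add: chi_eq_0_iff cong_0_iff cong_sym)
      then show ?thesis by blast
    next
      assume "chi y = 1"
      then show ?thesis by (auto simp: chi_def Legendre_def QuadRes_def split: if_splits)
    qed
    then obtain x where "[x\<^sup>2 = y] (mod int p)" by blast
    then have "(x mod int p)\<^sup>2 mod int p = y"
      using y by (simp add: cong_def power_mod)
    moreover have "x mod int p \<in> P" using p_gt_2 by simp
    ultimately show ?thesis by blast
  qed
  then have "inj_on (\<lambda>x. x\<^sup>2 mod int p) P"
    by (intro finite_surj_inj) auto
  moreover have "1 \<in> P" "int p - 1 \<in> P" using p_gt_2 by auto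
  moreover have "1\<^sup>2 mod int p = (int p - 1)\<^sup>2 mod int p"
  proof -
    have "(int p - 1)\<^sup>2 = 1 + int p * (int p - 2)"
      by (simp add: power2_eq_square algebra_simps)
    then show ?thesis by (metis mod_mult_self2 one_power2)
  qed
  ultimately have "1 = int p - 1" by (meson inj_onD)
  then show False using p_gt_2 by simp
qed

section \<open>Character sums and the number of residues with a given difference\<close>

lemma sum_chi: "(\<Sum>k\<in>P. chi k) = 0"
proof -
  obtain n where n: "n \<in> P" "chi n = -1" using exists_nonresidue by blast
  then have "\<not> int p dvd n" by (simp flip: chi_eq_0_iff)
  then have "(\<Sum>k\<in>P. chi (n * k)) = (\<Sum>k\<in>P. chi k)"
    by (rule sum_scale) simp
  then show ?thesis by (simp add: chi_mult n sum_negf)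
qed

lemma chi_square_sum: "(\<Sum>k\<in>P. chi k * chi k) = int p - 1"
proof -
  have "(\<Sum>k\<in>P. chi k * chi k) = (\<Sum>k\<in>P - {0}. chi k * chi k)"
    by (rule sum.mono_neutral_right) auto
  also have "\<dots> = (\<Sum>k\<in>P - {0}. 1)"
    by (rule sum.cong) (auto intro!: chi_square dest: zdvd_imp_le)
  also have "\<dots> = int p - 1" using p_gt_2 by (simp add: card_Diff_subset)
  finally show ?thesis .
qed

text \<open>The substitution x -> c x makes the sum independent of the nonzero c. Summed over all c
  it vanishes, because \<open>chi\<close> sums to 0; the term c = 0 is p - 1, so each of the p - 1
  other terms is -1.\<close>

lemma jacobsthal_sum:
  assumes "\<not> int p dvd c"
  shows "(\<Sum>x\<in>P. chi x * chi (x + c)) = -1"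
proof -
  define S where "S c = (\<Sum>x\<in>P. chi x * chi (x + c))" for c
  have S1: "S c = S 1" if "\<not> int p dvd c" for c
  proof -
    have "S c = (\<Sum>x\<in>P. chi (c * x) * chi (c * x + c))"
      unfolding S_def using that
      by (subst sum_scale[where F = "\<lambda>x. chi x * chi (x + c)"]) auto
    also have "\<dots> = (\<Sum>x\<in>P. (chi c * chi c) * (chi x * chi (x + 1)))"
    proof (rule sum.cong)
      fix x
      have "c * x + c = c * (x + 1)" by (simp add: algebra_simps)
      then show "chi (c * x) * chi (c * x + c) = chi c * chi c * (chi x * chi (x + 1))"
        by (simp only: chi_mult) (simp add: algebra_simps)
    qed auto
    also have "\<dots> = S 1" using that by (simp add: chi_square S_def)
    finally show ?thesis .
  qed
  have "(\<Sum>c\<in>P. S c) = (\<Sum>x\<in>P. chi x * (\<Sum>c\<in>P. chi (c + x)))"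
    unfolding S_def by (subst sum.swap) (simp add: sum_distrib_left add.commute)
  also have "\<dots> = 0" by (simp add: sum_shift sum_chi)
  finally have "0 = (\<Sum>c\<in>P. S c)" ..
  also have "\<dots> = S 0 + (\<Sum>c\<in>P - {0}. S c)"
    using p_gt_2 by (subst sum.remove[of _ 0]) auto
  also have "(\<Sum>c\<in>P - {0}. S c) = (\<Sum>c\<in>P - {0}. S 1)"
    by (rule sum.cong) (auto intro!: S1 dest: zdvd_imp_le)
  also have "\<dots> = (int p - 1) * S 1" using p_gt_2 by (simp add: card_Diff_subset)
  also have "S 0 = int p - 1" using chi_square_sum by (simp add: S_def)
  finally have "0 = (int p - 1) + (int p - 1) * S 1" .
  then have "(int p - 1) * (S 1 + 1) = 0" by (simp only: distrib_left mult_1_right add.commute)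
  then have "S 1 + 1 = 0" using p_gt_2 by (subst (asm) mult_eq_0_iff) auto
  then have "S 1 = -1" by simp
  with S1[OF assms] show ?thesis by (simp add: S_def)
qed

definition Res :: "int set" where "Res = {r\<in>P. chi r = 1}"
definition NRes :: "int set" where "NRes = {r\<in>P. chi r = -1}"

lemma finite_Res [simp]: "finite Res" "finite NRes" unfolding Res_def NRes_def by (rule finite_Collect_conjI, simp)+

lemma P_decomp: "P - {0} = Res \<union> NRes" "Res \<inter> NRes = {}"
proof -
  show "P - {0} = Res \<union> NRes"
  proof (intro equalityI subsetI)
    fix x assume x: "x \<in> P - {0}"
    then have "chi x \<noteq> 0" by (auto simp: chi_eq_0_iff dest: zdvd_imp_le)
    then show "x \<in> Res \<union> NRes" using x chi_cases[of x] by (auto simp: Res_def NRes_def)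
  next
    fix x assume "x \<in> Res \<union> NRes"
    then have "x \<in> P" "chi x \<noteq> 0" by (auto simp: Res_def NRes_def)
    then show "x \<in> P - {0}" by auto
  qed
qed (auto simp: Res_def NRes_def)

lemma sum_chi_times:
  fixes F :: "int \<Rightarrow> 'a :: comm_ring_1"
  shows "(\<Sum>k\<in>P. of_int (chi k) * F k) = (\<Sum>k\<in>Res. F k) - (\<Sum>k\<in>NRes. F k)"
proof -
  have "(\<Sum>k\<in>P. of_int (chi k) * F k) = (\<Sum>k\<in>Res \<union> NRes. of_int (chi k) * F k)"
    by (subst P_decomp(1)[symmetric], rule sum.mono_neutral_right) auto
  also have "\<dots> = (\<Sum>k\<in>Res. of_int (chi k) * F k) + (\<Sum>k\<in>NRes. of_int (chi k) * F k)"
    by (rule sum.union_disjoint) (auto simp: P_decomp)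
  also have "(\<Sum>k\<in>Res. of_int (chi k) * F k) = (\<Sum>k\<in>Res. F k)"
    by (rule sum.cong) (auto simp: Res_def)
  also have "(\<Sum>k\<in>NRes. of_int (chi k) * F k) = - (\<Sum>k\<in>NRes. F k)"
    by (subst sum_negf[symmetric], rule sum.cong) (auto simp: NRes_def)
  finally show ?thesis by simp
qed

lemma sum_P_decomp:
  fixes F :: "int \<Rightarrow> 'a :: comm_monoid_add"
  shows "(\<Sum>k\<in>P. F k) = F 0 + ((\<Sum>k\<in>Res. F k) + (\<Sum>k\<in>NRes. F k))"
proof -
  have "(\<Sum>k\<in>P. F k) = F 0 + (\<Sum>k\<in>P - {0}. F k)"
    using p_gt_2 by (subst sum.remove[of _ 0]) auto
  then show ?thesis by (simp add: P_decomp sum.union_disjoint)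
qed

lemma card_Res: "card Res = m" "card NRes = m"
proof -
  have "int (card Res) - int (card NRes) = 0"
    using sum_chi_times[of "\<lambda>_. 1 :: int"] sum_chi by simp
  moreover have "int p = 1 + (int (card Res) + int (card NRes))"
    using sum_P_decomp[of "\<lambda>_. 1 :: int"] by simp
  ultimately show "card Res = m" "card NRes = m" by linarith+
qed

text \<open>The products \<open>(1 + chi x) (1 + chi (x + c))\<close> are four times the indicator of the set
  being counted, except at \<open>x = 0\<close> and \<open>x = - c\<close>.\<close>

lemma card_residue_differences:
  assumes c: "c \<in> P - {0}"
  shows "4 * int (card {r\<in>Res. chi (r + c) = 1}) = int p - 3 - chi c - chi (- c)"
proof -
  have nd: "\<not> int p dvd c" using c by (auto dest: zdvd_imp_le)
  define H where "H x = (1 + chi x) * (1 + chi (x + c))" for x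
  \<comment> \<open>The four sums of the expanded product are p, 0, 0 and -1.\<close>
  have "(\<Sum>x\<in>P. H x) = (\<Sum>x\<in>P. 1 + chi x + chi (x + c) + chi x * chi (x + c))"
    by (rule sum.cong) (auto simp: H_def algebra_simps)
  also have "\<dots> = int p - 1"
    using jacobsthal_sum[OF nd] sum_shift[of chi c] sum_chi by (simp add: sum.distrib)
  finally have 1: "(\<Sum>x\<in>P. H x) = int p - 1" .
  have "(\<Sum>x\<in>P. H x) = H 0 + (H (int p - c) + (\<Sum>x\<in>P - {0} - {int p - c}. H x))"
    using c p_gt_2 by (subst sum.remove[of _ 0], simp, simp, subst sum.remove[of _ "int p - c"]) auto
  also have "H 0 = 1 + chi c" by (simp add: H_def)
  also have "H (int p - c) = 1 + chi (- c)"
    using chi_mod[of "int p - c"] chi_mod[of "-c"] by (simp add: H_def chi_eq_0_iff)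
  also have "(\<Sum>x\<in>P - {0} - {int p - c}. H x) = (\<Sum>x\<in>P - {0} - {int p - c}. if x \<in> Res \<and> chi (x + c) = 1 then 4 else 0)"
  proof (rule sum.cong)
    fix x assume x: "x \<in> P - {0} - {int p - c}"
    then have "chi x \<noteq> 0" by (auto simp: chi_eq_0_iff dest: zdvd_imp_le)
    moreover have "chi (x + c) \<noteq> 0"
    proof
      assume "chi (x + c) = 0"
      then obtain k where k: "x + c = int p * k" by (auto simp: chi_eq_0_iff)
      have "0 < x + c" "x + c < 2 * int p" using x c by auto
      then have k2: "0 < int p * k" "int p * k < 2 * int p" using k by linarith+
      have "0 < k" using k2(1) by (simp add: zero_less_mult_iff)
      moreover have "k < 2"
      proof (rule ccontr)
        assume "\<not> k < 2"
        then have "int p * 2 \<le> int p * k" by (intro mult_left_mono) auto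
        then show False using k2 by linarith
      qed
      ultimately have "k = 1" by simp
      then show False using k x by auto
    qed
    ultimately show "H x = (if x \<in> Res \<and> chi (x + c) = 1 then 4 else 0)"
      using x chi_cases[of x] chi_cases[of "x + c"] by (auto simp: H_def Res_def)
  qed auto
  also have "\<dots> = (\<Sum>x | x \<in> P - {0} - {int p - c} \<and> x \<in> Res \<and> chi (x + c) = 1. 4)"
    by (subst sum.inter_filter[symmetric]) auto
  also have "{x. x \<in> P - {0} - {int p - c} \<and> x \<in> Res \<and> chi (x + c) = 1} = {r\<in>Res. chi (r + c) = 1}"
    by (auto simp: Res_def chi_eq_0_iff)
  finally show ?thesis using 1 by simp
qed

text \<open>Gauss's lemma: the doubles of 1, ..., m stay below p, so no reduction occurs, and those
  larger than m come from the numbers above \<open>m div 2\<close>.\<close>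

lemma chi_2: "chi 2 = (-1) ^ (m - m div 2)"
proof -
  interpret GAUSS p 2
    using prime_p p_gt_2 by unfold_locales (auto simp: cong_0_iff dest: zdvd_imp_le)
  have Cx: "C = (\<lambda>x. x * 2) ` A"
    unfolding C_def B_def image_image
    by (rule image_cong) (use p_eq in \<open>auto simp: A_def\<close>)
  have "E = (\<lambda>x. x * 2) ` {int (m div 2) + 1..int m}"
    unfolding E_def Cx A_def using p_eq by (auto simp: image_iff)
  then have "card E = card {int (m div 2) + 1..int m}"
    by (simp add: card_image inj_on_def)
  also have "\<dots> = m - m div 2"
    unfolding card_atLeastAtMost_int by (simp add: nat_diff_distrib')
  finally show ?thesis using gauss_lemma by (simp add: chi_def)
qed

end

section \<open>Roots of unity of order p and the quadratic Gauss sum\<close>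

locale prime_root = odd_prime +
  fixes \<zeta> :: complex
  assumes \<zeta>_power: "\<zeta> ^ p = 1" and \<zeta>_neq_1: "\<zeta> \<noteq> 1"
begin

definition e :: "int \<Rightarrow> complex" where "e k = \<zeta> powi k"

lemma \<zeta>_nz: "\<zeta> \<noteq> 0"
  using \<zeta>_power p_gt_2 by (auto simp: power_0_left)

lemma e_add: "e (a + b) = e a * e b"
  by (simp add: e_def power_int_add \<zeta>_nz)

lemma e_0 [simp]: "e 0 = 1" by (simp add: e_def)

lemma e_nz [simp]: "e k \<noteq> 0" by (simp add: e_def \<zeta>_nz)

lemma e_mult_p [simp]: "e (int p * k) = 1"
  by (simp add: e_def power_int_mult \<zeta>_power)

lemma e_mod [simp]: "e (k mod int p) = e k"
proof -
  have "e k = e (int p * (k div int p) + k mod int p)" by simp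
  also have "\<dots> = e (k mod int p)" by (simp only: e_add e_mult_p) simp
  finally show ?thesis ..
qed

lemma e_mult_nat: "e (k * int n) = e k ^ n"
  by (simp add: e_def power_int_mult)

lemma norm_e [simp]: "norm (e k) = 1"
proof -
  have "norm \<zeta> ^ p = 1" by (simp add: \<zeta>_power flip: norm_power)
  then have "norm \<zeta> = 1"
    using power_eq_imp_eq_base[of "norm \<zeta>" p 1] p_gt_2 by simp
  then show ?thesis by (simp add: e_def norm_power_int)
qed

lemma cnj_e: "cnj (e k) = e (- k)"
proof -
  have "e k * cnj (e k) = 1" by (simp flip: complex_norm_square)
  moreover have "e k * e (- k) = 1" by (simp flip: e_add)
  ultimately show ?thesis by (metis e_nz mult_cancel_left)
qed

lemma e_eq_1_iff: "e k = 1 \<longleftrightarrow> int p dvd k"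
proof
  assume k: "e k = 1"
  show "int p dvd k"
  proof (rule ccontr)
    assume "\<not> int p dvd k"
    then have "coprime k (int p)"
      using prime_int_p prime_imp_coprime coprime_commute by blast
    then obtain u v where uv: "u * k + v * int p = 1"
      using bezout_int[of k "int p"] by (auto simp: coprime_iff_gcd_eq_1)
    have "e 1 = e (u * k + v * int p)" by (simp add: uv)
    also have "\<dots> = (e k) powi u * e (int p * v)"
      by (simp only: e_add mult.commute[of u k] mult.commute[of v]) (simp only: e_def power_int_mult)
    also have "\<dots> = 1" by (simp add: k)
    finally show False using \<zeta>_neq_1 by (simp add: e_def)
  qed
qed auto

lemma e_eq_iff: "e a = e b \<longleftrightarrow> int p dvd a - b"
proof -
  have "e a = e (a - b) * e b" by (simp flip: e_add)
  then show ?thesis by (simp add: e_eq_1_iff)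
qed

lemma inj_on_e: "inj_on e P"
  by (auto simp: inj_on_def e_eq_iff simp flip: mod_eq_dvd_iff)

text \<open>Orthogonality: the shift k -> k + 1 multiplies the sum of all roots by
  \<open>e 1\<close>, which is not 1.\<close>

lemma sum_e_mult: "(\<Sum>k\<in>P. e (k * n)) = (if int p dvd n then of_nat p else 0)"
proof (cases "int p dvd n")
  case True
  then have "e (k * n) = 1" for k by (simp add: e_eq_1_iff)
  then show ?thesis using True by simp
next
  case False
  have "(\<Sum>k\<in>P. e (k * n)) = (\<Sum>k\<in>P. e k)"
    using sum_scale[OF False, of e] by (simp add: mult.commute)
  moreover have "e 1 * (\<Sum>k\<in>P. e k) = (\<Sum>k\<in>P. e k)"
    using sum_shift[of e 1] by (simp add: e_add sum_distrib_left mult.commute)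
  moreover have "e 1 \<noteq> 1" using \<zeta>_neq_1 by (simp add: e_def)
  ultimately show ?thesis using False by auto
qed

text \<open>The root of unity is arbitrary. The sign of \<open>g\<close> depends on it and appears
  as an explicit hypothesis where it matters.\<close>

definition g :: complex where "g = (\<Sum>k\<in>P. of_int (chi k) * e k)"

text \<open>For n prime to p substitute k -> n k; for p dividing n both sides are 0. The identity
  thus holds for every n and can be applied to all coefficients of a power series.\<close>

lemma gauss_sum_twist: "(\<Sum>k\<in>P. of_int (chi k) * e (k * n)) = of_int (chi n) * g"
proof (cases "int p dvd n")
  case True
  then have "e (k * n) = 1" for k by (simp add: e_eq_1_iff)
  then have "(\<Sum>k\<in>P. of_int (chi k) * e (k * n)) = of_int (\<Sum>k\<in>P. chi k)" by simp
  then show ?thesis using True chi_eq_0_iff by (simp add: sum_chi del: of_int_sum)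
next
  case False
  have "g = (\<Sum>k\<in>P. of_int (chi (n * k)) * e (n * k))"
    unfolding g_def using False by (subst sum_scale[where F = "\<lambda>k. of_int (chi k) * e k"]) auto
  also have "\<dots> = of_int (chi n) * (\<Sum>k\<in>P. of_int (chi k) * e (k * n))"
    by (simp add: chi_mult sum_distrib_left mult_ac)
  finally have "of_int (chi n) * g = of_int (chi n * chi n) * (\<Sum>k\<in>P. of_int (chi k) * e (k * n))"
    by simp
  then show ?thesis by (simp only: chi_square[OF False]) simp
qed

text \<open>The squares of the twisted sums, added over all n, are computed twice: by orthogonality,
  which keeps only l = - k, and by \<open>gauss_sum_twist\<close>, which gives p - 1 copies of
  \<open>g\<^sup>2\<close>.\<close>

lemma gauss_sum_square: "g\<^sup>2 = of_int (chi (-1)) * of_nat p"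
proof -
  have "(\<Sum>n\<in>P. (\<Sum>k\<in>P. of_int (chi k) * e (k * n))\<^sup>2) =
      (\<Sum>n\<in>P. \<Sum>k\<in>P. \<Sum>l\<in>P. of_int (chi k) * of_int (chi l) * e (n * (k + l)))"
    by (simp add: power2_eq_square sum_product algebra_simps e_add)
  also have "\<dots> = (\<Sum>k\<in>P. \<Sum>l\<in>P. of_int (chi k) * of_int (chi l) * (\<Sum>n\<in>P. e (n * (k + l))))"
    by (subst sum.swap, rule sum.cong[OF refl], subst sum.swap) (simp add: sum_distrib_left)
  also have "\<dots> = (\<Sum>k\<in>P. \<Sum>l\<in>P. if l = (- k) mod int p then of_int (chi k * chi (-k)) * of_nat p else 0)"
  proof (intro sum.cong refl)
    fix k l assume l: "l \<in> P"
    have "int p dvd k + l \<longleftrightarrow> l mod int p = (- k) mod int p"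
      by (simp add: mod_eq_dvd_iff add.commute)
    also have "\<dots> \<longleftrightarrow> l = (- k) mod int p" using l by simp
    finally show "of_int (chi k) * of_int (chi l) * (\<Sum>n\<in>P. e (n * (k + l)))
      = (if l = (- k) mod int p then of_int (chi k * chi (-k)) * of_nat p else 0)"
      by (simp add: sum_e_mult)
  qed
  also have "\<dots> = (\<Sum>k\<in>P. of_int (chi k * chi (-k)) * of_nat p)"
    using p_gt_2 by (simp add: sum.delta)
  also have "\<dots> = of_int (\<Sum>k\<in>P. chi k * chi k) * (of_int (chi (-1)) * of_nat p)"
    by (simp add: chi_uminus chi_minus_1 sum_distrib_left sum_distrib_right mult_ac)
  also have "\<dots> = (of_nat p - 1) * (of_int (chi (-1)) * of_nat p)"
    by (simp only: chi_square_sum) simp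
  finally have 1: "(\<Sum>n\<in>P. (\<Sum>k\<in>P. of_int (chi k) * e (k * n))\<^sup>2) = \<dots>" .
  have "(\<Sum>n\<in>P. (\<Sum>k\<in>P. of_int (chi k) * e (k * n))\<^sup>2) = of_int (\<Sum>k\<in>P. chi k * chi k) * g\<^sup>2"
    unfolding gauss_sum_twist by (simp add: power2_eq_square sum_distrib_left mult_ac)
  also have "\<dots> = (of_nat p - 1) * g\<^sup>2" by (simp only: chi_square_sum) simp
  finally have "(of_nat p - 1) * g\<^sup>2 = (of_nat p - 1 :: complex) * (of_int (chi (-1)) * of_nat p)"
    by (simp only: 1)
  moreover have "(of_nat p - 1 :: complex) \<noteq> 0"
    using p_gt_2 by (simp add: of_nat_eq_1_iff)
  ultimately show ?thesis by simp
qed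

text \<open>The sum and the difference of the exponential sums over residues and over nonresidues
  are known, hence also the sum over residues.\<close>

lemma sum_e_Res: "2 * (\<Sum>r\<in>Res. e (r * n)) = of_int (chi n) * g - 1 + (if int p dvd n then of_nat p else 0)"
proof -
  define A B where "A = (\<Sum>r\<in>Res. e (r * n))" and "B = (\<Sum>r\<in>NRes. e (r * n))"
  have "A - B = of_int (chi n) * g"
    using gauss_sum_twist[of n] sum_chi_times[of "\<lambda>k. e (k * n)"] by (simp add: A_def B_def)
  moreover have "1 + (A + B) = (if int p dvd n then of_nat p else 0)"
    using sum_P_decomp[of "\<lambda>k. e (k * n)"] sum_e_mult[of n] by (simp add: A_def B_def)
  moreover have "A + A = (A - B) - 1 + (1 + (A + B))" by simp
  ultimately have "A + A = of_int (chi n) * g - 1 + (if int p dvd n then of_nat p else 0)"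
    by simp
  then show ?thesis by (simp add: A_def)
qed

text \<open>Both sides are monic of degree p and vanish at the p distinct numbers
  \<open>e k\<close>, so a nonzero difference would have more roots than its degree.\<close>

lemma prod_linear_factors: "(\<Prod>k\<in>P. [:- e k, 1:]) = Polynomial.monom 1 p - 1"
proof (rule ccontr)
  assume ne: "\<not> ?thesis"
  define D where "D = (\<Prod>k\<in>P. [:- e k, 1:]) - (Polynomial.monom 1 p - 1)"
  have d1: "degree (\<Prod>k\<in>P. [:- e k, 1:]) = p"
    by (subst degree_prod_eq_sum_degree) auto
  have c1: "Polynomial.coeff (\<Prod>k\<in>P. [:- e k, 1:]) p = 1"
    using d1 lead_coeff_prod[of "\<lambda>k. [:- e k, 1:]" P] by simp
  have "degree D \<le> p"
    unfolding D_def by (intro degree_diff_le) (auto simp: d1 degree_monom_le)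
  moreover have "Polynomial.coeff D p = 0"
    using p_gt_2 c1 by (simp add: D_def)
  moreover have "D \<noteq> 0" using ne by (simp add: D_def)
  ultimately have "degree D < p"
    by (metis le_neq_implies_less leading_coeff_0_iff)
  moreover have "e ` P \<subseteq> {x. poly D x = 0}"
  proof (intro image_subsetI CollectI)
    fix k assume "k \<in> P"
    then have "poly (\<Prod>k\<in>P. [:- e k, 1:]) (e k) = 0"
      by (auto simp: poly_prod)
    moreover have "e k ^ p = 1" by (metis e_mult_nat e_mult_p mult.commute)
    ultimately show "poly D (e k) = 0" by (simp add: D_def poly_monom)
  qed
  then have "card (e ` P) \<le> card {x. poly D x = 0}"
    using \<open>D \<noteq> 0\<close> by (intro card_mono poly_roots_finite)
  then have "p \<le> degree D"
    using \<open>D \<noteq> 0\<close> card_poly_roots_bound[of D] inj_on_e by (simp add: card_image)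
  ultimately show False by simp
qed

text \<open>Cancelling X - 1 leaves the sum of the powers of X below p, which is evaluated at
  1.\<close>

lemma prod_one_minus_e: "(\<Prod>k\<in>P - {0}. (1 - e k)) = of_nat p"
proof -
  have "[:-1, 1:] * (\<Prod>k\<in>P - {0}. [:- e k, 1:]) = (\<Prod>k\<in>P. [:- e k, 1:])"
    using p_gt_2 by (subst prod.remove[of P 0]) auto
  also have "\<dots> = [:-1, 1:] * (\<Sum>i<p. Polynomial.monom 1 i)"
    using power_diff_1_eq[of "[:0, 1 :: complex:]" p] unfolding prod_linear_factors
    by (simp add: monom_altdef one_pCons)
  finally have "(\<Prod>k\<in>P - {0}. [:- e k, 1:]) = (\<Sum>i<p. Polynomial.monom 1 i)"
    by (subst (asm) mult_cancel_left) auto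
  then have "poly (\<Prod>k\<in>P - {0}. [:- e k, 1:]) 1 = poly (\<Sum>i<p. Polynomial.monom 1 i) 1" by simp
  then show ?thesis by (simp add: poly_prod poly_sum poly_monom)
qed

end

section \<open>The determinant at \<open>- 1 / g\<close>\<close>

lemma det_lower_triangular_mat:
  fixes f :: "nat \<times> nat \<Rightarrow> 'a :: comm_ring_1"
  assumes "\<And>i j. i < j \<Longrightarrow> j < n \<Longrightarrow> f (i, j) = 0"
  shows "det (mat n n f) = (\<Prod>i<n. f (i, i))"
  by (subst det_lower_triangular[of n])
     (auto simp: assms prod_list_diag_prod atLeast0LessThan)

lemma det_scale_columns:
  fixes f :: "nat \<Rightarrow> nat \<Rightarrow> 'a :: comm_ring_1"
  shows "det (mat n n (\<lambda>(i, j). f i j * d j)) = (\<Prod>j<n. d j) * det (mat n n (\<lambda>(i, j). f i j))"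
proof -
  have "mat n n (\<lambda>(i, j). f i j * d j) =
      mat n n (\<lambda>(i, j). f i j) * mat n n (\<lambda>(i, j). if i = j then d i else 0)"
    by (rule eq_matI) (auto simp: scalar_prod_def if_distrib[of "\<lambda>x. _ * x"] sum.delta' cong: if_cong)
  then have "det (mat n n (\<lambda>(i, j). f i j * d j)) =
      det (mat n n (\<lambda>(i, j). f i j)) * det (mat n n (\<lambda>(i, j). if i = j then d i else 0))"
    by (simp add: det_mult[of _ n])
  then show ?thesis by (simp add: det_lower_triangular_mat mult.commute)
qed

definition vandermonde :: "nat \<Rightarrow> (nat \<Rightarrow> 'a :: comm_ring_1) \<Rightarrow> 'a" where
  "vandermonde n y = (\<Prod>j<n. \<Prod>i<j. y j - y i)"

lemma vandermonde_Suc_shift: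
  "vandermonde (Suc n) y = (\<Prod>j<n. y (Suc j) - y 0) * vandermonde n (\<lambda>i. y (Suc i))"
proof -
  have "vandermonde (Suc n) y = (\<Prod>j<n. \<Prod>i<Suc j. y (Suc j) - y i)"
    unfolding vandermonde_def by (subst prod.lessThan_Suc_shift) simp
  also have "\<dots> = (\<Prod>j<n. (y (Suc j) - y 0) * (\<Prod>i<j. y (Suc j) - y (Suc i)))"
    by (intro prod.cong refl prod.lessThan_Suc_shift)
  finally show ?thesis by (simp add: prod.distrib vandermonde_def)
qed

text \<open>The unipotent matrix \<open>B\<close> subtracts \<open>y 0\<close> times each row from
  the next one. Column 0 then becomes the first unit vector, and every other column j of the
  remaining minor carries the factor \<open>y j - y 0\<close>.\<close>

lemma det_vandermonde:
  fixes y :: "nat \<Rightarrow> 'a :: comm_ring_1"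
  shows "det (mat n n (\<lambda>(i, j). y j ^ i)) = vandermonde n y"
proof (induction n arbitrary: y)
  case 0
  then show ?case by (simp add: vandermonde_def)
next
  case (Suc n)
  define V where "V = mat (Suc n) (Suc n) (\<lambda>(i, j). y j ^ i)"
  define B where "B = mat (Suc n) (Suc n)
    (\<lambda>(i, j). if i = j then 1 else if i = Suc j then - y 0 else 0)"
  have dB: "det B = 1" unfolding B_def by (subst det_lower_triangular_mat) auto
  have BV: "(B * V) $$ (i, j) = (if i = 0 then 1 else y j ^ (i - 1) * (y j - y 0))"
    if ij: "i < Suc n" "j < Suc n" for i j
  proof -
    have "(B * V) $$ (i, j) = (\<Sum>k<Suc n. (if i = k then 1 else if i = Suc k then - y 0 else 0) * y j ^ k)"
      using ij by (simp add: B_def V_def scalar_prod_def atLeast0LessThan del: sum.lessThan_Suc)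
    also have "\<dots> = (\<Sum>k<Suc n. (if i = k then y j ^ k else 0) + (if i = Suc k then - y 0 * y j ^ k else 0))"
      by (rule sum.cong) auto
    also have "\<dots> = y j ^ i + (\<Sum>k<Suc n. if i = Suc k then - y 0 * y j ^ k else 0)"
      using ij by (simp add: sum.distrib sum.delta' del: sum.lessThan_Suc)
    also have "\<dots> = (if i = 0 then 1 else y j ^ (i - 1) * (y j - y 0))"
    proof (cases i)
      case (Suc k)
      then have "(\<Sum>l<Suc n. if i = Suc l then - y 0 * y j ^ l else 0) = - y 0 * y j ^ k"
        using ij by (simp add: sum.delta' del: sum.lessThan_Suc)
      then show ?thesis using Suc by (simp add: algebra_simps)
    qed simp
    finally show ?thesis .
  qed
  define C where "C = mat (Suc n) (Suc n) (\<lambda>(i, j). if i = 0 then 1 else y j ^ (i - 1) * (y j - y 0))"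
  have BVC: "B * V = C"
  proof (rule eq_matI)
    fix i j assume "i < dim_row C" "j < dim_col C"
    then have ij: "i < Suc n" "j < Suc n" by (simp_all add: C_def)
    then show "(B * V) $$ (i, j) = C $$ (i, j)" by (simp only: BV) (simp add: C_def)
  qed (auto simp: B_def V_def C_def)
  have "det V = det (B * V)"
    using det_mult[of B "Suc n" V] dB by (simp add: B_def V_def)
  also have "\<dots> = (\<Sum>i<Suc n. C $$ (i, 0) * cofactor C i 0)"
    unfolding BVC by (rule laplace_expansion_column) (auto simp: C_def)
  also have "\<dots> = cofactor C 0 0"
    by (subst sum.lessThan_Suc_shift) (simp add: C_def)
  also have "\<dots> = det (mat_delete C 0 0)"
    by (simp add: cofactor_def)
  also have "mat_delete C 0 0 = mat n n (\<lambda>(i, j). y (Suc j) ^ i * (y (Suc j) - y 0))"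
    by (rule eq_matI) (auto simp: mat_delete_def C_def)
  also have "det \<dots> = (\<Prod>j<n. y (Suc j) - y 0) * vandermonde n (\<lambda>i. y (Suc i))"
    using det_scale_columns[of n "\<lambda>i j. y (Suc j) ^ i" "\<lambda>j. y (Suc j) - y 0"] Suc by simp
  finally show ?case by (simp add: vandermonde_Suc_shift V_def)
qed

lemma minus_one_power_poly: "(-1) ^ i = [:(-1 :: 'a :: comm_ring_1) ^ i:]"
proof -
  have "(-1 :: 'a poly) = [:-1:]" by (simp add: one_pCons)
  then show ?thesis by (simp add: poly_const_pow)
qed

lemma prod_const_poly: "(\<Prod>i\<in>A. [:f i:]) = [:\<Prod>i\<in>A. f i:]"
  by (induction A rule: infinite_finite_induct) (auto simp: one_pCons mult.commute)

lemma det_const_poly: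
  fixes f :: "nat \<Rightarrow> nat \<Rightarrow> 'a :: comm_ring_1"
  shows "det (mat n n (\<lambda>(i, j). [:f i j:])) = [:det (mat n n (\<lambda>(i, j). f i j)):]"
proof -
  interpret c: comm_ring_hom "\<lambda>a :: 'a. [:a:]"
    by unfold_locales (auto simp: one_pCons)
  have "mat n n (\<lambda>(i, j). [:f i j:]) = map_mat (\<lambda>a. [:a:]) (mat n n (\<lambda>(i, j). f i j))"
    by (rule eq_matI) auto
  then show ?thesis by simp
qed

text \<open>The determinant with the row of exponent \<open>1\<close> omitted is read off as the linear coefficient
  of a Vandermonde determinant in which one variable is a polynomial indeterminate.\<close>

lemma det_vandermonde_skip_1:
  fixes y :: "nat \<Rightarrow> 'a :: idom"
  assumes "n > 0"
  shows "det (mat n n (\<lambda>(i, j). y j ^ (if i = 0 then 0 else Suc i))) =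
    (\<Sum>j<n. \<Prod>i\<in>{..<n} - {j}. y i) * vandermonde n y"
proof -
  define Y where "Y = case_nat [:0, 1:] (\<lambda>j. [:y j:])"
  define M where "M = mat (Suc n) (Suc n) (\<lambda>(i, j). Y j ^ i)"
  define D where "D i = det (mat n n (\<lambda>(i', j). y j ^ (if i' < i then i' else Suc i')))" for i
  have cof: "cofactor M i 0 = [:(-1) ^ i * D i:]" if "i < Suc n" for i
  proof -
    have "mat_delete M i 0 = mat n n (\<lambda>(i', j). [:y j ^ (if i' < i then i' else Suc i'):])"
      by (rule eq_matI) (auto simp: mat_delete_def M_def Y_def poly_const_pow)
    then have "cofactor M i 0 = (-1) ^ i * [:D i:]"
      by (simp add: cofactor_def det_const_poly D_def)
    also have "(-1) ^ i = [:(-1 :: 'a) ^ i:]" by (rule minus_one_power_poly)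
    finally show ?thesis by simp
  qed
  have "det M = (\<Sum>i<Suc n. M $$ (i, 0) * cofactor M i 0)"
    by (rule laplace_expansion_column) (auto simp: M_def)
  also have "\<dots> = (\<Sum>i<Suc n. Polynomial.monom ((-1) ^ i * D i) i)"
  proof (rule sum.cong)
    fix i assume i: "i \<in> {..<Suc n}"
    then have "M $$ (i, 0) = [:0, 1:] ^ i" by (simp add: M_def Y_def)
    then show "M $$ (i, 0) * cofactor M i 0 = Polynomial.monom ((-1) ^ i * D i) i"
      using i by (simp add: cof monom_altdef)
  qed simp
  finally have "Polynomial.coeff (det M) 1 = (\<Sum>i<Suc n. if i = 1 then (-1) ^ i * D i else 0)"
    by (simp add: coeff_sum del: sum.lessThan_Suc)
  also have "\<dots> = - D 1"
    using assms by (subst sum.delta) auto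
  finally have 1: "Polynomial.coeff (det M) 1 = - D 1" .
  \<comment> \<open>The indeterminate X is variable 0 of the Vandermonde product, so it occurs only
    in the factors \<open>y j - X\<close>.\<close>
  have "det M = (\<Prod>j<n. [:y j, -1:]) * vandermonde n (\<lambda>i. [:y i:])"
    unfolding M_def det_vandermonde vandermonde_Suc_shift by (simp add: Y_def)
  also have "vandermonde n (\<lambda>i. [:y i:]) = [:vandermonde n y:]"
    by (simp add: vandermonde_def prod_const_poly)
  finally have "Polynomial.coeff (det M) 1 = vandermonde n y * Polynomial.coeff (\<Prod>j<n. [:y j, -1:]) 1"
    by (simp add: mult.commute)
  \<comment> \<open>The linear coefficient is the derivative at 0; the product rule yields minus the
    elementary symmetric function of degree n - 1.\<close>
  also have "Polynomial.coeff (\<Prod>j<n. [:y j, -1:]) 1 = poly (pderiv (\<Prod>j<n. [:y j, -1:])) 0"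
    by (simp add: poly_0_coeff_0 coeff_pderiv)
  also have "\<dots> = - (\<Sum>j<n. \<Prod>i\<in>{..<n} - {j}. y i)"
    by (simp add: pderiv_prod poly_sum poly_prod pderiv_pCons sum_negf)
  finally have "D 1 = (\<Sum>j<n. \<Prod>i\<in>{..<n} - {j}. y i) * vandermonde n y"
    using 1 by (simp add: mult.commute)
  moreover have "D 1 = det (mat n n (\<lambda>(i, j). y j ^ (if i = 0 then 0 else Suc i)))"
    unfolding D_def by (intro arg_cong[of _ _ det] eq_matI) auto
  ultimately show ?thesis by simp
qed

text \<open>Each unordered pair contributes two opposite differences, whence the sign. The left side
  does not depend on the order of the \<open>y\<close>, so it can be computed over the set of
  residues.\<close>

lemma prod_differences_eq_vandermonde_square:
  fixes y :: "nat \<Rightarrow> 'a :: comm_ring_1"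
  shows "(\<Prod>j<n. \<Prod>i\<in>{..<n} - {j}. y j - y i) = (-1) ^ (n * (n - 1) div 2) * (vandermonde n y)\<^sup>2"
proof (induction n)
  case 0
  then show ?case by (simp add: vandermonde_def)
next
  case (Suc n)
  have "(\<Prod>j<Suc n. \<Prod>i\<in>{..<Suc n} - {j}. y j - y i) =
      (\<Prod>j<n. \<Prod>i\<in>{..<Suc n} - {j}. y j - y i) * (\<Prod>i\<in>{..<Suc n} - {n}. y n - y i)"
    by simp
  also have "(\<Prod>j<n. \<Prod>i\<in>{..<Suc n} - {j}. y j - y i) =
      (\<Prod>j<n. (y j - y n) * (\<Prod>i\<in>{..<n} - {j}. y j - y i))"
  proof (rule prod.cong)
    fix j assume "j \<in> {..<n}"
    then have "{..<Suc n} - {j} = insert n ({..<n} - {j})" by auto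
    then show "(\<Prod>i\<in>{..<Suc n} - {j}. y j - y i) = (y j - y n) * (\<Prod>i\<in>{..<n} - {j}. y j - y i)"
      by simp
  qed simp
  also have "\<dots> = (\<Prod>j<n. y j - y n) * ((-1) ^ (n * (n - 1) div 2) * (vandermonde n y)\<^sup>2)"
    by (simp add: prod.distrib Suc)
  also have "(\<Prod>j<n. y j - y n) = (\<Prod>j<n. (-1) * (y n - y j))" by simp
  also have "\<dots> = (-1) ^ n * (\<Prod>j<n. y n - y j)"
    by (simp only: prod.distrib) simp
  also have "{..<Suc n} - {n} = {..<n}" by auto
  finally have "(\<Prod>j<Suc n. \<Prod>i\<in>{..<Suc n} - {j}. y j - y i) =
    (-1) ^ (n + n * (n - 1) div 2) * (vandermonde n y * (\<Prod>j<n. y n - y j))\<^sup>2"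
    by (simp add: power_add power2_eq_square mult_ac)
  also have "n + n * (n - 1) div 2 = Suc n * (Suc n - 1) div 2"
    by (cases n) auto
  also have "vandermonde n y * (\<Prod>j<n. y n - y j) = vandermonde (Suc n) y"
    by (simp add: vandermonde_def)
  finally show ?case .
qed

text \<open>Subtracting row 0 from all others removes the indeterminate from them; expansion along
  row 0 then has constant cofactors.\<close>

lemma degree_det_add_indeterminate_le:
  fixes f :: "nat \<Rightarrow> nat \<Rightarrow> 'a :: comm_ring_1"
  assumes "n > 0"
  shows "degree (det (mat n n (\<lambda>(i, j). [:f i j, 1:]))) \<le> 1"
proof -
  define A where "A = mat n n (\<lambda>(i, j). [:f i j, 1:])"
  define B where "B = mat n n (\<lambda>(i, j). if i = j then 1 else if j = 0 then -1 else (0 :: 'a poly))"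
  have dB: "det B = 1" unfolding B_def by (subst det_lower_triangular_mat) auto
  have BA: "(B * A) $$ (i, j) = (if i = 0 then [:f 0 j, 1:] else [:f i j - f 0 j:])"
    if ij: "i < n" "j < n" for i j
  proof -
    have "(B * A) $$ (i, j) = (\<Sum>k<n. (if i = k then 1 else if k = 0 then -1 else 0) * [:f k j, 1:])"
      using ij by (simp add: A_def B_def scalar_prod_def atLeast0LessThan)
    also have "\<dots> = (\<Sum>k<n. (if i = k then [:f k j, 1:] else 0) +
        (if k = 0 then if i = 0 then 0 else - [:f k j, 1:] else 0))"
      by (rule sum.cong) (auto simp del: minus_pCons mult_pCons_right mult_pCons_left)
    also have "\<dots> = (if i = 0 then [:f 0 j, 1:] else [:f i j - f 0 j:])"
      using ij by (simp add: sum.distrib sum.delta sum.delta')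
    finally show ?thesis .
  qed
  define C where "C = mat n n (\<lambda>(i, j). if i = 0 then [:f 0 j, 1:] else [:f i j - f 0 j:])"
  have BAC: "B * A = C"
  proof (rule eq_matI)
    fix i j assume "i < dim_row C" "j < dim_col C"
    then have ij: "i < n" "j < n" by (simp_all add: C_def)
    then show "(B * A) $$ (i, j) = C $$ (i, j)" by (simp only: BA) (simp add: C_def)
  qed (auto simp: B_def A_def C_def)
  have "det A = det (B * A)"
    using det_mult[of B n A] dB by (simp add: B_def A_def)
  also have "\<dots> = (\<Sum>j<n. C $$ (0, j) * cofactor C 0 j)"
    unfolding BAC using assms by (intro laplace_expansion_row) (auto simp: C_def)
  also have "degree \<dots> \<le> 1"
  proof (rule degree_sum_le)
    fix j assume j: "j \<in> {..<n}"
    define f' where "f' i j' = f (Suc i) (if j' < j then j' else Suc j') - f 0 (if j' < j then j' else Suc j')" for i j'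
    have "mat_delete C 0 j = mat (n - 1) (n - 1) (\<lambda>(i, j'). [:f' i j':])"
      by (rule eq_matI) (auto simp: mat_delete_def C_def f'_def)
    then have "cofactor C 0 j = (-1) ^ j * [:det (mat (n - 1) (n - 1) (\<lambda>(i, j'). f' i j')):]"
      by (simp add: cofactor_def det_const_poly)
    also have "(-1) ^ j = [:(-1 :: 'a) ^ j:]" by (rule minus_one_power_poly)
    finally obtain c where "cofactor C 0 j = [:c:]" by simp
    then show "degree (C $$ (0, j) * cofactor C 0 j) \<le> 1"
      using j assms by (simp add: C_def)
  qed simp
  finally show ?thesis by (simp add: A_def)
qed

section \<open>The matrix at - 1 / g as a product of Vandermonde matrices over the residues\<close>

context odd_prime
begin

lemma bij_betw_Res_mult:
  assumes k: "chi k = 1"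
  shows "bij_betw (\<lambda>x. (k * x) mod int p) Res Res"
proof -
  have "\<not> int p dvd k" using k by (simp flip: chi_eq_0_iff)
  then have "inj_on (\<lambda>x. (k * x) mod int p) P"
    using bij_betw_affine_mod[of k 0] by (simp add: bij_betw_def)
  then have inj: "inj_on (\<lambda>x. (k * x) mod int p) Res"
    by (rule inj_on_subset) (auto simp: Res_def)
  moreover have "(\<lambda>x. (k * x) mod int p) ` Res \<subseteq> Res"
    using p_gt_2 k by (auto simp: Res_def chi_mult)
  ultimately have "(\<lambda>x. (k * x) mod int p) ` Res = Res"
    by (intro endo_inj_surj) auto
  with inj show ?thesis by (simp add: bij_betw_def)
qed

end

context prime_root
begin

lemma e_sum: "finite A \<Longrightarrow> e (\<Sum>x\<in>A. f x) = (\<Prod>x\<in>A. e (f x))"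
  by (induction A rule: finite_induct) (auto simp: e_add)

text \<open>Multiplication by 4 permutes the residues, so their sum S satisfies 4 S = S modulo p,
  and p > 3 allows the factor 3 to be cancelled.\<close>

lemma prod_e_Res:
  assumes "p > 3"
  shows "(\<Prod>r\<in>Res. e r) = 1"
proof -
  have "chi 2 * chi 2 = 1" using p_gt_2 by (intro chi_square) (auto dest: zdvd_imp_le)
  then have "chi 4 = 1" using chi_mult[of 2 2] by simp
  then have "(\<Prod>r\<in>Res. e (4 * r)) = (\<Prod>r\<in>Res. e r)"
    using prod.reindex_bij_betw[OF bij_betw_Res_mult[of 4], of e] by simp
  then have "e (4 * \<Sum>Res) = e (\<Sum>Res)"
    by (simp add: e_sum sum_distrib_left)
  then have "int p dvd 3 * \<Sum>Res" by (simp add: e_eq_iff)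
  moreover have "\<not> int p dvd 3" using assms by (auto dest: zdvd_imp_le)
  ultimately have "int p dvd \<Sum>Res" using prime_int_p by (simp add: prime_dvd_mult_iff)
  then have "e (\<Sum>Res) = 1" by (simp add: e_eq_1_iff)
  then show ?thesis by (simp add: e_sum)
qed

definition F_R :: complex where "F_R = (\<Prod>r\<in>Res. 1 - e r)"

text \<open>Ordered pairs (s, r) are grouped by c = r - s, using
  \<open>e s - e r = - e s * (e c - 1)\<close>. The factors \<open>- e s\<close> combine to a sign
  since all \<open>e s\<close> multiply to 1, and the exponent of \<open>e c - 1\<close> is the
  number of residues s for which s + c is again a residue.\<close>

lemma prod_residue_differences:
  assumes "p > 3"
  shows "(\<Prod>s\<in>Res. \<Prod>r\<in>Res - {s}. e s - e r) =
    (-1) ^ (m * (m - 1)) * (\<Prod>c\<in>P - {0}. (e c - 1) ^ card {r\<in>Res. chi (r + c) = 1})"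
proof -
  have inner: "(\<Prod>r\<in>Res - {s}. e s - e r) =
      (- e s) ^ (m - 1) * (\<Prod>c\<in>{c\<in>P - {0}. chi (s + c) = 1}. e c - 1)" if s: "s \<in> Res" for s
  proof -
    have "(\<Prod>r\<in>Res - {s}. e s - e r) = (\<Prod>r\<in>Res - {s}. (- e s) * (e (r - s) - 1))"
      by (intro prod.cong refl) (simp add: algebra_simps flip: e_add)
    also have "\<dots> = (- e s) ^ (m - 1) * (\<Prod>r\<in>Res - {s}. e (r - s) - 1)"
      using s by (simp only: prod.distrib prod_constant) (simp add: card_Res)
    also have "(\<Prod>r\<in>Res - {s}. e (r - s) - 1) = (\<Prod>c\<in>{c\<in>P - {0}. chi (s + c) = 1}. e c - 1)"
    proof (rule prod.reindex_bij_witness[of _ "\<lambda>c. (s + c) mod int p" "\<lambda>r. (r - s) mod int p"])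
      fix r assume r: "r \<in> Res - {s}"
      have "(s + (r - s) mod int p) mod int p = (s + (r - s)) mod int p" by (rule mod_add_right_eq)
      then show "(s + (r - s) mod int p) mod int p = r" using r by (simp add: Res_def)
      have "(r - s) mod int p \<noteq> 0"
      proof
        assume "(r - s) mod int p = 0"
        then have "r mod int p = s mod int p" by (simp add: mod_eq_dvd_iff dvd_eq_mod_eq_0)
        then show False using r s by (auto simp: Res_def)
      qed
      moreover have "chi (s + (r - s) mod int p) = chi r"
        using chi_mod_add[of "r - s" s] by (simp add: add.commute)
      ultimately show "(r - s) mod int p \<in> {c\<in>P - {0}. chi (s + c) = 1}"
        using r p_gt_2 by (auto simp: Res_def)
      show "e ((r - s) mod int p) - 1 = e (r - s) - 1" by simp
    next
      fix c assume c: "c \<in> {c\<in>P - {0}. chi (s + c) = 1}"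
      have "((s + c) mod int p - s) mod int p = (s + c - s) mod int p" by (rule mod_diff_left_eq)
      then show *: "((s + c) mod int p - s) mod int p = c" using c by simp
      have "(s + c) mod int p \<noteq> s" using * c by auto
      then show "(s + c) mod int p \<in> Res - {s}" using c p_gt_2 by (auto simp: Res_def)
    qed
    finally show ?thesis .
  qed
  have "(\<Prod>s\<in>Res. \<Prod>r\<in>Res - {s}. e s - e r) =
      (\<Prod>s\<in>Res. (- e s) ^ (m - 1)) * (\<Prod>s\<in>Res. \<Prod>c\<in>{c\<in>P - {0}. chi (s + c) = 1}. e c - 1)"
    by (simp add: inner prod.distrib)
  also have "(\<Prod>s\<in>Res. (- e s) ^ (m - 1)) = (\<Prod>s\<in>Res. (-1) * e s) ^ (m - 1)"
    by (simp add: prod_power_distrib)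
  also have "(\<Prod>s\<in>Res. (-1) * e s) = (-1) ^ m * (\<Prod>s\<in>Res. e s)"
    by (simp only: prod.distrib prod_constant card_Res)
  also have "((-1) ^ m * (\<Prod>s\<in>Res. e s)) ^ (m - 1) = (-1) ^ (m * (m - 1))"
    using prod_e_Res[OF assms] by (simp add: power_mult)
  also have "(\<Prod>s\<in>Res. \<Prod>c\<in>{c\<in>P - {0}. chi (s + c) = 1}. e c - 1) =
      (\<Prod>c\<in>P - {0}. \<Prod>s\<in>{s\<in>Res. chi (s + c) = 1}. e c - 1)"
    by (rule prod.swap_restrict) auto
  finally show ?thesis by simp
qed

lemma vandermonde_Res:
  assumes p3: "p > 3" and bij: "bij_betw \<rho> {..<m} Res"
  shows "(-1) ^ (m * (m - 1) div 2) * (vandermonde m (\<lambda>j. e (\<rho> j)))\<^sup>2 =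
    (\<Prod>c\<in>P - {0}. (e c - 1) ^ card {r\<in>Res. chi (r + c) = 1})"
proof -
  have "(-1) ^ (m * (m - 1) div 2) * (vandermonde m (\<lambda>j. e (\<rho> j)))\<^sup>2 =
      (\<Prod>j<m. \<Prod>i\<in>{..<m} - {j}. e (\<rho> j) - e (\<rho> i))"
    by (rule prod_differences_eq_vandermonde_square[symmetric])
  also have "\<dots> = (\<Prod>j<m. \<Prod>r\<in>Res - {\<rho> j}. e (\<rho> j) - e r)"
  proof (intro prod.cong refl)
    fix j assume "j \<in> {..<m}"
    then have "bij_betw \<rho> ({..<m} - {j}) (Res - {\<rho> j})"
      using bij by (auto simp: bij_betw_def inj_on_def)
    then show "(\<Prod>i\<in>{..<m} - {j}. e (\<rho> j) - e (\<rho> i)) = (\<Prod>r\<in>Res - {\<rho> j}. e (\<rho> j) - e r)"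
      by (rule prod.reindex_bij_betw)
  qed
  also have "\<dots> = (\<Prod>s\<in>Res. \<Prod>r\<in>Res - {s}. e s - e r)"
    by (rule prod.reindex_bij_betw[OF bij])
  also have "\<dots> = (-1) ^ (m * (m - 1)) * (\<Prod>c\<in>P - {0}. (e c - 1) ^ card {r\<in>Res. chi (r + c) = 1})"
    by (rule prod_residue_differences[OF p3])
  also have "(-1 :: complex) ^ (k * (k - 1)) = 1" for k :: nat by (cases k) auto
  finally show ?thesis by simp
qed

lemma g_nz: "g \<noteq> 0"
  using gauss_sum_square p_gt_2 chi_eq_0_iff[of "-1"] by auto

lemma eval_det_A_mat:
  assumes p3: "p > 3" and bij: "bij_betw \<rho> {..<m} Res"
  shows "poly (map_poly of_int (det (A_mat p))) (- 1 / g) =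
    (2 / g) ^ m * ((of_int (chi (-1)) * g - 1) / 2) * (vandermonde m (\<lambda>j. e (\<rho> j)))\<^sup>2"
proof -
  define y where "y j = e (\<rho> j)" for j
  \<comment> \<open>Row 0 stands for i = 1, whose entries are \<open>chi j\<close>, so its exponent
    is 0; row i > 0 stands for i + 1. Exponent 1 is skipped.\<close>
  define E where "E i = (if i = 0 then 0 else Suc i)" for i
  define f where "f q = poly (map_poly of_int q) (- 1 / g)" for q :: "int poly"
  define U where "U = mat m m (\<lambda>(i, j). y j ^ E i)"
  define W where "W = mat m m (\<lambda>(i, j). y j ^ i * y j)"
  have m0: "m > 0" using p3 by auto
  interpret f: comm_ring_hom f
    by unfold_locales (auto simp: f_def of_int_poly_hom.hom_add of_int_poly_hom.hom_mult)
  have entry: "f [:a_entry p (i + 1) (j + 1), 1:] = 2 / g * (\<Sum>k<m. y k ^ E i * (y k ^ j * y k))"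
    if ij: "i < m" "j < m" for i j
  proof -
    have a: "a_entry p (i + 1) (j + 1) = chi (int (E i + Suc j))"
      by (auto simp: a_entry_def chi_def E_def)
    \<comment> \<open>The largest sum is m + m = p - 1, so no entry meets the exceptional case of
      \<open>sum_e_Res\<close>.\<close>
    have "0 < E i + Suc j" "E i + Suc j < p"
      using ij p_eq by (auto simp: E_def)
    then have nd: "\<not> int p dvd int (E i + Suc j)" by (auto dest: dvd_imp_le simp del: of_nat_add of_nat_Suc)
    have "(\<Sum>k<m. y k ^ E i * (y k ^ j * y k)) = (\<Sum>k<m. e (\<rho> k * int (E i + Suc j)))"
      by (simp only: e_mult_nat y_def power_add power_Suc2)
    also have "\<dots> = (\<Sum>r\<in>Res. e (r * int (E i + Suc j)))"
      by (rule sum.reindex_bij_betw[OF bij])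
    finally have "2 * (\<Sum>k<m. y k ^ E i * (y k ^ j * y k)) = of_int (a_entry p (i + 1) (j + 1)) * g - 1"
      using sum_e_Res[of "int (E i + Suc j)"] nd by (simp only: a if_False add_0_right)
    then have "2 / g * (\<Sum>k<m. y k ^ E i * (y k ^ j * y k)) = (of_int (a_entry p (i + 1) (j + 1)) * g - 1) / g"
      by (metis times_divide_eq_left)
    also have "\<dots> = f [:a_entry p (i + 1) (j + 1), 1:]"
      using g_nz by (simp add: f_def field_simps)
    finally show ?thesis by simp
  qed
  have "map_mat f (A_mat p) = (2 / g) \<cdot>\<^sub>m (U * transpose_mat W)"
    by (rule eq_matI) (auto simp: A_mat_def U_def W_def scalar_prod_def atLeast0LessThan entry[simplified])
  then have "f (det (A_mat p)) = det ((2 / g) \<cdot>\<^sub>m (U * transpose_mat W))"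
    by (metis f.hom_det)
  also have "\<dots> = (2 / g) ^ m * (det U * det W)"
    using det_mult[of U m "transpose_mat W"] det_transpose[of W m] by (simp add: U_def W_def)
  also have "det U = (\<Sum>j<m. \<Prod>i\<in>{..<m} - {j}. y i) * vandermonde m y"
    unfolding U_def E_def by (rule det_vandermonde_skip_1[OF m0])
  also have "det W = (\<Prod>j<m. y j) * vandermonde m y"
    unfolding W_def by (simp add: det_scale_columns det_vandermonde)
  also have y1: "(\<Prod>j<m. y j) = 1"
    using prod.reindex_bij_betw[OF bij, of e] prod_e_Res[OF p3] by (simp add: y_def)
  \<comment> \<open>All nodes together multiply to 1, so omitting \<open>y j\<close> leaves its
    inverse, and the symmetric function becomes the exponential sum over residues at -1.\<close>
  also have "(\<Sum>j<m. \<Prod>i\<in>{..<m} - {j}. y i) = (\<Sum>j<m. e (\<rho> j * (-1)))"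
  proof (rule sum.cong)
    fix j assume "j \<in> {..<m}"
    then have "y j * (\<Prod>i\<in>{..<m} - {j}. y i) = 1"
      using y1 by (subst (asm) prod.remove[of _ j]) auto
    moreover have "y j * e (\<rho> j * (-1)) = 1" by (simp add: y_def flip: e_add)
    ultimately show "(\<Prod>i\<in>{..<m} - {j}. y i) = e (\<rho> j * (-1))"
      by (metis mult_cancel_left y_def e_nz)
  qed simp
  also have "\<dots> = (\<Sum>r\<in>Res. e (r * (-1)))"
    by (rule sum.reindex_bij_betw[OF bij])
  also have "\<dots> = (of_int (chi (-1)) * g - 1) / 2"
    using sum_e_Res[of "-1"] p_gt_2 by (simp add: mult.commute)
  finally show ?thesis
    by (simp add: f_def y_def[abs_def] power2_eq_square)
qed

text \<open>With q = (p - 1) / 4, a residue c occurs q - 1 times as a difference and a nonresidue q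
  times. Multiplication by \<open>F_R\<close> supplies the missing factor for each residue and
  completes a q-th power of the product over all c, which is p; hence a statement without division
  by \<open>F_R\<close>.\<close>

lemma eval_det_A_mat_1:
  assumes p3: "p > 3" and p1: "p mod 4 = 1"
  shows "poly (map_poly of_int (det (A_mat p))) (- 1 / g) * F_R = 2 ^ (m - 1) * of_int (chi 2) * (g - 1)"
proof -
  obtain q where q: "p = 4 * q + 1" using p1 by (metis mult_div_mod_eq)
  then have pq: "int p = 4 * int q + 1" by simp
  then have m: "m = 2 * q" "(p - Suc 0) div 2 = 2 * q" and q0: "q > 0" using p3 by auto
  obtain \<rho> where \<rho>: "bij_betw \<rho> {..<m} Res"
    using ex_bij_betw_nat_finite[of Res] by (auto simp: card_Res atLeast0LessThan)
  define V2 where "V2 = (vandermonde m (\<lambda>j. e (\<rho> j)))\<^sup>2"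
  have chim: "chi (-1) = 1" by (simp add: chi_minus_1 m)
  have "card {r\<in>Res. chi (r + c) = 1} = q - 1" if "c \<in> Res" for c
  proof -
    have "c \<in> P - {0}" "chi c = 1" using that P_decomp(1) by (auto simp: Res_def)
    then have "4 * int (card {r\<in>Res. chi (r + c) = 1}) = int p - 5"
      using card_residue_differences[of c] by (simp add: chi_uminus m)
    then show ?thesis using pq q0 by linarith
  qed
  moreover have "card {r\<in>Res. chi (r + c) = 1} = q" if "c \<in> NRes" for c
  proof -
    have "c \<in> P - {0}" "chi c = -1" using that P_decomp(1) by (auto simp: NRes_def)
    then have "4 * int (card {r\<in>Res. chi (r + c) = 1}) = int p - 1"
      using card_residue_differences[of c] by (simp add: chi_uminus m)
    then show ?thesis using pq q0 by linarith
  qed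
  ultimately have "(\<Prod>c\<in>P - {0}. (e c - 1) ^ card {r\<in>Res. chi (r + c) = 1}) =
      (\<Prod>c\<in>Res. (e c - 1) ^ (q - 1)) * (\<Prod>c\<in>NRes. (e c - 1) ^ q)"
    unfolding P_decomp(1) by (subst prod.union_disjoint) (auto simp: P_decomp)
  also have "\<dots> * (\<Prod>c\<in>Res. e c - 1) = ((\<Prod>c\<in>Res. e c - 1) * (\<Prod>c\<in>NRes. e c - 1)) ^ q"
    using q0 by (cases q) (simp_all add: prod_power_distrib prod.distrib power_mult_distrib mult_ac)
  also have "(\<Prod>c\<in>Res. e c - 1) * (\<Prod>c\<in>NRes. e c - 1) = (\<Prod>c\<in>P - {0}. e c - 1)"
    unfolding P_decomp(1) by (subst prod.union_disjoint) (auto simp: P_decomp)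
  also have "\<dots> = (\<Prod>c\<in>P - {0}. (-1) * (1 - e c))" by simp
  also have "\<dots> = (-1) ^ (p - 1) * of_nat p"
    using p_gt_2 by (simp only: prod.distrib prod_one_minus_e prod_constant) (simp add: card_Diff_subset)
  also have "\<dots> = of_nat p" by (simp add: q)
  also have "(\<Prod>c\<in>Res. e c - 1) = (\<Prod>c\<in>Res. (-1) * (1 - e c))" by simp
  also have "\<dots> = F_R"
    by (simp only: prod.distrib prod_constant card_Res F_R_def) (simp add: m)
  finally have V: "(-1) ^ (m * (m - 1) div 2) * V2 * F_R = of_nat p ^ q"
    using vandermonde_Res[OF p3 \<rho>] by (simp add: V2_def)
  \<comment> \<open>This exponent has the parity of q, and \<open>(-1) ^ q\<close> is also the value
    of \<open>chi 2\<close>.\<close>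
  have "m * (m - 1) div 2 = q * (2 * q - 1)" by (simp add: m)
  then have "(-1 :: complex) ^ (m * (m - 1) div 2) = (-1) ^ q"
    using q0 by (simp add: minus_one_power_iff)
  also have "\<dots> = of_int (chi 2)" by (simp add: chi_2 m)
  finally have V': "of_int (chi 2) * V2 * F_R = of_nat p ^ q" using V by simp
  have "chi 2 * chi 2 = 1" using p_gt_2 by (intro chi_square) (auto dest: zdvd_imp_le)
  then have c2: "of_int (chi 2) * of_int (chi 2) = (1 :: complex)" by (metis of_int_1 of_int_mult)
  have "V2 * F_R = of_int (chi 2) * of_int (chi 2) * V2 * F_R" by (simp add: c2)
  also have "\<dots> = of_int (chi 2) * of_nat p ^ q" by (simp only: V'[symmetric] mult.assoc)
  finally have "V2 * F_R = of_int (chi 2) * of_nat p ^ q" .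
  moreover have "g ^ m = of_nat p ^ q"
    using gauss_sum_square by (simp add: m power_mult chim)
  moreover have "g ^ m \<noteq> 0" using g_nz by simp
  moreover have "(2 :: complex) ^ m = 2 * 2 ^ (m - 1)" using p3 by (cases m) auto
  moreover have "(2 / g) ^ m * ((g - 1) / 2) * V2 * F_R = 2 ^ m / g ^ m * ((g - 1) / 2) * (V2 * F_R)"
    by (simp add: power_divide)
  ultimately show ?thesis
    unfolding eval_det_A_mat[OF p3 \<rho>] chim V2_def[symmetric] using p_gt_2 by simp
qed

text \<open>Here \<open>chi (- c) = - chi c\<close>, so every nonzero difference occurs equally
  often, namely (p - 3) / 4 times. The product is a power of p, and no analogue of
  \<open>F_R\<close> appears.\<close>

lemma eval_det_A_mat_3:
  assumes p3: "p > 3" and p1: "p mod 4 = 3"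
  shows "poly (map_poly of_int (det (A_mat p))) (- 1 / g) = 2 ^ (m - 1) * (- 1 / g - 1)"
proof -
  obtain q where q: "p = 4 * q + 3" using p1 by (metis mult_div_mod_eq)
  then have pq: "int p = 4 * int q + 3" by simp
  then have m: "m = 2 * q + 1" "(p - Suc 0) div 2 = 2 * q + 1" by auto
  obtain \<rho> where \<rho>: "bij_betw \<rho> {..<m} Res"
    using ex_bij_betw_nat_finite[of Res] by (auto simp: card_Res atLeast0LessThan)
  define V2 where "V2 = (vandermonde m (\<lambda>j. e (\<rho> j)))\<^sup>2"
  have chim: "chi (-1) = -1" by (simp add: chi_minus_1 m)
  have "card {r\<in>Res. chi (r + c) = 1} = q" if "c \<in> P - {0}" for c
    using card_residue_differences[OF that] pq by (simp add: chi_uminus m)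
  then have "(\<Prod>c\<in>P - {0}. (e c - 1) ^ card {r\<in>Res. chi (r + c) = 1}) = (\<Prod>c\<in>P - {0}. e c - 1) ^ q"
    by (simp add: prod_power_distrib)
  also have "(\<Prod>c\<in>P - {0}. e c - 1) = (\<Prod>c\<in>P - {0}. (-1) * (1 - e c))" by simp
  also have "\<dots> = (-1) ^ (p - 1) * of_nat p"
    using p_gt_2 by (simp only: prod.distrib prod_one_minus_e prod_constant) (simp add: card_Diff_subset)
  also have "\<dots> = of_nat p" by (simp add: q)
  finally have V: "(-1) ^ (m * (m - 1) div 2) * V2 = of_nat p ^ q"
    using vandermonde_Res[OF p3 \<rho>] by (simp add: V2_def)
  have "m * (m - 1) div 2 = q * (2 * q + 1)" by (simp add: m)
  then have "(-1 :: complex) ^ (m * (m - 1) div 2) = (-1) ^ q"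
    by (simp add: minus_one_power_iff)
  then have "(-1) ^ q * V2 = of_nat p ^ q" using V by simp
  then have "(-1) ^ q * (-1) ^ q * V2 = (-1) ^ q * of_nat p ^ q" by (simp only: mult.assoc)
  then have "V2 = (- of_nat p) ^ q" by (simp add: power_minus[of "of_nat p"] flip: power_add)
  also have "\<dots> = g ^ (m - 1)"
    using gauss_sum_square by (simp add: m power_mult chim)
  finally have "V2 = g ^ (m - 1)" .
  moreover have "g ^ m = g * g ^ (m - 1)" "(2 :: complex) ^ m = 2 * 2 ^ (m - 1)" using p3 by (cases m; simp)+
  moreover have "g ^ (m - 1) \<noteq> 0" using g_nz by simp
  ultimately show ?thesis
    unfolding eval_det_A_mat[OF p3 \<rho>] chim V2_def[symmetric]
    using g_nz by (simp add: power_divide field_simps)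
qed

end

section \<open>From one value to the linear polynomial\<close>

context odd_prime
begin

text \<open>Irrationality of sqrt p, in the form in which coefficients of 1 and sqrt p are
  compared.\<close>

lemma sqrt_p_rational_eq_0:
  assumes "of_rat x * sqrt (real p) = of_rat y"
  shows "x = 0" "y = 0"
proof -
  have "x = 0"
  proof (rule ccontr)
    assume "x \<noteq> 0"
    then have "sqrt (real p) = of_rat (y / x)"
      using assms by (simp add: of_rat_divide field_simps)
    then have "sqrt (real p) \<in> \<rat>" by simp
    moreover have "algebraic_int (sqrt (real p))"
      by (intro algebraic_int_sqrt int_imp_algebraic_int) auto
    ultimately have "sqrt (real p) \<in> \<int>" by (rule rational_algebraic_int_is_int[rotated])
    then obtain k where k: "sqrt (real p) = of_int k" by (auto elim: Ints_cases)
    then have "real p = of_int k * of_int k" by (metis abs_of_nat real_sqrt_abs2 real_sqrt_mult_self)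
    then have "real_of_int (int p) = of_int (k * k)" by simp
    then have pk: "int p = k * k" by (simp only: of_int_eq_iff)
    then have "int p dvd k * k" by simp
    then have "int p dvd k" using prime_int_p prime_dvd_multD by blast
    then obtain l where "k = int p * l" by blast
    with pk have "int p * (int p * (l * l)) = int p * 1" by (simp add: mult_ac)
    then have "int p * (l * l) = 1" using p_gt_2 by (subst (asm) mult_cancel_left) auto
    then have "int p dvd 1" by (metis dvd_triv_left)
    then show False using p_gt_2 by simp
  qed
  then show "x = 0" "y = 0" using assms by auto
qed

lemma det_A_mat_linear:
  assumes "p > 3"
  obtains u v where "det (A_mat p) = [:u, v:]"
proof -
  have "degree (det (A_mat p)) \<le> 1"
    unfolding A_mat_def using assms by (intro degree_det_add_indeterminate_le) auto
  then have "det (A_mat p) = [:Polynomial.coeff (det (A_mat p)) 0, Polynomial.coeff (det (A_mat p)) 1:]"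
    by (intro poly_eqI) (auto simp: coeff_pCons coeff_eq_0 split: nat.splits)
  then show ?thesis by (rule that)
qed

end

context prime_root
begin

text \<open>Now \<open>g\<close> is imaginary. Squaring \<open>g * (u + K) = v - K\<close> equates a
  nonpositive with a nonnegative integer, so both vanish, whichever square root of -p the sum
  \<open>g\<close> is.\<close>

lemma det_A_mat_3:
  assumes p3: "p > 3" and p1: "p mod 4 = 3"
  shows "det (A_mat p) = Polynomial.smult (2 ^ (m - 1)) [:-1, 1:]"
proof -
  obtain u v where uv: "det (A_mat p) = [:u, v:]" using det_A_mat_linear[OF p3] .
  define K :: int where "K = 2 ^ (m - 1)"
  have "odd m" using p1 by presburger
  then have g2: "g\<^sup>2 = - of_nat p" using gauss_sum_square by (simp add: chi_minus_1)
  have "of_int u - of_int v / g = of_int K * (- 1 / g - 1)"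
    using eval_det_A_mat_3[OF p3 p1] unfolding uv by (simp add: K_def of_int_hom.map_poly_pCons_hom)
  then have "g * of_int (u + K) = of_int (v - K)"
    using g_nz by (simp add: field_simps)
  then have "g\<^sup>2 * (of_int (u + K))\<^sup>2 = (of_int (v - K))\<^sup>2" by (metis power_mult_distrib)
  then have "of_int (- int p * (u + K)\<^sup>2) = (of_int ((v - K)\<^sup>2) :: complex)" by (simp add: g2)
  then have eq: "- int p * (u + K)\<^sup>2 = (v - K)\<^sup>2" by (simp only: of_int_eq_iff)
  have "(u + K)\<^sup>2 = 0"
  proof (rule ccontr)
    assume "(u + K)\<^sup>2 \<noteq> 0"
    then have "- int p * (u + K)\<^sup>2 < 0" using p_gt_2 by (simp add: mult_pos_pos)
    then show False using eq by (metis not_less zero_le_power2)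
  qed
  then have "u = - K" "v = K" using eq by auto
  then show ?thesis by (simp add: uv K_def)
qed

text \<open>Multiplied by g, the value at - 1 / g reads u g - v on one side and K (g - 1) (a + b g)
  on the other, and the coefficients of 1 and g are compared. The class number formula will enter
  through the hypothesis \<open>ab\<close>.\<close>

lemma det_A_mat_1:
  assumes p3: "p > 3" and p1: "p mod 4 = 1"
    and g: "g = of_real (sqrt (real p))" and FR: "F_R = of_real FR" "FR \<noteq> 0"
    and ab: "sqrt (real p) / FR = of_rat a + of_rat b * sqrt (real p)"
  shows "map_poly rat_of_int (det (A_mat p)) =
    Polynomial.smult (2 ^ (m - 1) * rat_of_int (chi 2)) [:a - b, a - of_nat p * b:]"
proof -
  obtain u v where uv: "det (A_mat p) = [:u, v:]" using det_A_mat_linear[OF p3] .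
  define K :: rat where "K = 2 ^ (m - 1) * rat_of_int (chi 2)"
  define s where "s = sqrt (real p)"
  have ss: "s * s = real p" "s > 0" using p_gt_2 by (simp_all add: s_def)
  have "complex_of_real ((of_int u - of_int v / s) * FR) = of_real (of_rat K * (s - 1))"
    using eval_det_A_mat_1[OF p3 p1] unfolding uv g FR
    by (simp add: K_def s_def of_rat_mult of_rat_power of_int_hom.map_poly_pCons_hom)
  then have "(of_int u - of_int v / s) * FR = of_rat K * (s - 1)" by (simp only: of_real_eq_iff)
  then have "of_int u * s - of_int v = of_rat K * (s - 1) * (s / FR)"
    using ss FR by (simp add: field_simps)
  also have "s / FR = of_rat a + of_rat b * s" using ab by (simp add: s_def)
  also have "of_rat K * (s - 1) * (of_rat a + of_rat b * s) =
      of_rat K * (of_rat a - of_rat b) * s + of_rat K * (of_rat b * (s * s) - of_rat a)"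
    by (simp add: algebra_simps)
  finally have "of_rat (of_int u - K * (a - b)) * s = of_rat (of_int v - K * (a - of_nat p * b))"
    by (simp add: ss(1) of_rat_add of_rat_diff of_rat_mult algebra_simps)
  from sqrt_p_rational_eq_0[OF this[unfolded s_def]] show ?thesis
    by (simp add: uv K_def of_int_hom.map_poly_pCons_hom)
qed

end

section \<open>Lattice points in hyperbolic sectors\<close>

text \<open>The coordinates stand for a number and its conjugate, scaled so that the norm bound is
  1. The ratio of u to |v| runs through the half-open interval [1, E), one period under a unit; u >
  0 disposes of the unit -1, while v keeps both signs.\<close>

definition hyp_sector :: "real \<Rightarrow> (real \<times> real) set" where
  "hyp_sector E = {(u, v). 0 < u \<and> \<bar>v\<bar> \<le> u \<and> u < E * \<bar>v\<bar> \<and> u * \<bar>v\<bar> \<le> 1}"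

lemma hyp_sector_borel [measurable]: "hyp_sector E \<in> sets (borel \<Otimes>\<^sub>M borel)"
proof -
  have "hyp_sector E = {z \<in> space (borel \<Otimes>\<^sub>M borel).
      0 < fst z \<and> \<bar>snd z\<bar> \<le> fst z \<and> fst z < E * \<bar>snd z\<bar> \<and> fst z * \<bar>snd z\<bar> \<le> 1}"
    by (auto simp: hyp_sector_def space_pair_measure)
  also have "\<dots> \<in> sets (borel \<Otimes>\<^sub>M borel)" by measurable
  finally show ?thesis .
qed

text \<open>From u < E |v| follows u^2 <= E u |v| <= E, so the cusps of the hyperbolic region are
  cut off. Boundedness gives the finiteness of the lattice points and a dominating function.\<close>

lemma hyp_sector_bounded:
  assumes "E > 1" "(u, v) \<in> hyp_sector E"
  shows "\<bar>u\<bar> \<le> E" "\<bar>v\<bar> \<le> E"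
proof -
  have uv: "0 < u" "\<bar>v\<bar> \<le> u" "u < E * \<bar>v\<bar>" "u * \<bar>v\<bar> \<le> 1"
    using assms by (auto simp: hyp_sector_def)
  have "u * u \<le> u * (E * \<bar>v\<bar>)" using uv by (intro mult_left_mono) auto
  also have "\<dots> = E * (u * \<bar>v\<bar>)" by simp
  also have "\<dots> \<le> E * 1" using uv assms by (intro mult_left_mono) auto
  also have "\<dots> \<le> E * E" using assms by simp
  finally have "u\<^sup>2 \<le> E\<^sup>2" by (simp add: power2_eq_square)
  then have "u \<le> E" by (rule power2_le_imp_le) (use assms in simp)
  then show "\<bar>u\<bar> \<le> E" "\<bar>v\<bar> \<le> E" using uv by auto
qed

text \<open>A linear change of variables of determinant \<theta>' - \<theta>, split by Fubini into a
  translation in one variable and an affine substitution in the other.\<close>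

lemma nn_integral_sheared:
  fixes F :: "real \<times> real \<Rightarrow> ennreal"
  assumes F [measurable]: "F \<in> borel_measurable (borel \<Otimes>\<^sub>M borel)" and "\<theta>' \<noteq> \<theta>"
  shows "ennreal \<bar>\<theta>' - \<theta>\<bar> * (\<integral>\<^sup>+z. F (fst z + snd z * \<theta>, fst z + snd z * \<theta>') \<partial>(lborel \<Otimes>\<^sub>M lborel)) =
    (\<integral>\<^sup>+u. \<integral>\<^sup>+v. F (u, v) \<partial>lborel \<partial>lborel)"
proof -
  have "(\<integral>\<^sup>+z. F (fst z + snd z * \<theta>, fst z + snd z * \<theta>') \<partial>(lborel \<Otimes>\<^sub>M lborel)) =
      (\<integral>\<^sup>+t. \<integral>\<^sup>+s. F (s + t * \<theta>, s + t * \<theta>') \<partial>lborel \<partial>lborel)"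
    by (subst lborel_pair.nn_integral_snd[symmetric]) simp_all
  also have "\<dots> = (\<integral>\<^sup>+t. \<integral>\<^sup>+u. F (u, u + t * (\<theta>' - \<theta>)) \<partial>lborel \<partial>lborel)"
  proof (rule nn_integral_cong)
    fix t
    show "(\<integral>\<^sup>+s. F (s + t * \<theta>, s + t * \<theta>') \<partial>lborel) = (\<integral>\<^sup>+u. F (u, u + t * (\<theta>' - \<theta>)) \<partial>lborel)"
      using nn_integral_real_affine[of "\<lambda>u. F (u, u + t * (\<theta>' - \<theta>))" 1 "t * \<theta>"]
      by (simp add: algebra_simps)
  qed
  also have "\<dots> = (\<integral>\<^sup>+u. \<integral>\<^sup>+t. F (u, u + t * (\<theta>' - \<theta>)) \<partial>lborel \<partial>lborel)"
    by (rule lborel_pair.Fubini') simp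
  finally have "ennreal \<bar>\<theta>' - \<theta>\<bar> * (\<integral>\<^sup>+z. F (fst z + snd z * \<theta>, fst z + snd z * \<theta>') \<partial>(lborel \<Otimes>\<^sub>M lborel)) =
      (\<integral>\<^sup>+u. ennreal \<bar>\<theta>' - \<theta>\<bar> * (\<integral>\<^sup>+t. F (u, u + t * (\<theta>' - \<theta>)) \<partial>lborel) \<partial>lborel)"
    by (simp add: nn_integral_cmult)
  also have "\<dots> = (\<integral>\<^sup>+u. \<integral>\<^sup>+v. F (u, v) \<partial>lborel \<partial>lborel)"
  proof (rule nn_integral_cong)
    fix u
    show "ennreal \<bar>\<theta>' - \<theta>\<bar> * (\<integral>\<^sup>+t. F (u, u + t * (\<theta>' - \<theta>)) \<partial>lborel) = (\<integral>\<^sup>+v. F (u, v) \<partial>lborel)"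
      using nn_integral_real_affine[of "\<lambda>v. F (u, v)" "\<theta>' - \<theta>" u] assms(2)
      by (simp add: mult.commute)
  qed
  finally show ?thesis .
qed

text \<open>Every lattice point owns a half-open square of side 1 / q, its preimage under scaling
  and rounding down, so a count of lattice points is an integral.\<close>

lemma nn_integral_floor_indicator:
  fixes q :: real
  assumes q: "q > 0" and "finite S"
  shows "(\<integral>\<^sup>+z. indicator S (\<lfloor>q * fst z\<rfloor>, \<lfloor>q * snd z\<rfloor>) \<partial>(lborel \<Otimes>\<^sub>M lborel)) = ennreal (card S / q\<^sup>2)"
proof -
  define I where "I k = {of_int k / q..<(of_int k + 1) / q}" for k :: int
  have I: "x \<in> I k \<longleftrightarrow> \<lfloor>q * x\<rfloor> = k" for x k
    using q by (auto simp: I_def floor_eq_iff field_simps)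
  have mI: "emeasure lborel (I k) = ennreal (1 / q)" for k
    using q by (simp add: I_def divide_right_mono diff_divide_distrib[symmetric])
  have "(\<integral>\<^sup>+z. indicator S (\<lfloor>q * fst z\<rfloor>, \<lfloor>q * snd z\<rfloor>) \<partial>(lborel \<Otimes>\<^sub>M lborel)) =
      (\<integral>\<^sup>+z. (\<Sum>k\<in>S. indicator (I (fst k) \<times> I (snd k)) z) \<partial>(lborel \<Otimes>\<^sub>M lborel))"
  proof (rule nn_integral_cong)
    fix z :: "real \<times> real"
    define k0 where "k0 = (\<lfloor>q * fst z\<rfloor>, \<lfloor>q * snd z\<rfloor>)"
    have "(\<Sum>k\<in>S. indicator (I (fst k) \<times> I (snd k)) z) = (\<Sum>k\<in>S. if k = k0 then 1 else (0 :: ennreal))"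
      by (rule sum.cong) (auto simp: indicator_def k0_def I mem_Times_iff)
    also have "\<dots> = indicator S k0" using assms by (simp add: sum.delta indicator_def)
    finally show "indicator S (\<lfloor>q * fst z\<rfloor>, \<lfloor>q * snd z\<rfloor>) =
      (\<Sum>k\<in>S. indicator (I (fst k) \<times> I (snd k)) z :: ennreal)" by (simp add: k0_def)
  qed
  also have "\<dots> = (\<Sum>k\<in>S. emeasure (lborel \<Otimes>\<^sub>M lborel) (I (fst k) \<times> I (snd k)))"
    by (subst nn_integral_sum) (auto simp: I_def)
  also have "\<dots> = (\<Sum>k\<in>S. ennreal (1 / q) * ennreal (1 / q))"
    by (intro sum.cong refl) (subst lborel.emeasure_pair_measure_Times, auto simp: mI, auto simp: I_def)
  also have "\<dots> = ennreal (card S / q\<^sup>2)"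
    using q by (simp add: ennreal_mult[symmetric] power2_eq_square ennreal_of_nat_eq_real_of_nat)
  finally show ?thesis .
qed

text \<open>For fixed u > 0 the slice is u / E < |v| <= min u (1 / u). It grows linearly up to u = 1
  (the part \<open>A\<close>) and then follows the hyperbola up to u = sqrt E (the part
  \<open>B\<close>); the areas are 1 - 1 / E and ln E - 1 + 1 / E.\<close>

lemma hyp_sector_area:
  assumes E: "E > 1"
  shows "(\<integral>\<^sup>+u. \<integral>\<^sup>+v. indicator (hyp_sector E) (u, v) \<partial>lborel \<partial>lborel) = ennreal (ln E)"
proof -
  define A where "A u = ennreal (2 * (1 - 1 / E) * u) * indicator {0..1} u" for u
  define B where "B u = ennreal (2 / u - 2 * u / E) * indicator {1..sqrt E} u" for u
  have sE: "sqrt E > 1" "sqrt E * sqrt E = E" using E by auto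
  have "(\<integral>\<^sup>+u. \<integral>\<^sup>+v. indicator (hyp_sector E) (u, v) \<partial>lborel \<partial>lborel) = (\<integral>\<^sup>+u. A u + B u \<partial>lborel)"
  proof (rule nn_integral_cong_AE)
    \<comment> \<open>The point 1 lies in the supports of both \<open>A\<close> and
      \<open>B\<close>.\<close>
    have "AE u in lborel. u \<noteq> (1 :: real)" by (rule AE_lborel_singleton)
    then show "AE u in lborel. (\<integral>\<^sup>+v. indicator (hyp_sector E) (u, v) \<partial>lborel) = A u + B u"
    proof eventually_elim
      fix u :: real assume u1: "u \<noteq> 1"
      show "(\<integral>\<^sup>+v. indicator (hyp_sector E) (u, v) \<partial>lborel) = A u + B u"
      proof (cases "u > 0")
        case False
        then have "indicator (hyp_sector E) (u, v) = (0 :: ennreal)" for v by (simp add: hyp_sector_def)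
        then show ?thesis using False by (cases "u = 0") (auto simp: A_def B_def indicator_def)
      next
        case u: True
        define M where "M = min u (1 / u)"
        have ue: "0 < u / E" using u E by simp
        have u_le: "u \<le> 1 / u" if "u \<le> 1"
          using mult_mono[OF that that] u by (simp add: pos_le_divide_eq)
        have u_ge: "1 / u \<le> u" if "1 < u"
        proof -
          have "1 / u \<le> 1" using that by simp
          then show ?thesis using that by linarith
        qed
        have "(u, v) \<in> hyp_sector E \<longleftrightarrow> u / E < \<bar>v\<bar> \<and> \<bar>v\<bar> \<le> M" for v
          using u E pos_divide_less_eq[of E u "\<bar>v\<bar>"] pos_le_divide_eq[of u "\<bar>v\<bar>" 1]
          by (auto simp: hyp_sector_def M_def mult.commute)
        then have slice: "(u, v) \<in> hyp_sector E \<longleftrightarrow> v \<in> {u / E<..M} \<union> {-M..<- (u / E)}" for v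
          using ue by (auto simp: abs_if split: if_splits)
        have "(\<integral>\<^sup>+v. indicator (hyp_sector E) (u, v) \<partial>lborel) =
            emeasure lborel ({u / E<..M} \<union> {-M..<- (u / E)})"
        proof -
          have "(\<lambda>v. indicator (hyp_sector E) (u, v)) = (indicator ({u / E<..M} \<union> {-M..<- (u / E)}) :: real \<Rightarrow> ennreal)"
            unfolding fun_eq_iff indicator_def slice by simp
          then show ?thesis by simp
        qed
        also have "\<dots> = emeasure lborel {u / E<..M} + emeasure lborel {-M..<- (u / E)}"
          using ue by (intro plus_emeasure[symmetric]) auto
        also have "\<dots> = A u + B u"
        proof (cases "u / E \<le> M")
          case le: True
          then have "u * u \<le> E" using u E by (simp add: M_def field_simps)
          then have us: "u \<le> sqrt E" using u by (simp add: real_le_rsqrt power2_eq_square)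
          have "emeasure lborel {u / E<..M} + emeasure lborel {-M..<- (u / E)} = ennreal (2 * (M - u / E))"
            using le by (simp add: ennreal_plus[symmetric] del: ennreal_plus)
          also have "\<dots> = A u + B u"
          proof (cases "u < 1")
            case True
            then have "M = u" using u_le by (simp add: M_def min_def)
            then show ?thesis using True u by (simp add: A_def B_def algebra_simps)
          next
            case False
            then have "1 < u" using u1 by simp
            then have "M = 1 / u" using u_ge by (simp add: M_def min_def)
            then show ?thesis using \<open>1 < u\<close> us by (simp add: A_def B_def algebra_simps)
          qed
          finally show ?thesis .
        next
          case gt: False
          have "u / E \<le> u" using u E by (simp add: pos_divide_le_eq)
          then have "\<not> u \<le> 1" using gt u_le by (auto simp: M_def min_def)
          then have "M = 1 / u" using u_ge by (simp add: M_def min_def)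
          then have "1 / u < u / E" using gt by simp
          then have "E < u * u" using u E by (simp add: field_simps)
          then have "\<not> u \<le> sqrt E" using u by (simp add: not_le real_less_lsqrt power2_eq_square)
          then show ?thesis using gt \<open>\<not> u \<le> 1\<close> by (simp add: A_def B_def)
        qed
        finally show ?thesis .
      qed
    qed
  qed
  also have "\<dots> = (\<integral>\<^sup>+u. A u \<partial>lborel) + (\<integral>\<^sup>+u. B u \<partial>lborel)"
    unfolding A_def B_def by (rule nn_integral_add) auto
  also have "(\<integral>\<^sup>+u. A u \<partial>lborel) = ennreal ((1 - 1 / E) * 1\<^sup>2 - (1 - 1 / E) * 0\<^sup>2)"
    unfolding A_def using E
    by (intro nn_integral_FTC_Icc) (auto intro!: derivative_eq_intros simp: divide_le_eq)
  also have "(\<integral>\<^sup>+u. B u \<partial>lborel) = ennreal ((2 * ln (sqrt E) - (sqrt E)\<^sup>2 / E) - (2 * ln 1 - 1\<^sup>2 / E))"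
    unfolding B_def
  proof (intro nn_integral_FTC_Icc)
    fix x assume x: "x \<in> {1..sqrt E}"
    show "((\<lambda>x. 2 * ln x - x\<^sup>2 / E) has_real_derivative 2 / x - 2 * x / E) (at x)"
      using x E by (auto intro!: derivative_eq_intros simp: field_simps)
    have "x * x \<le> sqrt E * sqrt E" using x E by (intro mult_mono) auto
    then show "0 \<le> 2 / x - 2 * x / E" using x E by (simp add: field_simps)
  qed (use sE in auto)
  also have "ennreal ((1 - 1 / E) * 1\<^sup>2 - (1 - 1 / E) * 0\<^sup>2) + \<dots> = ennreal (ln E)"
  proof -
    have "0 \<le> ln E - 1 + 1 / E"
      using ln_le_minus_one[of "1 / E"] E by (simp add: ln_div)
    moreover have "2 * ln (sqrt E) = ln E" using E by (simp add: ln_sqrt)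
    ultimately show ?thesis
      using E by (subst ennreal_plus[symmetric]) (auto simp: divide_le_eq)
  qed
  finally show ?thesis .
qed

text \<open>For each nonzero u at most six values of v lie on the boundary curves, and
  \<open>nn_integral_sheared\<close> carries the null set over to lattice coordinates. Off the
  boundary the rounded indicator functions converge pointwise.\<close>

lemma hyp_sector_boundary_null:
  fixes E \<theta> \<theta>' :: real
  assumes "E > 1" "\<theta>' \<noteq> \<theta>"
  shows "AE z in lborel \<Otimes>\<^sub>M lborel. (fst z + snd z * \<theta>, fst z + snd z * \<theta>') \<notin>
    {(u, v). u = 0 \<or> \<bar>v\<bar> = u \<or> u = E * \<bar>v\<bar> \<or> u * \<bar>v\<bar> = 1}" (is "AE z in _. ?T z \<notin> ?B")
proof -
  have "?B = {z. fst z = 0} \<union> {z. \<bar>snd z\<bar> = fst z} \<union> {z. fst z = E * \<bar>snd z\<bar>} \<union> {z. fst z * \<bar>snd z\<bar> = 1}"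
    by auto
  moreover have c: "continuous_on UNIV (\<lambda>z :: real \<times> real. \<bar>snd z\<bar>)"
    by (intro continuous_on_rabs continuous_on_snd continuous_on_id)
  have "closed ({z. fst z = 0} \<union> {z. \<bar>snd z\<bar> = fst z} \<union> {z. fst z = E * \<bar>snd z\<bar>} \<union> {z. fst z * \<bar>snd z\<bar> = 1})"
    by (intro closed_Un closed_Collect_eq continuous_on_mult c continuous_on_fst
        continuous_on_const continuous_on_id)
  ultimately have B [measurable]: "?B \<in> sets (borel \<Otimes>\<^sub>M borel)"
    unfolding borel_prod by (simp only: borel_closed)
  have "(\<integral>\<^sup>+u. \<integral>\<^sup>+v. indicator ?B (u, v) \<partial>lborel \<partial>lborel) = (\<integral>\<^sup>+u. 0 \<partial>(lborel :: real measure))"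
  proof (rule nn_integral_cong_AE)
    have "AE u in lborel. u \<noteq> (0 :: real)" by (rule AE_lborel_singleton)
    then show "AE u in lborel. (\<integral>\<^sup>+v. indicator ?B (u, v) \<partial>lborel) = 0"
    proof eventually_elim
      fix u :: real assume u: "u \<noteq> 0"
      have "AE v in lborel. v \<notin> {u, - u, u / E, - u / E, 1 / u, - 1 / u}"
        by (intro AE_not_in countable_imp_null_set_lborel) auto
      then have "AE v in lborel. indicator ?B (u, v) = (0 :: ennreal)"
      proof eventually_elim
        fix v assume v: "v \<notin> {u, - u, u / E, - u / E, 1 / u, - 1 / u}"
        have "(u, v) \<notin> ?B" using u v assms(1) by (auto simp: abs_if field_simps split: if_splits)
        then show "indicator ?B (u, v) = (0 :: ennreal)" by (auto simp: indicator_def)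
      qed
      then show "(\<integral>\<^sup>+v. indicator ?B (u, v) \<partial>lborel) = 0"
        by (subst nn_integral_cong_AE[where v = "\<lambda>_. 0"]) auto
    qed
  qed
  then have "ennreal \<bar>\<theta>' - \<theta>\<bar> * (\<integral>\<^sup>+z. indicator ?B (?T z) \<partial>(lborel \<Otimes>\<^sub>M lborel)) = 0"
    by (subst nn_integral_sheared[OF _ assms(2)]) auto
  then have "(\<integral>\<^sup>+z. indicator ?B (?T z) \<partial>(lborel \<Otimes>\<^sub>M lborel)) = 0"
    using assms(2) by auto
  then have "AE z in lborel \<Otimes>\<^sub>M lborel. indicator ?B (?T z) = (0 :: ennreal)"
    by (subst (asm) nn_integral_0_iff_AE) auto
  then show ?thesis by eventually_elim (auto simp: indicator_def split: if_splits)
qed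

text \<open>The number of lattice points divided by \<open>q\<^sup>2\<close> is the integral of the indicator function of the
  sector precomposed with rounding to the lattice scaled by \<open>1 / q\<close>; by dominated convergence it
  tends to the area of the sector divided by the covolume of the lattice.\<close>

lemma lattice_points_hyp_sector:
  fixes \<theta> \<theta>' E c :: real and q :: "nat \<Rightarrow> real"
  assumes E: "E > 1" and \<theta>: "\<theta>' \<noteq> \<theta>" and c: "c > 0" "\<And>n. c \<le> q n"
    and q: "filterlim q at_top sequentially"
  defines "S \<equiv> \<lambda>n. {(s :: int, t :: int).
    ((of_int s + of_int t * \<theta>) / q n, (of_int s + of_int t * \<theta>') / q n) \<in> hyp_sector E}"
  shows "finite (S n)" and "(\<lambda>n. card (S n) / (q n)\<^sup>2) \<longlonglongrightarrow> ln E / \<bar>\<theta>' - \<theta>\<bar>"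
proof -
  define T where "T z = (fst z + snd z * \<theta>, fst z + snd z * \<theta>')" for z :: "real \<times> real"
  define r where "r n x = of_int \<lfloor>q n * x\<rfloor> / q n" for n x
  \<comment> \<open>t is the difference of the two coordinates divided by \<theta>' - \<theta>, and
    in the sector both coordinates are at most E in absolute value.\<close>
  define B1 where "B1 = 2 * E / \<bar>\<theta>' - \<theta>\<bar>"
  define B2 where "B2 = E + B1 * \<bar>\<theta>\<bar>"
  have q0: "q n > 0" for n using c(1) c(2)[of n] by simp
  have B: "\<bar>t\<bar> \<le> B1" "\<bar>s\<bar> \<le> B2" if "T (s, t) \<in> hyp_sector E" for s t
  proof -
    have uv: "\<bar>s + t * \<theta>\<bar> \<le> E" "\<bar>s + t * \<theta>'\<bar> \<le> E"
      using hyp_sector_bounded[OF E, of "s + t * \<theta>" "s + t * \<theta>'"] that by (auto simp: T_def)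
    have "\<bar>t\<bar> * \<bar>\<theta>' - \<theta>\<bar> = \<bar>(s + t * \<theta>') - (s + t * \<theta>)\<bar>"
      by (simp add: abs_mult[symmetric] algebra_simps)
    also have "\<dots> \<le> 2 * E" using uv by linarith
    finally show t: "\<bar>t\<bar> \<le> B1" using \<theta> by (simp add: B1_def field_simps)
    have "\<bar>t * \<theta>\<bar> \<le> B1 * \<bar>\<theta>\<bar>" using t by (simp add: abs_mult mult_right_mono)
    then show "\<bar>s\<bar> \<le> B2" using uv unfolding B2_def by linarith
  qed
  have S_iff: "(s, t) \<in> S n \<longleftrightarrow> T (of_int s / q n, of_int t / q n) \<in> hyp_sector E" for s t n
    by (simp add: S_def T_def add_divide_distrib)
  show fin: "finite (S n)" for n
  proof (rule finite_subset)
    show "S n \<subseteq> {-\<lceil>B2 * q n\<rceil>..\<lceil>B2 * q n\<rceil>} \<times> {-\<lceil>B1 * q n\<rceil>..\<lceil>B1 * q n\<rceil>}"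
    proof
      fix x assume x: "x \<in> S n"
      obtain s t where st: "x = (s, t)" by (cases x)
      then have "\<bar>of_int t / q n\<bar> \<le> B1" "\<bar>of_int s / q n\<bar> \<le> B2"
        using B[of "of_int s / q n" "of_int t / q n"] x unfolding st S_iff by blast+
      then have "\<bar>real_of_int t\<bar> \<le> B1 * q n" "\<bar>real_of_int s\<bar> \<le> B2 * q n"
        using q0[of n] by (simp_all add: abs_divide divide_le_eq)
      then show "x \<in> {-\<lceil>B2 * q n\<rceil>..\<lceil>B2 * q n\<rceil>} \<times> {-\<lceil>B1 * q n\<rceil>..\<lceil>B1 * q n\<rceil>}"
        using st by (auto; linarith)
    qed
  qed auto
  define h where "h n z = (indicator (hyp_sector E) (T (r n (fst z), r n (snd z))) :: ennreal)" for n z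
  \<comment> \<open>The summand 1 / c allows for the rounding error, which is at most
    \<open>1 / q n\<close>.\<close>
  define b where "b = B1 + B2 + 1 / c"
  have T_meas [measurable]: "T \<in> borel \<Otimes>\<^sub>M borel \<rightarrow>\<^sub>M borel \<Otimes>\<^sub>M borel"
    unfolding T_def by measurable
  have r_meas [measurable]: "r n \<in> borel \<rightarrow>\<^sub>M borel" for n
    unfolding r_def by measurable
  have count: "(\<integral>\<^sup>+z. h n z \<partial>(lborel \<Otimes>\<^sub>M lborel)) = ennreal (card (S n) / (q n)\<^sup>2)" for n
    using nn_integral_floor_indicator[OF q0[of n] fin[of n]]
    by (simp add: h_def r_def indicator_def S_iff)
  have r_bound: "\<bar>x - r n x\<bar> \<le> 1 / q n" for n x
  proof -
    have "\<bar>q n * x - of_int \<lfloor>q n * x\<rfloor>\<bar> \<le> 1" by linarith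
    moreover have "x - r n x = (q n * x - of_int \<lfloor>q n * x\<rfloor>) / q n"
      using q0[of n] by (simp add: r_def field_simps)
    ultimately show ?thesis using q0[of n] by (simp add: abs_divide divide_right_mono)
  qed
  have r_lim: "(\<lambda>n. r n x) \<longlonglongrightarrow> x" for x
  proof -
    have "(\<lambda>n. 1 / q n) \<longlonglongrightarrow> 0"
      using q by (simp add: tendsto_inverse_0_at_top flip: inverse_eq_divide)
    then have "(\<lambda>n. x - r n x) \<longlonglongrightarrow> 0"
      by (rule Lim_null_comparison[rotated]) (auto intro!: always_eventually simp: r_bound)
    then have "(\<lambda>n. x - (x - r n x)) \<longlonglongrightarrow> x - 0" by (intro tendsto_intros)
    then show ?thesis by simp
  qed
  have "(\<lambda>n. \<integral>\<^sup>+z. h n z \<partial>(lborel \<Otimes>\<^sub>M lborel)) \<longlonglongrightarrow>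
      (\<integral>\<^sup>+z. indicator (hyp_sector E) (T z) \<partial>(lborel \<Otimes>\<^sub>M lborel))"
  proof (rule nn_integral_dominated_convergence)
    show "h n \<in> borel_measurable (lborel \<Otimes>\<^sub>M lborel)" for n
      unfolding h_def by measurable
    show "(\<lambda>z. indicator (hyp_sector E) (T z)) \<in> borel_measurable (lborel \<Otimes>\<^sub>M lborel)"
      by measurable
    show "(\<lambda>z. indicator ({-b..b} \<times> {-b..b}) z) \<in> borel_measurable (lborel \<Otimes>\<^sub>M lborel)"
      by measurable
    show "AE z in lborel \<Otimes>\<^sub>M lborel. h n z \<le> indicator ({-b..b} \<times> {-b..b}) z" for n
    proof (rule AE_I2)
      fix z :: "real \<times> real"
      have "z \<in> {-b..b} \<times> {-b..b}" if "T (r n (fst z), r n (snd z)) \<in> hyp_sector E"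
      proof -
        have "1 / q n \<le> 1 / c" using c by (simp add: frac_le)
        moreover have "0 \<le> B1" "0 \<le> B2" using E by (simp_all add: B1_def B2_def)
        ultimately have "\<bar>fst z\<bar> \<le> b" "\<bar>snd z\<bar> \<le> b"
          using B[OF that] r_bound[of "fst z" n] r_bound[of "snd z" n] unfolding b_def by linarith+
        then show ?thesis by (cases z) auto
      qed
      then show "h n z \<le> indicator ({-b..b} \<times> {-b..b}) z" by (auto simp: h_def indicator_def)
    qed
    show "(\<integral>\<^sup>+z. indicator ({-b..b} \<times> {-b..b}) z \<partial>(lborel \<Otimes>\<^sub>M lborel)) < \<infinity>"
      by (simp add: lborel.emeasure_pair_measure_Times ennreal_mult_less_top emeasure_lborel_Icc_eq)
    show "AE z in lborel \<Otimes>\<^sub>M lborel. (\<lambda>n. h n z) \<longlonglongrightarrow> indicator (hyp_sector E) (T z)"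
      using hyp_sector_boundary_null[OF E \<theta>]
    proof eventually_elim
      fix z :: "real \<times> real"
      obtain u v where Tz: "T z = (u, v)" by (cases "T z")
      assume "(fst z + snd z * \<theta>, fst z + snd z * \<theta>') \<notin>
        {(u, v). u = 0 \<or> \<bar>v\<bar> = u \<or> u = E * \<bar>v\<bar> \<or> u * \<bar>v\<bar> = 1}"
      then have nb: "u \<noteq> 0" "\<bar>v\<bar> \<noteq> u" "u \<noteq> E * \<bar>v\<bar>" "u * \<bar>v\<bar> \<noteq> 1"
        using Tz by (auto simp: T_def)
      have lim: "(\<lambda>n. T (r n (fst z), r n (snd z))) \<longlonglongrightarrow> (u, v)"
        unfolding Tz[symmetric] T_def by (auto intro!: tendsto_intros r_lim)
      have l: "(\<lambda>n. fst (T (r n (fst z), r n (snd z)))) \<longlonglongrightarrow> u"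
        "(\<lambda>n. snd (T (r n (fst z), r n (snd z)))) \<longlonglongrightarrow> v"
        using tendsto_fst[OF lim] tendsto_snd[OF lim] by simp_all
      note l2 = tendsto_rabs[OF l(2)]
      note l3 = tendsto_mult[OF tendsto_const[of E] l2]
      note l4 = tendsto_mult[OF l(1) l2]
      \<comment> \<open>Off the boundary either all defining inequalities hold strictly or one of
        them fails strictly, so membership is eventually constant along the rounded points.\<close>
      have "\<forall>\<^sub>F n in sequentially. T (r n (fst z), r n (snd z)) \<in> hyp_sector E \<longleftrightarrow> T z \<in> hyp_sector E"
      proof (cases "(u, v) \<in> hyp_sector E")
        case True
        then have s: "0 < u" "\<bar>v\<bar> < u" "u < E * \<bar>v\<bar>" "u * \<bar>v\<bar> < 1"
          using nb by (auto simp: hyp_sector_def)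
        have s': "0 < u - \<bar>v\<bar>" "0 < E * \<bar>v\<bar> - u" using s by auto
        show ?thesis
          using order_tendstoD(1)[OF l(1) s(1)] order_tendstoD(2)[OF l4 s(4)]
            order_tendstoD(1)[OF tendsto_diff[OF l(1) l2] s'(1)] order_tendstoD(1)[OF tendsto_diff[OF l3 l(1)] s'(2)]
          unfolding Tz by eventually_elim (use True in \<open>auto simp: hyp_sector_def split_beta\<close>)
      next
        case False
        then consider "u < 0" | "0 < \<bar>v\<bar> - u" | "0 < u - E * \<bar>v\<bar>" | "1 < u * \<bar>v\<bar>"
          using nb by (auto simp: hyp_sector_def)
        then show ?thesis
        proof cases
          case 1
          show ?thesis using order_tendstoD(2)[OF l(1) 1] unfolding Tz
            by eventually_elim (use False in \<open>auto simp: hyp_sector_def split_beta\<close>)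
        next
          case 2
          show ?thesis using order_tendstoD(1)[OF tendsto_diff[OF l2 l(1)] 2] unfolding Tz
            by eventually_elim (use False in \<open>auto simp: hyp_sector_def split_beta\<close>)
        next
          case 3
          show ?thesis using order_tendstoD(1)[OF tendsto_diff[OF l(1) l3] 3] unfolding Tz
            by eventually_elim (use False in \<open>auto simp: hyp_sector_def split_beta\<close>)
        next
          case 4
          show ?thesis using order_tendstoD(1)[OF l4 4] unfolding Tz
            by eventually_elim (use False in \<open>auto simp: hyp_sector_def split_beta\<close>)
        qed
      qed
      then show "(\<lambda>n. h n z) \<longlonglongrightarrow> indicator (hyp_sector E) (T z)"
        by (intro tendsto_eventually, eventually_elim) (auto simp: h_def indicator_def)
    qed
  qed
  also have "(\<integral>\<^sup>+z. indicator (hyp_sector E) (T z) \<partial>(lborel \<Otimes>\<^sub>M lborel)) = ennreal (ln E / \<bar>\<theta>' - \<theta>\<bar>)"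
  proof -
    define I where "I = (\<integral>\<^sup>+z. indicator (hyp_sector E) (T z) \<partial>(lborel \<Otimes>\<^sub>M lborel))"
    have "ennreal \<bar>\<theta>' - \<theta>\<bar> * I = ennreal (ln E)"
      unfolding I_def T_def using nn_integral_sheared[OF _ \<theta>, of "indicator (hyp_sector E)"]
      by (simp add: hyp_sector_area[OF E])
    then have "ennreal (1 / \<bar>\<theta>' - \<theta>\<bar>) * (ennreal \<bar>\<theta>' - \<theta>\<bar> * I) = ennreal (ln E / \<bar>\<theta>' - \<theta>\<bar>)"
      using E by (simp add: ennreal_mult[symmetric])
    moreover have "ennreal (1 / \<bar>\<theta>' - \<theta>\<bar>) * ennreal \<bar>\<theta>' - \<theta>\<bar> = 1"
      using \<theta> by (simp add: ennreal_mult[symmetric])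
    ultimately show ?thesis unfolding I_def by (simp add: mult.assoc[symmetric])
  qed
  finally show "(\<lambda>n. card (S n) / (q n)\<^sup>2) \<longlonglongrightarrow> ln E / \<bar>\<theta>' - \<theta>\<bar>"
    unfolding count using E by (subst (asm) tendsto_ennreal_iff) (auto intro!: always_eventually)
qed

section \<open>Roots of the norm form and divisor sums of the Legendre symbol\<close>

definition dconv :: "(nat \<Rightarrow> int) \<Rightarrow> (nat \<Rightarrow> int) \<Rightarrow> nat \<Rightarrow> int" where
  "dconv F G n = (\<Sum>d | d dvd n. F d * G (n div d))"

definition multiplicative :: "(nat \<Rightarrow> int) \<Rightarrow> bool" where
  "multiplicative F \<longleftrightarrow> F 1 = 1 \<and> (\<forall>m n. m > 0 \<longrightarrow> n > 0 \<longrightarrow> coprime m n \<longrightarrow> F (m * n) = F m * F n)"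

lemma multiplicative_dconv:
  assumes F: "multiplicative F" and G: "multiplicative G"
  shows "multiplicative (dconv F G)"
  unfolding multiplicative_def
proof (intro conjI allI impI)
  show "dconv F G 1 = 1" using F G by (simp add: dconv_def multiplicative_def)
next
  fix m n :: nat assume mn: "m > 0" "n > 0" "coprime m n"
  have inj: "inj_on (\<lambda>(a, b). a * b) ({a. a dvd m} \<times> {b. b dvd n})"
  proof (rule inj_onI, clarify)
    fix a b a' b' assume d: "a dvd m" "b dvd n" "a' dvd m" "b' dvd n" and eq: "a * b = a' * b'"
    have c: "coprime a b'" "coprime a' b"
      using coprime_divisors[OF d(1) d(4) mn(3)] coprime_divisors[OF d(3) d(2) mn(3)] by auto
    have "a dvd a' * b'" "a' dvd a * b" "b dvd a' * b'" "b' dvd a * b"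
      using dvd_triv_left[of a b] dvd_triv_left[of a' b'] dvd_triv_right[of b a] dvd_triv_right[of b' a']
      by (simp_all only: eq)
    then have "a dvd a'" "a' dvd a" "b dvd b'" "b' dvd b"
      using c by (simp_all add: coprime_dvd_mult_left_iff coprime_dvd_mult_right_iff coprime_commute)
    then show "a = a' \<and> b = b'" by (simp add: dvd_antisym)
  qed
  have img: "(\<lambda>(a, b). a * b) ` ({a. a dvd m} \<times> {b. b dvd n}) = {d. d dvd m * n}"
  proof (intro equalityI subsetI)
    fix d assume "d \<in> {d. d dvd m * n}"
    then obtain a b where "d = a * b" "a dvd m" "b dvd n" using division_decomp by blast
    then show "d \<in> (\<lambda>(a, b). a * b) ` ({a. a dvd m} \<times> {b. b dvd n})" by auto
  qed (auto intro: mult_dvd_mono)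
  have "dconv F G (m * n) = (\<Sum>x\<in>{a. a dvd m} \<times> {b. b dvd n}.
      F (fst x * snd x) * G ((m * n) div (fst x * snd x)))"
    unfolding dconv_def img[symmetric] sum.reindex[OF inj] by (simp add: split_beta)
  also have "\<dots> = (\<Sum>x\<in>{a. a dvd m} \<times> {b. b dvd n}.
      (F (fst x) * G (m div fst x)) * (F (snd x) * G (n div snd x)))"
  proof (rule sum.cong[OF refl], clarify)
    fix a b assume d: "a dvd m" "b dvd n"
    then have pos: "a > 0" "b > 0" "m div a > 0" "n div b > 0"
      using mn by (auto intro: dvd_pos_nat simp: dvd_imp_le div_greater_zero_iff)
    have "coprime a b" using mn(3) d coprime_divisors by blast
    moreover have "coprime (m div a) (n div b)"
    proof (rule coprime_divisors[OF _ _ mn(3)])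
      show "m div a dvd m" using dvd_mult_div_cancel[OF d(1)] by (metis dvd_triv_right)
      show "n div b dvd n" using dvd_mult_div_cancel[OF d(2)] by (metis dvd_triv_right)
    qed
    moreover have "(m * n) div (a * b) = (m div a) * (n div b)"
      using d by (simp add: div_mult_div_if_dvd)
    ultimately show "F (fst (a, b) * snd (a, b)) * G (m * n div (fst (a, b) * snd (a, b))) =
        F (fst (a, b)) * G (m div fst (a, b)) * (F (snd (a, b)) * G (n div snd (a, b)))"
      using F G pos by (simp add: multiplicative_def)
  qed
  also have "\<dots> = dconv F G m * dconv F G n"
    unfolding dconv_def sum_product by (subst sum.cartesian_product) (simp add: split_beta)
  finally show "dconv F G (m * n) = dconv F G m * dconv F G n" .
qed

lemma multiplicative_eqI:
  assumes F: "multiplicative F" and G: "multiplicative G"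
    and pp: "\<And>q k. prime q \<Longrightarrow> F (q ^ k) = G (q ^ k)"
    and n: "n > 0"
  shows "F n = G n"
  using n
proof (induction n rule: less_induct)
  case (less n)
  show ?case
  proof (cases "n = 1")
    case True
    then show ?thesis using F G by (simp add: multiplicative_def)
  next
    case False
    then obtain q where q: "prime q" "q dvd n" using prime_factor_nat by blast
    define k where "k = multiplicity q n"
    obtain y where y: "n = q ^ k * y" "\<not> q dvd y"
      using multiplicity_decompose'[of n q] less.prems q prime_gt_1_nat[OF q(1)] by (auto simp: k_def mult.commute)
    have k: "k > 0" using q less.prems unfolding k_def
      by (simp add: prime_multiplicity_gt_zero_iff)
    have y0: "y > 0" using y less.prems by (cases y) auto
    have "q ^ k > 1" using k q prime_gt_1_nat one_less_power by blast
    then have "y < n" using y y0 by simp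
    moreover have "coprime (q ^ k) y" using q y by (simp add: prime_imp_coprime_nat)
    ultimately show ?thesis
      using F G pp[OF q(1)] less.IH[of y] y y0 q by (simp add: multiplicative_def prime_gt_0_nat)
  qed
qed

lemma dconv_prime_power:
  assumes q: "prime (q :: nat)"
  shows "dconv F G (q ^ k) = (\<Sum>i\<le>k. F (q ^ i) * G (q ^ (k - i)))"
proof -
  have "{d. d dvd q ^ k} = (\<lambda>i. q ^ i) ` {..k}"
    using divides_primepow_nat[OF q] by auto
  moreover have "inj_on (\<lambda>i. q ^ i) {..k}"
    using prime_gt_1_nat[OF q] by (auto simp: inj_on_def)
  ultimately have "dconv F G (q ^ k) = (\<Sum>i\<le>k. F (q ^ i) * G (q ^ k div q ^ i))"
    by (simp add: dconv_def sum.reindex)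
  also have "\<dots> = (\<Sum>i\<le>k. F (q ^ i) * G (q ^ (k - i)))"
    using prime_gt_0_nat[OF q] by (intro sum.cong refl) (simp add: power_diff)
  finally show ?thesis .
qed

text \<open>Every nonzero ideal is an integer d times a primitive ideal, and d contributes its
  square to the norm; convolution with this indicator accounts for d.\<close>

definition square_ind :: "nat \<Rightarrow> int" where
  "square_ind n = (if is_nth_power 2 n then 1 else 0)"

lemma multiplicative_square_ind: "multiplicative square_ind"
  by (auto simp: multiplicative_def square_ind_def is_nth_power_mult_coprime_nat_iff)

lemma square_ind_prime_power: "prime q \<Longrightarrow> square_ind (q ^ k) = (if even k then 1 else 0)"
  by (simp add: square_ind_def is_nth_power_prime_power_nat_iff)

section \<open>Roots of the norm form modulo prime powers\<close>

locale prime_1_mod_4 = odd_prime +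
  assumes p_mod_4: "p mod 4 = 1"
begin

text \<open>The constant of the minimal polynomial X^2 - X - K of (1 + sqrt p) / 2.\<close>

definition K :: int where "K = int ((p - 1) div 4)"

lemma p_eq_K: "int p = 4 * K + 1"
  using p_mod_4 unfolding K_def by presburger

definition f :: "int \<Rightarrow> int" where "f b = b * b + b - K"

lemma four_f: "4 * f b = (2 * b + 1) * (2 * b + 1) - int p"
  by (simp add: f_def p_eq_K algebra_simps)

lemma f_diff: "f b - f c = (b - c) * (b + c + 1)"
  by (simp add: f_def algebra_simps)

lemma dvd_f_cong: "n dvd b - c \<Longrightarrow> n dvd f b \<longleftrightarrow> n dvd f c"
  using f_diff[of b c] by (metis dvd_diff_right_iff dvd_mult2 dvd_diff_left_iff)

lemma dvd_f_mod: "n dvd f (b mod n) \<longleftrightarrow> n dvd f b"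
  by (rule dvd_f_cong) (metis dvd_minus_mod minus_diff_eq dvd_minus_iff)

text \<open>\<open>f b\<close> is the norm of \<open>b + (1 + sqrt p) / 2\<close>; its roots modulo \<open>a\<close> parametrize the primitive
  ideals of norm \<open>a\<close>.\<close>

definition roots :: "nat \<Rightarrow> int set" where
  "roots n = {b \<in> {0..<int n}. int n dvd f b}"

definition rho :: "nat \<Rightarrow> int" where "rho n = int (card (roots n))"

lemma finite_roots [simp]: "finite (roots n)"
  unfolding roots_def by (rule finite_Collect_conjI) simp

lemma multiplicative_rho: "multiplicative rho"
  unfolding multiplicative_def
proof (intro conjI allI impI)
  have "roots 1 = {0}" by (auto simp: roots_def)
  then show "rho 1 = 1" by (simp add: rho_def)
next
  fix m n :: nat assume mn: "m > 0" "n > 0" "coprime m n"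
  have cop: "coprime (int m) (int n)" using mn by simp
  have "bij_betw (\<lambda>b. (b mod int m, b mod int n)) (roots (m * n)) (roots m \<times> roots n)"
  proof (rule bij_betwI')
    fix x y assume xy: "x \<in> roots (m * n)" "y \<in> roots (m * n)"
    have "x = y" if "x mod int m = y mod int m" "x mod int n = y mod int n"
    proof -
      have "int m dvd x - y" "int n dvd x - y" using that by (simp_all add: mod_eq_dvd_iff)
      then have "int m * int n dvd x - y" using cop by (rule divides_mult)
      then have "x mod int (m * n) = y mod int (m * n)" by (simp add: mod_eq_dvd_iff)
      then show ?thesis using xy by (simp add: roots_def)
    qed
    then show "((x mod int m, x mod int n) = (y mod int m, y mod int n)) = (x = y)" by auto
  next
    fix x assume "x \<in> roots (m * n)"
    then have "int m dvd f x" "int n dvd f x" by (auto simp: roots_def dest: dvd_mult_left dvd_mult_right)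
    then show "(x mod int m, x mod int n) \<in> roots m \<times> roots n"
      using mn by (simp add: roots_def dvd_f_mod)
  next
    fix z assume z: "z \<in> roots m \<times> roots n"
    obtain x y where xy: "z = (x, y)" by (cases z)
    obtain b where b: "[b = x] (mod int m)" "[b = y] (mod int n)"
      using binary_chinese_remainder_int[OF cop] by blast
    have bm: "b mod int m = x" "b mod int n = y"
      using b z xy by (auto simp: cong_def roots_def)
    define b' where "b' = b mod int (m * n)"
    have b': "b' mod int m = x" "b' mod int n = y"
      using bm by (simp_all add: b'_def mod_mod_cancel)
    have "int m dvd f b'" "int n dvd f b'"
      using z xy dvd_f_mod[of "int m" b'] dvd_f_mod[of "int n" b'] b' by (auto simp: roots_def)
    then have "int m * int n dvd f b'" using cop by (rule divides_mult)
    then have "b' \<in> roots (m * n)" using mn by (simp add: roots_def b'_def)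
    then show "\<exists>b\<in>roots (m * n). z = (b mod int m, b mod int n)" using b' xy by blast
  qed
  then have "card (roots (m * n)) = card (roots m \<times> roots n)" by (rule bij_betw_same_card)
  then show "rho (m * n) = rho m * rho n" by (simp add: rho_def card_cartesian_product)
qed

text \<open>2 b + 1 is the derivative of \<open>f\<close> at b, and (2 b + 1)^2 - 4 f b = p; so
  roots modulo a prime other than p are simple.\<close>

lemma two_b_plus_1_not_dvd:
  assumes q: "prime q" "q \<noteq> p" and b: "int q dvd f b"
  shows "\<not> int q dvd 2 * b + 1"
proof
  assume "int q dvd 2 * b + 1"
  then have "int q dvd (2 * b + 1) * (2 * b + 1) - 4 * f b" using b by simp
  then have "int q dvd int p" by (simp add: four_f)
  then show False using q prime_p primes_dvd_imp_eq by auto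
qed

text \<open>Hensel lifting: a simple root modulo one power of q has exactly one lift modulo the
  next.\<close>

lemma rho_prime_power_Suc:
  assumes q: "prime q" "q \<noteq> p" and k: "k > 0"
  shows "rho (q ^ Suc k) = rho (q ^ k)"
proof -
  define Q where "Q = int q"
  have Q: "prime Q" "Q > 0" using q by (auto simp: Q_def prime_gt_0_nat)
  have Qk: "Q dvd Q ^ k" using k by (simp add: dvd_power)
  have "bij_betw (\<lambda>b. b mod Q ^ k) (roots (q ^ Suc k)) (roots (q ^ k))"
  proof (rule bij_betwI')
    fix x y assume xy: "x \<in> roots (q ^ Suc k)" "y \<in> roots (q ^ Suc k)"
    have "x = y" if "x mod Q ^ k = y mod Q ^ k"
    proof -
      have d: "Q ^ Suc k dvd f x" "Q ^ Suc k dvd f y" using xy by (auto simp: roots_def Q_def)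
      have "Q ^ k dvd x - y" using that by (simp add: mod_eq_dvd_iff)
      then have "Q dvd x - y" using Qk dvd_trans by blast
      have "\<not> Q dvd 2 * x + 1"
        using two_b_plus_1_not_dvd[OF q, of x] d by (auto simp: Q_def dest: dvd_mult_left)
      moreover have "2 * x + 1 = (x + y + 1) + (x - y)" by simp
      ultimately have "\<not> Q dvd x + y + 1" using \<open>Q dvd x - y\<close> by (metis dvd_add)
      then have "coprime (Q ^ Suc k) (x + y + 1)"
        using Q(1) by (simp add: prime_imp_coprime)
      moreover have "Q ^ Suc k dvd (x - y) * (x + y + 1)" using d f_diff[of x y] by (metis dvd_diff)
      ultimately have "Q ^ Suc k dvd x - y" by (simp add: coprime_dvd_mult_left_iff)
      then have "x mod Q ^ Suc k = y mod Q ^ Suc k" by (simp add: mod_eq_dvd_iff)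
      then show ?thesis using xy by (simp add: roots_def Q_def)
    qed
    then show "(x mod Q ^ k = y mod Q ^ k) = (x = y)" by auto
  next
    fix x assume "x \<in> roots (q ^ Suc k)"
    then have "Q ^ k dvd f x" by (auto simp: roots_def Q_def dest: dvd_mult_right)
    then have "Q ^ k dvd f (x mod Q ^ k)" by (simp add: dvd_f_mod)
    then show "x mod Q ^ k \<in> roots (q ^ k)"
      using Q by (simp add: roots_def Q_def)
  next
    fix c assume c: "c \<in> roots (q ^ k)"
    then obtain w where w: "f c = Q ^ k * w" by (auto simp: roots_def Q_def)
    then have "int q dvd f c" using Qk by (simp add: Q_def)
    then have "\<not> Q dvd 2 * c + 1" using two_b_plus_1_not_dvd[OF q] by (simp add: Q_def)
    then have "coprime (2 * c + 1) Q" using Q(1) by (simp add: prime_imp_coprime coprime_commute)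
    then obtain t0 where t0: "[(2 * c + 1) * t0 = 1] (mod Q)" using cong_solve_coprime_int by blast
    \<comment> \<open>Newton correction: it solves \<open>w + t * (2 * c + 1) = 0\<close> modulo Q,
      where \<open>Q ^ k * w\<close> is the value of \<open>f\<close> at c.\<close>
    define t where "t = - w * t0"
    have "[w + t * (2 * c + 1) = w + - w * ((2 * c + 1) * t0)] (mod Q)"
      by (simp add: t_def mult_ac)
    also have "[w + - w * ((2 * c + 1) * t0) = w + - w * 1] (mod Q)"
      by (intro cong_add cong_mult t0 cong_refl)
    finally have "Q dvd w + t * (2 * c + 1)" by (simp add: cong_0_iff)
    then have "Q ^ Suc k dvd Q ^ k * (w + t * (2 * c + 1))" by (simp add: mult.commute)
    moreover have "Q ^ Suc k dvd t * t * (Q ^ k * Q ^ k)"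
      using Qk by (simp add: mult_dvd_mono mult.commute)
    ultimately have "Q ^ Suc k dvd Q ^ k * (w + t * (2 * c + 1)) + t * t * (Q ^ k * Q ^ k)" by (rule dvd_add)
    also have "\<dots> = f (c + t * Q ^ k)"
      using w by (simp add: f_def algebra_simps)
    finally have "Q ^ Suc k dvd f ((c + t * Q ^ k) mod Q ^ Suc k)" by (simp only: dvd_f_mod)
    then have 1: "(c + t * Q ^ k) mod Q ^ Suc k \<in> roots (q ^ Suc k)"
      using Q by (simp add: roots_def Q_def)
    have "(c + t * Q ^ k) mod Q ^ Suc k mod Q ^ k = (c + t * Q ^ k) mod Q ^ k"
      by (rule mod_mod_cancel) simp
    also have "\<dots> = c" using c by (simp add: roots_def Q_def)
    finally show "\<exists>x\<in>roots (q ^ Suc k). c = x mod Q ^ k" using 1 by metis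
  qed
  then show ?thesis unfolding rho_def by (simp add: bij_betw_same_card)
qed

text \<open>For odd q, completing the square makes p a square modulo q, and reciprocity carries no
  sign because p is 1 modulo 4. For q = 2 the value \<open>f b\<close> has the parity of K, and
  \<open>chi 2\<close> is (-1)^K.\<close>

lemma exists_root_iff:
  assumes q: "prime q" "q \<noteq> p"
  shows "roots q \<noteq> {} \<longleftrightarrow> chi (int q) = 1"
proof (cases "q = 2")
  case True
  have "m = 2 * nat K" using p_eq_K by (auto simp: K_def)
  then have "chi 2 = (-1) ^ nat K" by (simp add: chi_2)
  then have "chi 2 = 1 \<longleftrightarrow> even K"
    by (auto simp: minus_one_power_iff K_def)
  moreover have "even (f b) \<longleftrightarrow> even K" for b by (auto simp: f_def)
  ultimately show ?thesis using True by (auto simp: roots_def intro!: exI[of _ 0])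
next
  case False
  then have q2: "q > 2" "odd q" using q prime_gt_1_nat[of q] prime_odd_nat by fastforce+
  have nd: "\<not> int p dvd int q" using q prime_p primes_dvd_imp_eq by auto
  have nd': "\<not> int q dvd int p" using q prime_p primes_dvd_imp_eq by auto
  have "even m" using p_eq_K by (auto simp: K_def) presburger
  then have "Legendre (int p) (int q) * chi (int q) = 1"
    using Quadratic_Reciprocity[OF prime_p p_gt_2 q(1) q2(1)] q by (simp add: chi_def)
  then have "chi (int q) = 1 \<longleftrightarrow> Legendre (int p) (int q) = 1"
    using chi_cases[of "int q"] by auto
  also have "\<dots> \<longleftrightarrow> QuadRes (int q) (int p)"
    using nd' by (auto simp: Legendre_def cong_0_iff)
  also have "\<dots> \<longleftrightarrow> roots q \<noteq> {}"
  proof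
    assume "QuadRes (int q) (int p)"
    then obtain y where y: "[y\<^sup>2 = int p] (mod int q)" by (auto simp: QuadRes_def)
    \<comment> \<open>A solution of 2 b = y - 1 modulo q; the factor q + 1 is even, which makes the
      halving exact.\<close>
    define b where "b = (y - 1) * (int q + 1) div 2"
    have "2 * b = (y - 1) * (int q + 1)" using q2 by (simp add: b_def)
    then have b1: "2 * b + 1 = y + int q * (y - 1)" by (simp add: algebra_simps)
    have "(2 * b + 1) * (2 * b + 1) = y\<^sup>2 + int q * ((y - 1) * (2 * y + int q * (y - 1)))"
      unfolding b1 by (simp add: power2_eq_square algebra_simps)
    then have "4 * f b = (y\<^sup>2 - int p) + int q * ((y - 1) * (2 * y + int q * (y - 1)))"
      by (simp add: four_f)
    moreover have "int q dvd y\<^sup>2 - int p" using y by (simp add: cong_iff_dvd_diff)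
    ultimately have "int q dvd 4 * f b" by simp
    moreover have "coprime (int q) 4"
    proof -
      have "coprime (int q) 2" using q2 by simp
      then have "coprime (int q) (2 * 2)" by (simp only: coprime_mult_right_iff)
      then show ?thesis by simp
    qed
    ultimately have "int q dvd f b" by (simp add: coprime_dvd_mult_right_iff)
    then have "b mod int q \<in> roots q" using q2 by (simp add: roots_def dvd_f_mod)
    then show "roots q \<noteq> {}" by blast
  next
    assume "roots q \<noteq> {}"
    then obtain b where "int q dvd f b" by (auto simp: roots_def)
    then have "int q dvd (2 * b + 1)\<^sup>2 - int p" using four_f[of b] by (simp add: power2_eq_square flip: four_f)
    then show "QuadRes (int q) (int p)" by (auto simp: QuadRes_def cong_iff_dvd_diff)
  qed
  finally show ?thesis by simp
qed

text \<open>Roots come in pairs b, - 1 - b, which are distinct because 2 b + 1 is prime to q; the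
  factorization of \<open>f b - f x\<close> excludes others.\<close>

lemma rho_prime:
  assumes q: "prime q" "q \<noteq> p"
  shows "rho q = 1 + chi (int q)"
proof (cases "roots q = {}")
  case True
  have "chi (int q) \<noteq> 0"
    using q prime_p primes_dvd_imp_eq by (auto simp: chi_eq_0_iff)
  then have "chi (int q) = -1" using True exists_root_iff[OF q] chi_cases[of "int q"] by auto
  then show ?thesis using True by (simp add: rho_def)
next
  case False
  then obtain b where b: "b \<in> roots q" by blast
  define c where "c = (- 1 - b) mod int q"
  have q0: "q > 0" using q prime_gt_0_nat by blast
  have nd: "\<not> int q dvd 2 * b + 1" using two_b_plus_1_not_dvd[OF q] b by (simp add: roots_def)
  have "f (- 1 - b) = f b" by (simp add: f_def algebra_simps)
  then have c: "c \<in> roots q" using b q0 by (simp add: roots_def c_def dvd_f_mod)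
  have "b \<noteq> c"
  proof
    assume "b = c"
    then have "b mod int q = (- 1 - b) mod int q" using b by (simp add: c_def roots_def)
    then show False using nd by (simp add: mod_eq_dvd_iff)
  qed
  moreover have "roots q = {b, c}"
  proof (intro equalityI subsetI)
    fix x assume x: "x \<in> roots q"
    then have "int q dvd (b - x) * (b + x + 1)" using b f_diff[of b x] by (simp add: roots_def) (metis dvd_diff)
    then have "int q dvd b - x \<or> int q dvd b + x + 1"
      using q by (simp add: prime_dvd_mult_iff)
    then show "x \<in> {b, c}"
    proof
      assume "int q dvd b - x"
      then have "b mod int q = x mod int q" by (simp add: mod_eq_dvd_iff)
      then show ?thesis using b x by (simp add: roots_def)
    next
      assume "int q dvd b + x + 1"
      then have "x mod int q = (- 1 - b) mod int q" by (simp add: mod_eq_dvd_iff algebra_simps)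
      then show ?thesis using x by (simp add: c_def roots_def)
    qed
  qed (use b c in auto)
  ultimately show ?thesis using exists_root_iff[OF q] False by (simp add: rho_def)
qed

text \<open>At the ramified prime a root satisfies (2 x + 1)^2 = 0 modulo p, which leaves only (p -
  1) / 2.\<close>

lemma rho_p: "rho p = 1"
proof -
  have "2 * int m + 1 = int p" using p_eq by linarith
  then have "4 * f (int m) = int p * (int p - 1)"
    unfolding four_f by (simp add: algebra_simps)
  then have "int p dvd 4 * f (int m)" by simp
  moreover have "\<not> int p dvd 4"
  proof
    assume "int p dvd 4"
    then have "int p \<le> 4" by (rule zdvd_imp_le) simp
    then show False using p_eq_K p_gt_2 by presburger
  qed
  ultimately have "int p dvd f (int m)" using prime_int_p by (simp add: prime_dvd_mult_iff)
  moreover have "x = int m" if x: "x \<in> roots p" for x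
  proof -
    have "int p dvd (2 * x + 1) * (2 * x + 1) - int p" using x by (simp add: roots_def flip: four_f)
    then have "int p dvd (2 * x + 1) * (2 * x + 1)" by (simp add: dvd_diff_left_iff)
    then have "int p dvd 2 * x + 1" using prime_int_p by (simp add: prime_dvd_mult_iff)
    then obtain l where l: "2 * x + 1 = int p * l" by blast
    have "0 \<le> x" "x < int p" using x by (auto simp: roots_def)
    then have "0 < int p * l" "int p * l < int p * 2" using l by linarith+
    then have "l = 1" using p_gt_2 by (simp add: zero_less_mult_iff)
    then have "2 * x + 1 = int p" using l by simp
    then show ?thesis using p_eq by linarith
  qed
  moreover have "int m \<in> {0..<int p}" using p_eq by simp
  ultimately have "roots p = {int m}" by (auto simp: roots_def)
  then show ?thesis by (simp add: rho_def)
qed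

text \<open>If p divides 2 x + 1, then p^2 divides its square, so 4 f x = (2 x + 1)^2 - p cannot be
  divisible by p^2.\<close>

lemma rho_p_power:
  assumes "k \<ge> 2"
  shows "rho (p ^ k) = 0"
proof -
  have "False" if x: "x \<in> roots (p ^ k)" for x
  proof -
    have "int p ^ 2 dvd int p ^ k" using assms by (rule le_imp_power_dvd)
    then have d: "int p ^ 2 dvd 4 * f x" using x by (auto simp: roots_def intro: dvd_trans dvd_mult)
    then have "int p dvd (2 * x + 1) * (2 * x + 1) - int p"
      unfolding four_f by (metis dvd_mult_left power2_eq_square)
    then have "int p dvd (2 * x + 1) * (2 * x + 1)" by (simp add: dvd_diff_left_iff)
    then have "int p dvd 2 * x + 1" using prime_int_p by (simp add: prime_dvd_mult_iff)
    then have "int p ^ 2 dvd (2 * x + 1) * (2 * x + 1)" by (simp add: power2_eq_square mult_dvd_mono)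
    then have "int p ^ 2 dvd (2 * x + 1) * (2 * x + 1) - 4 * f x" using d by (rule dvd_diff)
    then have "int p * int p dvd int p * 1" by (simp add: four_f power2_eq_square)
    then have "int p dvd 1" using p_gt_2 by (subst (asm) dvd_mult_cancel_left) auto
    then show False using p_gt_2 by simp
  qed
  then have "roots (p ^ k) = {}" by blast
  then show ?thesis by (simp add: rho_def)
qed

lemma chi_power: "chi (a ^ n) = chi a ^ n"
  by (induction n) (simp_all add: chi_mult)

lemma multiplicative_chi: "multiplicative (\<lambda>n. chi (int n))"
  by (simp add: multiplicative_def chi_mult)

text \<open>The coefficient form of the factorization of the Dedekind zeta function into the Riemann
  zeta function and the L-series of \<open>chi\<close>. Both sides are multiplicative, so prime
  powers suffice.\<close>

lemma dconv_rho_square_ind: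
  assumes "n > 0"
  shows "dconv rho square_ind n = (\<Sum>d | d dvd n. chi (int d))"
proof -
  have "multiplicative (\<lambda>_. 1)" by (simp add: multiplicative_def)
  then have m1: "multiplicative (dconv (\<lambda>n. chi (int n)) (\<lambda>_. 1))"
    by (intro multiplicative_dconv multiplicative_chi)
  have m2: "multiplicative (dconv rho square_ind)"
    by (intro multiplicative_dconv multiplicative_rho multiplicative_square_ind)
  have pp: "dconv rho square_ind (q ^ k) = dconv (\<lambda>n. chi (int n)) (\<lambda>_. 1) (q ^ k)" if q: "prime q" for q k
  proof -
    define A where "A k = (\<Sum>i\<le>k. rho (q ^ i) * (if even (k - i) then 1 else 0))" for k
    define B where "B k = (\<Sum>i\<le>k. chi (int q) ^ i)" for k
    have rho1: "rho (Suc 0) = 1" using multiplicative_rho by (simp add: multiplicative_def)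
    have A2: "A (Suc (Suc k)) = A k + rho (q ^ Suc (Suc k))" for k
    proof -
      have "(\<Sum>i\<le>k. rho (q ^ i) * (if even (Suc (Suc k) - i) then 1 else 0)) = A k"
        unfolding A_def by (intro sum.cong refl) (auto simp: Suc_diff_le)
      then show ?thesis by (simp add: A_def)
    qed
    have rq: "rho (q ^ Suc k) = 1 + chi (int q)" if "q \<noteq> p" for k
    proof (induction k)
      case 0
      then show ?case using rho_prime[OF q that] by simp
    next
      case (Suc k)
      then show ?case using rho_prime_power_Suc[OF q that, of "Suc k"] by (simp only: zero_less_Suc)
    qed
    \<comment> \<open>The comparison advances in steps of 2: \<open>A\<close> grows by one value of
      \<open>rho\<close>, \<open>B\<close> by two consecutive powers of \<open>chi q\<close>. These
      agree because \<open>chi q\<close> is 1 or -1 away from p, while at p both increments are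
      0.\<close>
    have AB: "A k = B k \<and> A (Suc k) = B (Suc k)" for k
    proof (induction k)
      case 0
      have "rho q = 1 + chi (int q)" using rho_prime[OF q] rho_p by (cases "q = p") auto
      then show ?case by (simp add: A_def B_def rho1)
    next
      case (Suc k)
      have "rho (q ^ Suc (Suc k)) = chi (int q) ^ Suc k + chi (int q) ^ Suc (Suc k)"
      proof (cases "q = p")
        case True
        then show ?thesis by (simp add: rho_p_power del: power_Suc)
      next
        case False
        then have "chi (int q) \<noteq> 0" using q prime_p primes_dvd_imp_eq by (auto simp: chi_eq_0_iff)
        then have "chi (int q) = 1 \<or> chi (int q) = -1" using chi_cases[of "int q"] by auto
        then show ?thesis unfolding rq[OF False] by auto
      qed
      then show ?case using Suc A2[of k] by (simp add: B_def)
    qed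
    have "dconv rho square_ind (q ^ k) = A k"
      unfolding dconv_prime_power[OF q] A_def
      by (intro sum.cong refl) (simp add: square_ind_prime_power[OF q])
    also have "\<dots> = B k" using AB by blast
    also have "\<dots> = dconv (\<lambda>n. chi (int n)) (\<lambda>_. 1) (q ^ k)"
      unfolding dconv_prime_power[OF q] B_def by (intro sum.cong refl) (simp add: chi_power)
    finally show ?thesis .
  qed
  show ?thesis using multiplicative_eqI[OF m2 m1 pp assms] by (simp add: dconv_def)
qed

end

section \<open>The value of the L-series at 1\<close>

text \<open>Summation by parts: for nonnegative nonincreasing weights only the first weight and a
  bound for the partial sums enter. It serves both for \<open>z ^ k / k\<close> and for the integer
  quotients \<open>N div d\<close>.\<close>

lemma abel_inequality:
  fixes c w :: "nat \<Rightarrow> real"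
  assumes B: "\<And>n. \<bar>\<Sum>k\<in>{m..<n}. c k\<bar> \<le> B"
    and w: "\<And>k. m \<le> k \<Longrightarrow> 0 \<le> w k" "\<And>k. m \<le> k \<Longrightarrow> w (Suc k) \<le> w k"
  shows "\<bar>\<Sum>k\<in>{m..<n}. c k * w k\<bar> \<le> B * w m"
proof (cases "m \<le> n")
  case True
  define C where "C n = (\<Sum>k\<in>{m..<n}. c k)" for n
  have parts: "(\<Sum>k\<in>{m..<n}. c k * w k) = C n * w n + (\<Sum>k\<in>{m..<n}. C (Suc k) * (w k - w (Suc k)))"
    using True by (induction n rule: dec_induct) (auto simp: C_def algebra_simps)
  have tele: "(\<Sum>k\<in>{m..<n}. w k - w (Suc k)) = w m - w n"
    using True by (induction n rule: dec_induct) auto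
  have "\<bar>\<Sum>k\<in>{m..<n}. C (Suc k) * (w k - w (Suc k))\<bar> \<le> (\<Sum>k\<in>{m..<n}. B * (w k - w (Suc k)))"
  proof (rule order.trans[OF sum_abs], rule sum_mono)
    fix k assume "k \<in> {m..<n}"
    then have "0 \<le> w k - w (Suc k)" using w(2) by simp
    moreover have "\<bar>C (Suc k)\<bar> \<le> B" unfolding C_def by (rule B)
    ultimately show "\<bar>C (Suc k) * (w k - w (Suc k))\<bar> \<le> B * (w k - w (Suc k))"
      by (simp only: abs_mult abs_of_nonneg mult_right_mono)
  qed
  also have "\<dots> = B * (w m - w n)" by (simp only: tele flip: sum_distrib_left)
  finally have "\<bar>\<Sum>k\<in>{m..<n}. C (Suc k) * (w k - w (Suc k))\<bar> \<le> B * (w m - w n)" .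
  moreover have "\<bar>C n * w n\<bar> \<le> B * w n"
    using B[of n] w(1)[OF True] by (simp add: C_def abs_mult mult_right_mono)
  ultimately show ?thesis unfolding parts by (simp add: algebra_simps)
next
  case False
  have "0 \<le> B" using B[of 0] by simp
  then show ?thesis using False w(1)[of m] by simp
qed

lemma card_multiples: "d > 0 \<Longrightarrow> card {n \<in> {1..N}. d dvd n} = N div (d :: nat)"
proof -
  assume d: "d > 0"
  have "{n \<in> {1..N}. d dvd n} = (\<lambda>k. d * k) ` {1..N div d}"
    using d by (auto simp: less_eq_div_iff_mult_less_eq mult.commute elim!: dvdE)
  moreover have "inj_on (\<lambda>k. d * k) {1..N div d}" using d by (auto simp: inj_on_def)
  ultimately show ?thesis by (simp add: card_image)
qed

context odd_prime
begin

lemma sum_chi_period: "(\<Sum>k<p. chi (int (n + k))) = 0"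
proof -
  have "(\<Sum>k<p. chi (int (n + k))) = (\<Sum>x\<in>P. chi (x + int n))"
    by (rule sum.reindex_bij_witness[of _ nat int]) (auto simp: add.commute)
  then show ?thesis by (simp add: sum_shift sum_chi)
qed

text \<open>Whole periods sum to 0 and can be removed, leaving fewer than p terms.\<close>

lemma abs_sum_chi_lessThan: "\<bar>\<Sum>k<n. chi (int k)\<bar> \<le> int p"
proof (induction n rule: less_induct)
  case (less n)
  show ?case
  proof (cases "n < p")
    case True
    have "\<bar>\<Sum>k<n. chi (int k)\<bar> \<le> (\<Sum>k<n. 1)"
      by (rule order.trans[OF sum_abs]) (intro sum_mono abs_chi_le)
    then show ?thesis using True by simp
  next
    case False
    have "(\<Sum>k<a + b. F k) = (\<Sum>k<a. F k) + (\<Sum>k<b. F (a + k))" for a b and F :: "nat \<Rightarrow> int"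
      by (induction b) (simp_all add: add.assoc)
    then have "(\<Sum>k<n - p + p. chi (int k)) = (\<Sum>k<n - p. chi (int k)) + (\<Sum>k<p. chi (int (n - p + k)))" .
    moreover have "n - p + p = n" using False by simp
    ultimately have "(\<Sum>k<n. chi (int k)) = (\<Sum>k<n - p. chi (int k))"
      by (simp only: sum_chi_period add_0_right)
    then show ?thesis using less[of "n - p"] False p_gt_2 by simp
  qed
qed

lemma abs_sum_chi_le: "\<bar>\<Sum>k\<in>{a..<n}. real_of_int (chi (int k))\<bar> \<le> 2 * real p"
proof (cases "a \<le> n")
  case True
  have "(\<Sum>k<n. chi (int k)) = (\<Sum>k<a. chi (int k)) + (\<Sum>k\<in>{a..<n}. chi (int k))"
    using True by (subst sum.union_disjoint[symmetric]) (auto simp: ivl_disj_un)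
  then have "\<bar>\<Sum>k\<in>{a..<n}. chi (int k)\<bar> \<le> 2 * int p"
    using abs_sum_chi_lessThan[of n] abs_sum_chi_lessThan[of a] by linarith
  then have "real_of_int \<bar>\<Sum>k\<in>{a..<n}. chi (int k)\<bar> \<le> real_of_int (2 * int p)" by (simp only: of_int_le_iff)
  then show ?thesis by simp
qed simp

text \<open>The bound does not depend on z; it gives convergence at z = 1 as well as uniform
  convergence on [0, 1].\<close>

lemma chi_power_series_tail:
  assumes "0 \<le> z" "z \<le> 1" "M > 0"
  shows "\<bar>\<Sum>k\<in>{M..<n}. of_int (chi (int k)) * (z ^ k / real k)\<bar> \<le> 2 * real p / real M"
proof -
  have "\<bar>\<Sum>k\<in>{M..<n}. of_int (chi (int k)) * (z ^ k / real k)\<bar> \<le> 2 * real p * (z ^ M / real M)"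
  proof (rule abel_inequality)
    show "\<bar>\<Sum>k\<in>{M..<n}. real_of_int (chi (int k))\<bar> \<le> 2 * real p" for n by (rule abs_sum_chi_le)
    fix k assume k: "M \<le> k"
    show "0 \<le> z ^ k / real k" using assms by simp
    have "z ^ Suc k / real (Suc k) \<le> z ^ k / real k"
      using assms k by (intro frac_le power_decreasing) auto
    then show "z ^ Suc k / real (Suc k) \<le> z ^ k / real k" .
  qed
  also have "\<dots> \<le> 2 * real p * (1 / real M)"
    using assms by (intro mult_left_mono divide_right_mono power_le_one) auto
  finally show ?thesis by simp
qed

lemma summable_chi_power_series:
  assumes "0 \<le> z" "z \<le> 1"
  shows "summable (\<lambda>k. of_int (chi (int k)) * (z ^ k / real k))"
  unfolding summable_Cauchy
proof (intro allI impI)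
  fix e :: real assume e: "e > 0"
  obtain N where N: "2 * real p / e < real N" using reals_Archimedean2 by blast
  have N0: "N > 0" using N e p_gt_2 by (cases N) (auto simp: field_simps)
  show "\<exists>N. \<forall>m\<ge>N. \<forall>n. norm (\<Sum>k\<in>{m..<n}. of_int (chi (int k)) * (z ^ k / real k)) < e"
  proof (intro exI allI impI)
    fix m n assume m: "m \<ge> N"
    have "norm (\<Sum>k\<in>{m..<n}. of_int (chi (int k)) * (z ^ k / real k)) \<le> 2 * real p / real m"
      using chi_power_series_tail[OF assms, of m n] m N0 by simp
    also have "\<dots> \<le> 2 * real p / real N" using m N0 by (intro divide_left_mono) auto
    also have "\<dots> < e" using N e N0 by (simp add: field_simps)
    finally show "norm (\<Sum>k\<in>{m..<n}. of_int (chi (int k)) * (z ^ k / real k)) < e" .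
  qed
qed

text \<open>The term k = 0 vanishes, as \<open>chi 0 = 0\<close>. The variable z is there for Abel
  summation: the logarithm series is available only for z < 1.\<close>

definition chi_series :: "real \<Rightarrow> real" where
  "chi_series z = (\<Sum>k. of_int (chi (int k)) * (z ^ k / real k))"

definition L1 :: real where "L1 = chi_series 1"

lemma chi_series_tail:
  assumes "0 \<le> z" "z \<le> 1" "M > 0"
  shows "\<bar>chi_series z - (\<Sum>k<M. of_int (chi (int k)) * (z ^ k / real k))\<bar> \<le> 2 * real p / real M"
proof -
  define t where "t k = of_int (chi (int k)) * (z ^ k / real k)" for k
  have "(\<lambda>n. \<Sum>k<n. t k) \<longlonglongrightarrow> chi_series z"
    using summable_LIMSEQ[OF summable_chi_power_series[OF assms(1,2)]] by (simp add: chi_series_def t_def)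
  then have "(\<lambda>n. \<bar>(\<Sum>k<n. t k) - (\<Sum>k<M. t k)\<bar>) \<longlonglongrightarrow> \<bar>chi_series z - (\<Sum>k<M. t k)\<bar>"
    by (intro tendsto_intros)
  moreover have "\<bar>(\<Sum>k<n. t k) - (\<Sum>k<M. t k)\<bar> \<le> 2 * real p / real M" if "n \<ge> M" for n
  proof -
    have "(\<Sum>k<n. t k) = (\<Sum>k<M. t k) + (\<Sum>k\<in>{M..<n}. t k)"
      using that by (subst sum.union_disjoint[symmetric]) (auto simp: ivl_disj_un)
    then show ?thesis using chi_power_series_tail[OF assms, of n] by (simp add: t_def)
  qed
  ultimately show ?thesis
    unfolding t_def[symmetric] by (intro LIMSEQ_le_const2) auto
qed

text \<open>After exchanging the sums, \<open>chi d\<close> has weight \<open>N div d\<close>. Below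
  a cutoff M the floor is replaced by N / d at a cost of at most 1 per term; from M on
  \<open>abel_inequality\<close> applies, since \<open>N div d\<close> decreases. Divided by N, the
  error is at most 4 p / M + M / N, and M is fixed before N grows.\<close>

lemma sum_divisor_chi_limit:
  "(\<lambda>N. real_of_int (\<Sum>n\<in>{1..N}. \<Sum>d | d dvd n. chi (int d)) / real N) \<longlonglongrightarrow> L1"
proof -
  define S where "S N = real_of_int (\<Sum>n\<in>{1..N}. \<Sum>d | d dvd n. chi (int d))" for N
  have S: "S N = (\<Sum>d<Suc N. of_int (chi (int d)) * real (N div d))" for N
  proof -
    have "(\<Sum>n\<in>{1..N}. \<Sum>d | d dvd n. chi (int d)) = (\<Sum>n\<in>{1..N}. \<Sum>d\<in>{d\<in>{1..N}. d dvd n}. chi (int d))"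
      by (intro sum.cong refl) (auto dest: dvd_imp_le intro: Suc_leI dvd_pos_nat simp: Suc_le_eq)
    also have "\<dots> = (\<Sum>d\<in>{1..N}. \<Sum>n\<in>{n\<in>{1..N}. d dvd n}. chi (int d))"
      by (rule sum.swap_restrict) auto
    also have "\<dots> = (\<Sum>d\<in>{1..N}. int (N div d) * chi (int d))"
    proof (rule sum.cong[OF refl])
      fix d assume "d \<in> {1..N}"
      then have "card {n\<in>{1..N}. d dvd n} = N div d" by (intro card_multiples) auto
      then show "(\<Sum>n\<in>{n\<in>{1..N}. d dvd n}. chi (int d)) = int (N div d) * chi (int d)"
        by (simp only: sum_constant)
    qed
    also have "\<dots> = (\<Sum>d<Suc N. chi (int d) * int (N div d))"
      by (rule sum.mono_neutral_cong_left) (auto simp: not_le)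
    finally show ?thesis by (simp add: S_def del: sum.lessThan_Suc)
  qed
  have bound: "\<bar>S N / real N - L1\<bar> \<le> 4 * real p / real M + real M / real N"
    if MN: "0 < M" "M \<le> N" for M N
  proof -
    define T where "T = (\<Sum>d<M. of_int (chi (int d)) * (1 ^ d / real d))"
    have N0: "real N > 0" using MN by simp
    have "S N = (\<Sum>d<M. of_int (chi (int d)) * real (N div d)) + (\<Sum>d\<in>{M..<Suc N}. of_int (chi (int d)) * real (N div d))"
      unfolding S using MN by (subst sum.union_disjoint[symmetric]) (auto simp: ivl_disj_un)
    moreover have "\<bar>\<Sum>d\<in>{M..<Suc N}. of_int (chi (int d)) * real (N div d)\<bar> \<le> 2 * real p * real (N div M)"
      using MN by (intro abel_inequality abs_sum_chi_le) (auto intro!: div_le_mono2)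
    moreover have "2 * real p * real (N div M) \<le> 2 * real p * (real N / real M)"
      by (intro mult_left_mono of_nat_div_le_of_nat) auto
    moreover have "\<bar>(\<Sum>d<M. of_int (chi (int d)) * real (N div d)) - real N * T\<bar> \<le> real M"
    proof -
      have "(\<Sum>d<M. of_int (chi (int d)) * real (N div d)) - real N * T =
          (\<Sum>d<M. of_int (chi (int d)) * (real (N div d) - real N / real d))"
        by (simp add: T_def sum_distrib_left sum_subtractf[symmetric] algebra_simps)
      also have "\<bar>\<dots>\<bar> \<le> (\<Sum>d<M. 1)"
      proof (rule order.trans[OF sum_abs], rule sum_mono)
        fix d
        have "\<bar>real (N div d) - real N / real d\<bar> \<le> 1"
        proof (cases "d = 0")
          case False
          then have "N \<le> N div d * d + d"
            using div_mult_mod_eq[of N d] mod_less_divisor[of d N] by linarith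
          then have "real N \<le> real (N div d * d + d)" by (simp only: of_nat_le_iff)
          then have "real N / real d \<le> real (N div d) + 1" using False by (simp add: field_simps)
          then show ?thesis
            using of_nat_div_le_of_nat[where 'a = real, of N d] by (simp add: abs_le_iff)
        qed simp
        moreover have "\<bar>real_of_int (chi (int d))\<bar> \<le> 1"
          using abs_chi_le[of "int d"] by linarith
        ultimately have "\<bar>real_of_int (chi (int d))\<bar> * \<bar>real (N div d) - real N / real d\<bar> \<le> 1 * 1"
          by (intro mult_mono) auto
        then show "\<bar>of_int (chi (int d)) * (real (N div d) - real N / real d)\<bar> \<le> 1"
          by (simp add: abs_mult)
      qed
      finally show ?thesis by simp
    qed
    ultimately have "\<bar>S N - real N * T\<bar> \<le> real M + 2 * real p * (real N / real M)" by linarith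
    moreover have "\<bar>real N * (T - L1)\<bar> \<le> real N * (2 * real p / real M)"
      using chi_series_tail[of 1 M] MN unfolding T_def L1_def
      by (simp add: abs_mult abs_minus_commute mult_left_mono del: times_divide_eq_right)
    ultimately have "\<bar>S N - real N * L1\<bar> \<le> real M + 4 * real p * (real N / real M)"
      by (simp add: algebra_simps)
    then have "\<bar>S N - real N * L1\<bar> / real N \<le> (real M + 4 * real p * (real N / real M)) / real N"
      using N0 by (intro divide_right_mono) auto
    moreover have "\<bar>S N - real N * L1\<bar> / real N = \<bar>S N / real N - L1\<bar>"
    proof -
      have "S N / real N - L1 = (S N - real N * L1) / real N" using N0 by (simp add: field_simps)
      then show ?thesis using N0 by (simp only: abs_divide abs_of_pos)
    qed
    moreover have "(real M + 4 * real p * (real N / real M)) / real N = 4 * real p / real M + real M / real N"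
      using N0 MN by (simp add: field_simps)
    ultimately show ?thesis by simp
  qed
  have "(\<lambda>N. S N / real N) \<longlonglongrightarrow> L1"
  proof (rule LIMSEQ_I)
    fix r :: real assume r: "r > 0"
    obtain M where M: "8 * real p / r < real M" using reals_Archimedean2 by blast
    have M0: "M > 0" using M r p_gt_2 by (cases M) (auto simp: field_simps)
    obtain N0 where N0: "2 * real M / r < real N0" using reals_Archimedean2 by blast
    show "\<exists>no. \<forall>n\<ge>no. norm (S n / real n - L1) < r"
    proof (intro exI allI impI)
      fix n assume n: "n \<ge> max M N0"
      have "4 * real p / real M < r / 2" using M M0 r by (simp add: field_simps)
      moreover have "real M / real n < r / 2"
      proof -
        have "2 * real M / r < real n" using N0 n by linarith
        then show ?thesis using r n M0 by (simp add: field_simps)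
      qed
      moreover have "\<bar>S n / real n - L1\<bar> \<le> 4 * real p / real M + real M / real n"
        using n M0 by (intro bound) auto
      ultimately show "norm (S n / real n - L1) < r" unfolding real_norm_def by linarith
    qed
  qed
  then show ?thesis by (simp add: S_def)
qed

end

section \<open>L(1) as a combination of logarithms\<close>

context prime_root
begin

lemma one_minus_e_nz: "k \<in> P - {0} \<Longrightarrow> 1 - e k \<noteq> 0"
  using e_eq_1_iff[of k] by (auto dest: zdvd_imp_le)

text \<open>For z < 1 the logarithm series and \<open>gauss_sum_twist\<close> give the identity with
  \<open>1 - z * e k\<close>; continuity of the series on [0, 1] lets z tend to 1.\<close>

lemma sqrt_p_L1:
  assumes g: "g = of_real (sqrt (real p))"
  shows "sqrt (real p) * L1 = - (\<Sum>k\<in>P. of_int (chi k) * ln (cmod (1 - e k)))"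
proof -
  have ser: "sqrt (real p) * chi_series z = - (\<Sum>k\<in>P. of_int (chi k) * ln (cmod (1 - of_real z * e k)))"
    if z: "0 < z" "z < 1" for z :: real
  proof -
    have nz: "1 - of_real z * e k \<noteq> 0" for k
    proof
      assume "1 - of_real z * e k = 0"
      then have "cmod (of_real z * e k) = 1" by simp
      then show False using z by (simp add: norm_mult)
    qed
    have "(\<lambda>n. \<Sum>k\<in>P. of_int (chi k) * (- ((of_real z * e k) ^ n) / of_nat n)) sums
        (\<Sum>k\<in>P. of_int (chi k) * Ln (1 - of_real z * e k))"
    proof (intro sums_sum sums_mult)
      fix k
      have "cmod (- (of_real z * e k)) < 1" using z by (simp add: norm_mult)
      from Ln_series'[OF this] show "(\<lambda>n. - ((of_real z * e k) ^ n) / of_nat n) sums Ln (1 - of_real z * e k)"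
        by simp
    qed
    also have "(\<lambda>n. \<Sum>k\<in>P. of_int (chi k) * (- ((of_real z * e k) ^ n) / of_nat n)) =
        (\<lambda>n. of_real (- (sqrt (real p) * (of_int (chi (int n)) * (z ^ n / real n)))))"
    proof
      fix n
      have "(\<Sum>k\<in>P. of_int (chi k) * (- ((of_real z * e k) ^ n) / of_nat n)) =
          - (of_real z ^ n / of_nat n) * (\<Sum>k\<in>P. of_int (chi k) * e (k * int n))"
        by (simp add: sum_distrib_left power_mult_distrib e_mult_nat mult_ac sum_negf)
      then show "(\<Sum>k\<in>P. of_int (chi k) * (- ((of_real z * e k) ^ n) / of_nat n)) =
          of_real (- (sqrt (real p) * (of_int (chi (int n)) * (z ^ n / real n))))"
        by (simp add: gauss_sum_twist g mult_ac)
    qed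
    \<comment> \<open>Real parts turn the principal logarithm into \<open>ln\<close> of the modulus,
      so no argument has to be tracked.\<close>
    finally have "(\<lambda>n. Re (of_real (- (sqrt (real p) * (of_int (chi (int n)) * (z ^ n / real n)))))) sums
        Re (\<Sum>k\<in>P. of_int (chi k) * Ln (1 - of_real z * e k))"
      by (rule sums_Re)
    then have "(\<lambda>n. - (sqrt (real p) * (of_int (chi (int n)) * (z ^ n / real n)))) sums
        (\<Sum>k\<in>P. of_int (chi k) * ln (cmod (1 - of_real z * e k)))"
      using nz by simp
    moreover have "(\<lambda>n. - (sqrt (real p) * (of_int (chi (int n)) * (z ^ n / real n)))) sums
        (- (sqrt (real p) * chi_series z))"
      unfolding chi_series_def using z
      by (intro sums_minus sums_mult summable_sums summable_chi_power_series) auto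
    ultimately show ?thesis using sums_unique2 by fastforce
  qed
  have "uniform_limit {0..1} (\<lambda>N z. \<Sum>k<N. of_int (chi (int k)) * (z ^ k / real k)) chi_series sequentially"
  proof (rule uniform_limitI)
    fix \<epsilon> :: real assume \<epsilon>: "\<epsilon> > 0"
    obtain N where N: "2 * real p / \<epsilon> < real N" using reals_Archimedean2 by blast
    have N0: "N > 0" using N \<epsilon> p_gt_2 by (cases N) (auto simp: field_simps)
    show "\<forall>\<^sub>F n in sequentially. \<forall>z\<in>{0..1}. dist (\<Sum>k<n. of_int (chi (int k)) * (z ^ k / real k)) (chi_series z) < \<epsilon>"
      using eventually_ge_at_top[of N]
    proof eventually_elim
      fix n assume n: "n \<ge> N"
      have "2 * real p / real n \<le> 2 * real p / real N" using n N0 by (intro divide_left_mono) auto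
      also have "\<dots> < \<epsilon>" using N \<epsilon> N0 by (simp add: field_simps)
      finally have "2 * real p / real n < \<epsilon>" .
      moreover have "dist (\<Sum>k<n. of_int (chi (int k)) * (z ^ k / real k)) (chi_series z) \<le> 2 * real p / real n"
        if "z \<in> {0..1}" for z
        using chi_series_tail[of z n] that n N0 by (simp only: dist_real_def abs_minus_commute) simp
      ultimately show "\<forall>z\<in>{0..1}. dist (\<Sum>k<n. of_int (chi (int k)) * (z ^ k / real k)) (chi_series z) < \<epsilon>"
        using le_less_trans by blast
    qed
  qed
  then have "continuous_on {0..1} chi_series"
  proof (rule uniform_limit_theorem[rotated])
    show "\<forall>\<^sub>F N in sequentially. continuous_on {0..1} (\<lambda>z. \<Sum>k<N. of_int (chi (int k)) * (z ^ k / real k))"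
      unfolding divide_inverse by (intro always_eventually allI continuous_intros)
  qed simp
  then have "(chi_series \<longlongrightarrow> L1) (at 1 within {0..1})"
    unfolding L1_def by (simp add: continuous_on)
  then have "(chi_series \<longlongrightarrow> L1) (at 1 within {0<..<1})"
    by (rule tendsto_within_subset) auto
  then have "((\<lambda>z. sqrt (real p) * chi_series z) \<longlongrightarrow> sqrt (real p) * L1) (at 1 within {0<..<1})"
    by (intro tendsto_intros)
  moreover have "((\<lambda>z. sqrt (real p) * chi_series z) \<longlongrightarrow>
      - (\<Sum>k\<in>P. of_int (chi k) * ln (cmod (1 - e k)))) (at 1 within {0<..<1})"
  proof (rule Lim_transform_eventually)
    \<comment> \<open>The term k = 0, singular at z = 1, is removed beforehand; its coefficient is
      0.\<close>
    show "((\<lambda>z. - (\<Sum>k\<in>P - {0}. of_int (chi k) * ln (cmod (1 - of_real z * e k)))) \<longlongrightarrow>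
        - (\<Sum>k\<in>P. of_int (chi k) * ln (cmod (1 - e k)))) (at 1 within {0<..<1})"
    proof -
      have "(\<Sum>k\<in>P. of_int (chi k) * ln (cmod (1 - e k))) = (\<Sum>k\<in>P - {0}. of_int (chi k) * ln (cmod (1 - of_real 1 * e k)))"
        by (rule sum.mono_neutral_cong_right) auto
      then show ?thesis
        by (simp only:) (intro tendsto_intros; use one_minus_e_nz in simp)
    qed
    show "\<forall>\<^sub>F z in at 1 within {0<..<1}. - (\<Sum>k\<in>P - {0}. of_int (chi k) * ln (cmod (1 - of_real z * e k))) =
        sqrt (real p) * chi_series z"
    proof -
      have "- (\<Sum>k\<in>P - {0}. of_int (chi k) * ln (cmod (1 - of_real z * e k))) = sqrt (real p) * chi_series z"
        if "z \<in> {0<..<1}" for z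
      proof -
        have "(\<Sum>k\<in>P - {0}. of_int (chi k) * ln (cmod (1 - of_real z * e k))) =
            (\<Sum>k\<in>P. of_int (chi k) * ln (cmod (1 - of_real z * e k)))"
          by (rule sum.mono_neutral_left) auto
        then show ?thesis using ser[of z] that by simp
      qed
      then show ?thesis by (simp add: eventually_at_filter)
    qed
  qed
  moreover have "at (1 :: real) within {0<..<1} \<noteq> bot"
    by (simp add: at_within_eq_bot_iff) 
  ultimately show ?thesis using tendsto_unique by blast
qed

definition FR :: real where "FR = (\<Prod>r\<in>Res. cmod (1 - e r))"

lemma FR_pos: "FR > 0"
  unfolding FR_def
proof (rule prod_pos)
  fix r assume "r \<in> Res"
  then have "r \<in> P - {0}" using P_decomp by auto
  then show "cmod (1 - e r) > 0" using one_minus_e_nz by simp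
qed

text \<open>The products over residues and over nonresidues multiply to p, so the one over
  nonresidues is p / FR.\<close>

lemma sqrt_p_L1_eq_ln:
  assumes g: "g = of_real (sqrt (real p))"
  shows "sqrt (real p) * L1 = ln (real p / FR\<^sup>2)"
proof -
  define FN where "FN = (\<Prod>r\<in>NRes. cmod (1 - e r))"
  have nz: "cmod (1 - e r) > 0" if "r \<in> Res \<union> NRes" for r
    using that P_decomp(1) one_minus_e_nz by simp
  have FN: "FN > 0" unfolding FN_def using nz by (intro prod_pos) auto
  have "FR * FN = (\<Prod>k\<in>P - {0}. cmod (1 - e k))"
    unfolding FR_def FN_def P_decomp(1) by (subst prod.union_disjoint) (auto simp: P_decomp)
  also have "\<dots> = cmod (\<Prod>k\<in>P - {0}. 1 - e k)" by (rule prod_norm)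
  also have "\<dots> = real p" unfolding prod_one_minus_e by simp
  finally have FF: "FR * FN = real p" .
  have "sqrt (real p) * L1 = (\<Sum>k\<in>NRes. ln (cmod (1 - e k))) - (\<Sum>k\<in>Res. ln (cmod (1 - e k)))"
    unfolding sqrt_p_L1[OF g] sum_chi_times by simp
  also have "(\<Sum>k\<in>NRes. ln (cmod (1 - e k))) = ln FN"
    unfolding FN_def using nz by (intro ln_prod[symmetric]) auto
  also have "(\<Sum>k\<in>Res. ln (cmod (1 - e k))) = ln FR"
    unfolding FR_def using nz by (intro ln_prod[symmetric]) auto
  also have "ln FN - ln FR = ln (FN / FR)" using FN FR_pos by (simp add: ln_div)
  also have "FN / FR = real p / FR\<^sup>2"
    using FF FR_pos by (simp add: field_simps power2_eq_square)
  finally show ?thesis .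
qed

text \<open>Since -1 is a residue, residues pair off as r and p - r with conjugate factors. The
  product is real and positive, hence equal to the product of absolute values that the logarithms
  see.\<close>

lemma F_R_eq_FR:
  assumes "p mod 4 = 1"
  shows "F_R = of_real FR"
proof -
  have "even m" using assms by presburger
  then have um: "chi (- k) = chi k" for k by (simp add: chi_uminus)
  define R1 where "R1 = {r\<in>Res. 2 * r < int p}"
  have split: "(\<Prod>r\<in>Res. F r) = (\<Prod>r\<in>R1. F r * F (int p - r))" for F :: "int \<Rightarrow> 'a :: comm_monoid_mult"
  proof -
    have "Res = R1 \<union> (\<lambda>r. int p - r) ` R1"
    proof (intro equalityI subsetI)
      fix r assume r: "r \<in> Res"
      have "chi (int p - r) = 1" using r um[of r] chi_mod[of "int p - r"] chi_mod[of "- r"] by (simp add: Res_def)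
      then have "int p - r \<in> Res" using r by (auto simp: Res_def intro: ccontr)
      moreover have "2 * r \<noteq> int p" using odd_p by presburger
      moreover have "r = int p - (int p - r)" by simp
      ultimately show "r \<in> R1 \<union> (\<lambda>r. int p - r) ` R1" using r by (cases "2 * r < int p") (auto simp: R1_def image_iff)
    next
      fix r assume "r \<in> R1 \<union> (\<lambda>r. int p - r) ` R1"
      then obtain s where s: "s \<in> Res" "r = s \<or> r = int p - s" by (auto simp: R1_def)
      have "chi (int p - s) = 1" using s um[of s] chi_mod[of "int p - s"] chi_mod[of "- s"] by (simp add: Res_def)
      moreover have "s \<noteq> 0" using s by (auto simp: Res_def)
      ultimately show "r \<in> Res" using s by (auto simp: Res_def)
    qed
    moreover have "R1 \<inter> (\<lambda>r. int p - r) ` R1 = {}" by (auto simp: R1_def)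
    moreover have "finite R1" unfolding R1_def by simp
    moreover have "inj_on (\<lambda>r. int p - r) R1" by (simp add: inj_on_def)
    ultimately have "(\<Prod>r\<in>Res. F r) = (\<Prod>r\<in>R1. F r) * (\<Prod>r\<in>R1. F (int p - r))"
      by (simp add: prod.union_disjoint prod.reindex)
    then show ?thesis by (simp add: prod.distrib)
  qed
  have ep: "e (int p - r) = cnj (e r)" for r
    using e_mod[of "int p - r"] e_mod[of "- r"] by (simp add: cnj_e)
  have "F_R = (\<Prod>r\<in>R1. (1 - e r) * cnj (1 - e r))"
    unfolding F_R_def split by (simp add: ep)
  also have "\<dots> = (\<Prod>r\<in>R1. of_real (cmod (1 - e r) * cmod (1 - e r)))"
    by (intro prod.cong refl) (simp only: complex_norm_square[symmetric] power2_eq_square)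
  also have "\<dots> = of_real (\<Prod>r\<in>R1. cmod (1 - e r) * cmod (cnj (1 - e r)))"
    by (simp only: complex_mod_cnj of_real_prod)
  also have "(\<Prod>r\<in>R1. cmod (1 - e r) * cmod (cnj (1 - e r))) = FR"
    unfolding FR_def split by (simp add: ep)
  finally show ?thesis .
qed

end

context odd_prime
begin

lemma exists_prime_root: "\<exists>\<zeta>. prime_root p \<zeta>"
proof -
  have "cis (2 * pi / real p) ^ p = 1" using p_gt_2 by (simp add: Complex.DeMoivre)
  moreover have "cis (2 * pi / real p) \<noteq> 1"
  proof
    assume "cis (2 * pi / real p) = 1"
    then have "cos (2 * pi / real p) = 1" by (simp add: complex_eq_iff)
    then obtain k :: int where "2 * pi / real p = of_int k * 2 * pi" by (auto simp: cos_one_2pi_int)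
    then have "1 = of_int k * real p" using p_gt_2 by (simp add: field_simps)
    then have "real_of_int 1 = of_int (k * int p)" by simp
    then have "1 = k * int p" by (simp only: of_int_eq_iff)
    then have "int p dvd 1" by (metis dvd_triv_right)
    then show False using p_gt_2 by simp
  qed
  ultimately show ?thesis using odd_prime_axioms by (auto simp: prime_root_def prime_root_axioms_def)
qed

text \<open>Replacing \<open>\<zeta>\<close> by its power with a nonresidue exponent changes the sign of the Gauss sum, so its
  sign need not be determined.\<close>

lemma exists_prime_root_gauss_sum:
  assumes "p mod 4 = 1"
  shows "\<exists>\<zeta>. prime_root p \<zeta> \<and> prime_root.g p \<zeta> = of_real (sqrt (real p))"
proof -
  obtain \<zeta> where \<zeta>: "prime_root p \<zeta>" using exists_prime_root by blast
  interpret prime_root p \<zeta> by (rule \<zeta>)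
  have "even m" using assms by presburger
  then have "g\<^sup>2 = (of_real (sqrt (real p)))\<^sup>2"
    by (simp add: gauss_sum_square chi_minus_1 flip: of_real_power)
  then have "g = of_real (sqrt (real p)) \<or> g = - of_real (sqrt (real p))"
    by (simp add: power2_eq_iff)
  then show ?thesis
  proof
    assume "g = of_real (sqrt (real p))"
    then show ?thesis using \<zeta> by blast
  next
    assume g: "g = - of_real (sqrt (real p))"
    obtain n where n: "n \<in> P" "chi n = -1" using exists_nonresidue by blast
    have "prime_root p (e n)"
    proof unfold_locales
      show "e n ^ p = 1" by (metis e_mult_nat e_mult_p mult.commute)
      have "\<not> int p dvd n" using n by (simp flip: chi_eq_0_iff)
      then show "e n \<noteq> 1" by (simp add: e_eq_1_iff)
    qed
    moreover from this have "prime_root.g p (e n) = (\<Sum>k\<in>P. of_int (chi k) * e (k * n))"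
      by (simp add: prime_root.g_def prime_root.e_def e_def power_int_mult mult.commute[of _ n])
    then have "prime_root.g p (e n) = of_real (sqrt (real p))"
      by (simp add: gauss_sum_twist n g)
    ultimately show ?thesis by blast
  qed
qed

end

section \<open>The quadratic field\<close>

lemma algebraic_int_quadratic:
  fixes u :: real
  assumes "u * u = of_int t * u + of_int n"
  shows "algebraic_int u"
proof (rule algebraic_int.intros)
  show "lead_coeff [:- of_int n, - of_int t, 1 :: real:] = 1" by simp
  show "poly [:- of_int n, - of_int t, 1:] u = 0" using assms by (simp add: algebra_simps)
  show "\<forall>i. Polynomial.coeff [:- of_int n, - of_int t, 1 :: real:] i \<in> \<int>"
    by (auto simp: coeff_pCons split: nat.splits)
qed

text \<open>In lowest terms every power of the denominator of M divides D, so the denominator is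
  1.\<close>

lemma rat_power_bounded_denominator:
  fixes M :: rat and D :: int
  assumes "D > 0" and "\<And>k. \<exists>z. of_int D * M ^ k = of_int z"
  shows "\<exists>z. M = of_int z"
proof -
  obtain x y where xy: "quotient_of M = (x, y)" by (cases "quotient_of M")
  have y: "y > 0" "coprime x y" "M = of_int x / of_int y"
    using quotient_of_denom_pos[OF xy] quotient_of_coprime[OF xy] quotient_of_div[OF xy] by auto
  have "y ^ k dvd D" for k
  proof -
    obtain z where "of_int D * M ^ k = of_int z" using assms(2) by blast
    then have "of_int D * of_int x ^ k = (of_int z * of_int y ^ k :: rat)"
      using y by (simp add: power_divide field_simps)
    then have "of_int (D * x ^ k) = (of_int (z * y ^ k) :: rat)" by simp
    then have "D * x ^ k = z * y ^ k" by (simp only: of_int_eq_iff)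
    then have "y ^ k dvd D * x ^ k" by simp
    moreover have "coprime (y ^ k) (x ^ k)" using y by (simp add: coprime_commute)
    ultimately show ?thesis by (simp add: coprime_dvd_mult_left_iff)
  qed
  then have "y ^ k \<le> D" for k using assms(1) by (auto intro: zdvd_imp_le)
  moreover have "\<exists>k. D < y ^ k" if "y \<noteq> 1"
  proof -
    have "D < 2 ^ nat D"
      using assms(1) of_nat_less_two_power[where 'a = int, of "nat D"] by simp
    also have "(2 :: int) ^ nat D \<le> y ^ nat D" using y that by (intro power_mono) auto
    finally show ?thesis by blast
  qed
  ultimately have "y = 1" by (metis not_le)
  then show ?thesis using y by auto
qed

context odd_prime
begin

abbreviation s :: real where "s \<equiv> sqrt (real p)"
abbreviation KK :: "real set" where "KK \<equiv> quad_field p"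

lemma s_square: "s * s = real p" by simp

lemma s_pos: "s > 0" using p_gt_2 by simp

lemma rat_coords_unique:
  assumes "of_rat a + of_rat b * s = of_rat c + of_rat d * s"
  shows "a = c" "b = d"
proof -
  have "of_rat (b - d) * s = of_rat (c - a)" using assms by (simp add: of_rat_diff algebra_simps)
  from sqrt_p_rational_eq_0[OF this] show "a = c" "b = d" by auto
qed

text \<open>Conjugation of the quadratic field; unspecified outside of it.\<close>

definition cj :: "real \<Rightarrow> real" where
  "cj u = (THE v. \<exists>a b. u = of_rat a + of_rat b * s \<and> v = of_rat a - of_rat b * s)"

lemma cj_eq: "cj (of_rat a + of_rat b * s) = of_rat a - of_rat b * s"
  unfolding cj_def by (rule the_equality) (auto dest: rat_coords_unique)

lemma KK_iff: "u \<in> KK \<longleftrightarrow> (\<exists>a b. u = of_rat a + of_rat b * s)"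
  by (auto simp: quad_field_def)

lemma KK_E:
  assumes "u \<in> KK"
  obtains a b where "u = of_rat a + of_rat b * s" "cj u = of_rat a - of_rat b * s"
  using assms cj_eq by (auto simp: KK_iff)

lemma KK_I: "of_rat a + of_rat b * s \<in> KK"
  by (auto simp: KK_iff)

lemma KK_rat: "of_rat a \<in> KK" "cj (of_rat a) = of_rat a"
  using KK_I[of a 0] cj_eq[of a 0] by simp_all

lemma KK_of_int [simp]: "of_int k \<in> KK" "cj (of_int k) = of_int k"
  using KK_rat[of "of_int k"] by simp_all

lemma KK_0 [simp]: "0 \<in> KK" "cj 0 = 0" and KK_1 [simp]: "1 \<in> KK" "cj 1 = 1"
  using KK_of_int[of 0] KK_of_int[of 1] by simp_all

lemma KK_s: "s \<in> KK" "cj s = - s"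
  using KK_I[of 0 1] cj_eq[of 0 1] by simp_all

lemma KK_add: assumes "u \<in> KK" "v \<in> KK" shows "u + v \<in> KK" "cj (u + v) = cj u + cj v"
proof -
  obtain a b where u: "u = of_rat a + of_rat b * s" "cj u = of_rat a - of_rat b * s"
    using assms(1) by (rule KK_E)
  obtain c d where v: "v = of_rat c + of_rat d * s" "cj v = of_rat c - of_rat d * s"
    using assms(2) by (rule KK_E)
  have uv: "u + v = of_rat (a + c) + of_rat (b + d) * s"
    by (simp add: u v of_rat_add algebra_simps)
  show "u + v \<in> KK" unfolding uv by (rule KK_I)
  show "cj (u + v) = cj u + cj v" unfolding uv cj_eq u(2) v(2) by (simp add: of_rat_add algebra_simps)
qed

lemma KK_mult: assumes "u \<in> KK" "v \<in> KK" shows "u * v \<in> KK" "cj (u * v) = cj u * cj v"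
proof -
  obtain a b where u: "u = of_rat a + of_rat b * s" "cj u = of_rat a - of_rat b * s"
    using assms(1) by (rule KK_E)
  obtain c d where v: "v = of_rat c + of_rat d * s" "cj v = of_rat c - of_rat d * s"
    using assms(2) by (rule KK_E)
  have "u * v = of_rat a * of_rat c + of_rat b * of_rat d * (s * s) + (of_rat a * of_rat d + of_rat b * of_rat c) * s"
    by (simp add: u v algebra_simps)
  then have uv: "u * v = of_rat (a * c + of_nat p * b * d) + of_rat (a * d + b * c) * s"
    by (simp add: s_square of_rat_add of_rat_mult algebra_simps)
  have "cj u * cj v = of_rat a * of_rat c + of_rat b * of_rat d * (s * s) - (of_rat a * of_rat d + of_rat b * of_rat c) * s"
    unfolding u(2) v(2) by (simp add: algebra_simps)
  then have cuv: "cj u * cj v = of_rat (a * c + of_nat p * b * d) - of_rat (a * d + b * c) * s"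
    by (simp add: s_square of_rat_add of_rat_mult algebra_simps)
  show "u * v \<in> KK" unfolding uv by (rule KK_I)
  show "cj (u * v) = cj u * cj v" unfolding cuv unfolding uv cj_eq ..
qed

lemma KK_uminus: "u \<in> KK \<Longrightarrow> - u \<in> KK" "u \<in> KK \<Longrightarrow> cj (- u) = - cj u"
  using KK_mult[of "of_int (-1)" u] KK_of_int[of "-1"] by simp_all

lemma KK_cj: assumes "u \<in> KK" shows "cj u \<in> KK" "cj (cj u) = u"
proof -
  obtain a b where u: "u = of_rat a + of_rat b * s" "cj u = of_rat a - of_rat b * s"
    using assms by (rule KK_E)
  have c: "cj u = of_rat a + of_rat (- b) * s" using u by (simp add: of_rat_minus)
  show "cj u \<in> KK" unfolding c by (rule KK_I)
  show "cj (cj u) = u" unfolding c cj_eq by (simp add: u of_rat_minus)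
qed

lemma cj_eq_0_iff: "u \<in> KK \<Longrightarrow> cj u = 0 \<longleftrightarrow> u = 0"
  using KK_cj KK_0 by metis

lemma KK_norm_rat: assumes "u \<in> KK" obtains r where "u * cj u = of_rat r"
proof -
  obtain a b where u: "u = of_rat a + of_rat b * s" "cj u = of_rat a - of_rat b * s"
    using assms by (rule KK_E)
  have "u * cj u = of_rat a * of_rat a - of_rat b * of_rat b * (s * s)"
    unfolding u(2) by (subst u(1)) (simp add: algebra_simps)
  also have "\<dots> = of_rat (a * a - b * b * of_nat p)" by (simp add: s_square of_rat_diff of_rat_mult)
  finally show ?thesis by (rule that)
qed

lemma KK_inverse: assumes "u \<in> KK" shows "inverse u \<in> KK" "cj (inverse u) = inverse (cj u)"
proof -
  show "inverse u \<in> KK"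
  proof (cases "u = 0")
    case False
    obtain r where r: "u * cj u = of_rat r" using assms by (rule KK_norm_rat)
    have "cj u \<noteq> 0" using False assms cj_eq_0_iff by simp
    then have "inverse u = cj u * of_rat (inverse r)"
      using False by (simp add: of_rat_inverse r[symmetric])
    then show ?thesis using KK_mult KK_cj(1)[OF assms] KK_rat by simp
  qed simp
  then have "cj u * cj (inverse u) = cj (u * inverse u)" using KK_mult assms by simp
  then show "cj (inverse u) = inverse (cj u)"
    using assms cj_eq_0_iff[OF assms] by (cases "u = 0") (auto simp: field_simps)
qed

lemma KK_divide: "u \<in> KK \<Longrightarrow> v \<in> KK \<Longrightarrow> u / v \<in> KK" "u \<in> KK \<Longrightarrow> v \<in> KK \<Longrightarrow> cj (u / v) = cj u / cj v"
  using KK_mult[of u "inverse v"] KK_inverse[of v] by (simp_all add: divide_inverse)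

lemma KK_power: "u \<in> KK \<Longrightarrow> u ^ n \<in> KK" "u \<in> KK \<Longrightarrow> cj (u ^ n) = cj u ^ n"
  by (induction n) (simp_all add: KK_mult)

lemma KK_denominator:
  assumes "u \<in> KK"
  obtains d x y where "d > 0" "of_int d * u = of_int x + of_int y * s"
proof -
  obtain a b where u: "u = of_rat a + of_rat b * s" using assms by (auto simp: KK_iff)
  obtain a1 a2 where a: "quotient_of a = (a1, a2)" by (cases "quotient_of a")
  obtain b1 b2 where b: "quotient_of b = (b1, b2)" by (cases "quotient_of b")
  have a': "a2 > 0" "of_rat a = (of_int a1 / of_int a2 :: real)"
    using quotient_of_denom_pos[OF a] quotient_of_div[OF a] by (auto simp: of_rat_divide)
  have b': "b2 > 0" "of_rat b = (of_int b1 / of_int b2 :: real)"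
    using quotient_of_denom_pos[OF b] quotient_of_div[OF b] by (auto simp: of_rat_divide)
  have "of_int (a2 * b2) * u = of_int (a1 * b2) + of_int (b1 * a2) * s"
    unfolding u a'(2) b'(2) using a'(1) b'(1) by (simp add: field_simps)
  moreover have "a2 * b2 > 0" using a' b' by simp
  ultimately show ?thesis by (rule that[rotated])
qed

text \<open>The powers of an algebraic integer have bounded denominators, hence so have the powers of
  its norm.\<close>

lemma norm_algebraic_int:
  assumes u: "u \<in> KK" "algebraic_int u"
  shows "\<exists>z. u * cj u = of_int z"
proof -
  obtain Q where Q: "lead_coeff Q = 1" "\<And>i. Polynomial.coeff Q i \<in> \<int>" "poly Q u = 0"
    using u(2) by (auto elim!: algebraic_int.cases)
  define n where "n = degree Q"
  obtain d x0 y0 where d: "d > 0" "of_int d * u = of_int x0 + of_int y0 * s"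
    using KK_denominator[OF u(1)] .
  \<comment> \<open>The order Z[sqrt p]: it is closed under multiplication and conjugation, and that
    is enough for bounding denominators.\<close>
  define \<Lambda> where "\<Lambda> = {v. \<exists>x y. v = of_int x + of_int y * s}"
  have \<Lambda>_add: "v + w \<in> \<Lambda>" if vw: "v \<in> \<Lambda>" "w \<in> \<Lambda>" for v w
  proof -
    obtain x y where "v = of_int x + of_int y * s" using vw(1) unfolding \<Lambda>_def by blast
    moreover obtain x' y' where "w = of_int x' + of_int y' * s" using vw(2) unfolding \<Lambda>_def by blast
    ultimately have "v + w = of_int (x + x') + of_int (y + y') * s" by (simp add: algebra_simps)
    then show ?thesis unfolding \<Lambda>_def by blast
  qed
  have \<Lambda>_mult: "v * w \<in> \<Lambda>" if vw: "v \<in> \<Lambda>" "w \<in> \<Lambda>" for v w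
  proof -
    obtain x y where v: "v = of_int x + of_int y * s" using vw(1) unfolding \<Lambda>_def by blast
    obtain x' y' where w: "w = of_int x' + of_int y' * s" using vw(2) unfolding \<Lambda>_def by blast
    have "v * w = of_int x * of_int x' + of_int y * of_int y' * (s * s) + (of_int x * of_int y' + of_int y * of_int x') * s"
      by (simp add: v w algebra_simps)
    then have "v * w = of_int (x * x' + y * y' * int p) + of_int (x * y' + y * x') * s"
      by (simp add: s_square)
    then show ?thesis unfolding \<Lambda>_def by blast
  qed
  have \<Lambda>_int: "of_int k \<in> \<Lambda>" for k unfolding \<Lambda>_def by (rule CollectI, rule exI[of _ k], rule exI[of _ 0]) simp
  have \<Lambda>_power: "v ^ k \<in> \<Lambda>" if "v \<in> \<Lambda>" for v k
    using that \<Lambda>_int[of 1] by (induction k) (auto intro: \<Lambda>_mult)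
  have \<Lambda>_sum: "(\<Sum>i\<in>A. h i) \<in> \<Lambda>" if "\<And>i. i \<in> A \<Longrightarrow> h i \<in> \<Lambda>" for h and A :: "nat set"
    using that \<Lambda>_int[of 0] by (induction A rule: infinite_finite_induct) (auto intro: \<Lambda>_add)
  \<comment> \<open>Powers up to the degree are cleared by \<open>d ^ n\<close> directly; higher
    ones are combinations of lower powers by the monic equation.\<close>
  have bdd: "of_int (d ^ n) * u ^ k \<in> \<Lambda>" for k
  proof (induction k rule: less_induct)
    case (less k)
    show ?case
    proof (cases "k \<le> n")
      case True
      have "of_int (d ^ n) * u ^ k = of_int (d ^ (n - k)) * (of_int d * u) ^ k"
        using True by (simp add: power_mult_distrib flip: power_add mult.assoc)
      moreover have "of_int d * u \<in> \<Lambda>" unfolding \<Lambda>_def using d(2) by blast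
      ultimately show ?thesis by (simp only: \<Lambda>_mult \<Lambda>_int \<Lambda>_power)
    next
      case False
      have "0 = (\<Sum>i\<le>n. Polynomial.coeff Q i * u ^ i)"
        using Q(3) by (simp add: poly_altdef n_def)
      also have "\<dots> = (\<Sum>i<n. Polynomial.coeff Q i * u ^ i) + u ^ n"
        using Q(1) by (simp add: n_def lessThan_Suc_atMost[symmetric])
      finally have "u ^ n = - (\<Sum>i<n. Polynomial.coeff Q i * u ^ i)" by simp
      then have "u ^ k = - (\<Sum>i<n. Polynomial.coeff Q i * u ^ i) * u ^ (k - n)"
        using False by (metis le_add_diff_inverse nat_le_linear power_add)
      then have "of_int (d ^ n) * u ^ k = (\<Sum>i<n. (- Polynomial.coeff Q i) * (of_int (d ^ n) * u ^ (i + (k - n))))"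
        by (simp add: sum_distrib_left sum_distrib_right sum_negf power_add mult_ac)
      also have "\<dots> \<in> \<Lambda>"
      proof (rule \<Lambda>_sum)
        fix i assume "i \<in> {..<n}"
        then have "of_int (d ^ n) * u ^ (i + (k - n)) \<in> \<Lambda>" using False by (intro less) auto
        moreover obtain c where "Polynomial.coeff Q i = of_int c" using Q(2)[of i] by (auto elim: Ints_cases)
        ultimately show "(- Polynomial.coeff Q i) * (of_int (d ^ n) * u ^ (i + (k - n))) \<in> \<Lambda>"
          using \<Lambda>_mult[OF \<Lambda>_int[of "- c"]] by simp
      qed
      finally show ?thesis .
    qed
  qed
  obtain r where r: "u * cj u = of_rat r" using u(1) by (rule KK_norm_rat)
  have "\<exists>z. of_int (d ^ n * d ^ n) * r ^ k = of_int z" for k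
  proof -
    obtain x y where xy: "of_int (d ^ n) * u ^ k = of_int x + of_int y * s"
      using bdd[of k] unfolding \<Lambda>_def by blast
    have "cj (of_int (d ^ n) * u ^ k) = of_int (d ^ n) * cj u ^ k"
      using u(1) by (simp only: KK_mult KK_power KK_of_int)
    moreover have "cj (of_int x + of_int y * s) = of_int x - of_int y * s"
      using KK_s by (simp add: KK_add KK_mult)
    ultimately have "of_int (d ^ n) * cj u ^ k = of_int x - of_int y * s" using xy by simp
    then have "(of_int (d ^ n) * u ^ k) * (of_int (d ^ n) * cj u ^ k) =
        (of_int x + of_int y * s) * (of_int x - of_int y * s)" using xy by simp
    also have "\<dots> = of_int x * of_int x - of_int y * of_int y * (s * s)" by (simp add: algebra_simps)
    also have "\<dots> = of_int (x * x - y * y * int p)" by (simp add: s_square)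
    also have "(of_int (d ^ n) * u ^ k) * (of_int (d ^ n) * cj u ^ k) = of_int (d ^ n * d ^ n) * (u * cj u) ^ k"
      by (simp add: power_mult_distrib)
    finally have "of_rat (of_int (d ^ n * d ^ n) * r ^ k) = (of_rat (of_int (x * x - y * y * int p)) :: real)"
      by (simp only: r of_rat_mult of_rat_power of_rat_of_int_eq)
    then have "of_int (d ^ n * d ^ n) * r ^ k = of_int (x * x - y * y * int p)" by (simp only: of_rat_eq_iff)
    then show ?thesis by blast
  qed
  moreover have "d ^ n * d ^ n > 0" using d(1) by simp
  ultimately obtain z where "r = of_int z" using rat_power_bounded_denominator by blast
  then show ?thesis using r by auto
qed

text \<open>Together with the integrality of norms this makes traces integers, because the trace of
  u is N(u + 1) - N(u) - 1.\<close>

lemma algebraic_int_add_1: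
  fixes u :: real
  assumes "algebraic_int u"
  shows "algebraic_int (u + 1)"
proof -
  obtain Q where Q: "Polynomial.lead_coeff Q = 1" "poly (map_poly of_int Q) u = (0 :: real)"
    using assms by (auto simp: algebraic_int_altdef_ipoly)
  have "poly (map_poly of_int (Q \<circ>\<^sub>p [:-1, 1:])) (u + 1) = 0"
    using Q by (simp add: of_int_hom.map_poly_pcompose poly_pcompose)
  moreover have "Polynomial.lead_coeff (Q \<circ>\<^sub>p [:-1, 1:]) = 1"
    using Q by (subst lead_coeff_comp) auto
  ultimately show ?thesis by (auto simp: algebraic_int_altdef_ipoly)
qed

end

section \<open>Ideals of the ring of integers\<close>

lemma int_subgroup_generator:
  fixes H :: "int set"
  assumes add: "\<And>x y. x \<in> H \<Longrightarrow> y \<in> H \<Longrightarrow> x + y \<in> H" and neg: "\<And>x. x \<in> H \<Longrightarrow> - x \<in> H"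
    and ne: "x0 \<in> H" "x0 \<noteq> 0"
  obtains g :: nat where "g > 0" "\<And>x. x \<in> H \<longleftrightarrow> int g dvd x"
proof -
  define Q where "Q n \<longleftrightarrow> n > 0 \<and> int n \<in> H" for n
  have "Q (nat \<bar>x0\<bar>)" using ne neg[of x0] by (auto simp: Q_def abs_if)
  define g where "g = (LEAST n. Q n)"
  have g: "Q g" unfolding g_def by (rule LeastI) fact
  have min: "g \<le> n" if "Q n" for n unfolding g_def by (rule Least_le) fact
  have z: "0 \<in> H" using add[OF ne(1) neg[OF ne(1)]] by simp
  have natmult: "int n * x \<in> H" if "x \<in> H" for n x
    using that z add by (induction n) (auto simp: distrib_right)
  have mult: "k * x \<in> H" if "x \<in> H" for k x
  proof (cases "k \<ge> 0")
    case True
    then show ?thesis using natmult[OF that, of "nat k"] by simp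
  next
    case False
    then show ?thesis using neg[OF natmult[OF that, of "nat (- k)"]] by simp
  qed
  have "x \<in> H \<longleftrightarrow> int g dvd x" for x
  proof
    assume "x \<in> H"
    moreover have "- (x div int g) * int g \<in> H" using mult[of "int g" "- (x div int g)"] g by (simp add: Q_def)
    ultimately have "x + - (x div int g) * int g \<in> H" by (rule add)
    then have m: "x mod int g \<in> H" by (simp add: minus_div_mult_eq_mod)
    have g0: "int g > 0" using g by (simp add: Q_def)
    show "int g dvd x"
    proof (rule ccontr)
      assume "\<not> int g dvd x"
      then have "x mod int g > 0" using g0 by (metis dvd_eq_mod_eq_0 order_le_less pos_mod_sign)
      then have "Q (nat (x mod int g))" using m by (simp add: Q_def)
      then have "int g \<le> x mod int g" using min g0 by fastforce
      then show False using pos_mod_bound[OF g0, of x] by linarith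
    qed
  next
    assume "int g dvd x"
    then show "x \<in> H" using mult[of "int g"] g by (auto simp: Q_def mult.commute elim!: dvdE)
  qed
  then show ?thesis using that[of g] g by (auto simp: Q_def)
qed

section \<open>The integral basis 1, (1 + sqrt p) / 2\<close>

context prime_1_mod_4
begin

definition w :: real where "w = (1 + s) / 2"
definition w' :: real where "w' = (1 - s) / 2"
abbreviation OI :: "real set" where "OI \<equiv> carrier (quad_integers p)"

lemma real_p_eq: "real p = 4 * of_int K + 1"
  using p_eq_K by (metis of_int_1 of_int_add of_int_mult of_int_numeral of_int_of_nat_eq)

lemma w_square: "w * w = w + of_int K" and w'_square: "w' * w' = w' + of_int K"
  and w_w': "w * w' = - of_int K" and w_add_w': "w + w' = 1"
  using s_square by (simp_all add: w_def w'_def real_p_eq field_simps)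

lemma KK_w: "w \<in> KK" "cj w = w'" and KK_w': "w' \<in> KK"
proof -
  have w: "w = of_rat (1/2) + of_rat (1/2) * s" by (simp add: w_def of_rat_divide field_simps)
  have w': "w' = of_rat (1/2) - of_rat (1/2) * s" by (simp add: w'_def of_rat_divide field_simps)
  show "w \<in> KK" "cj w = w'" unfolding w' unfolding w by (rule KK_I, rule cj_eq)
  then show "w' \<in> KK" using KK_cj by metis
qed

definition el :: "int \<Rightarrow> int \<Rightarrow> real" where "el x y = of_int x + of_int y * w"

lemma el_add: "el x y + el x' y' = el (x + x') (y + y')"
  by (simp add: el_def algebra_simps)

lemma el_mult: "el x y * el x' y' = el (x * x' + K * (y * y')) (x * y' + y * x' + y * y')"
proof -
  have "el x y * el x' y' = of_int x * of_int x' + (of_int x * of_int y' + of_int y * of_int x') * w + of_int y * of_int y' * (w * w)"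
    unfolding el_def by (simp only: distrib_left distrib_right) (simp add: mult_ac)
  then show ?thesis unfolding w_square by (simp add: el_def algebra_simps)
qed

lemma el_0 [simp]: "el 0 0 = 0" and el_1: "el 1 0 = 1" and el_of_int: "el x 0 = of_int x"
  by (simp_all add: el_def)

lemma el_w: "el 0 1 = w" by (simp add: el_def)

lemma KK_el: "el x y \<in> KK" "cj (el x y) = of_int x + of_int y * w'"
  unfolding el_def using KK_w by (simp_all only: KK_add KK_mult KK_of_int)

lemma rat_w_unique:
  assumes "of_rat a + of_rat b * w = of_rat c + of_rat d * w"
  shows "a = c" "b = d"
proof -
  have "of_rat (a + b / 2) + of_rat (b / 2) * s = of_rat (c + d / 2) + of_rat (d / 2) * s"
    using assms by (simp add: w_def of_rat_add of_rat_divide algebra_simps add_divide_distrib)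
  from rat_coords_unique[OF this] show "a = c" "b = d" by auto
qed

lemma el_eq_iff: "el x y = el x' y' \<longleftrightarrow> x = x' \<and> y = y'"
  using rat_w_unique[of "of_int x" "of_int y" "of_int x'" "of_int y'"] by (auto simp: el_def)

lemma el_eq_0_iff: "el x y = 0 \<longleftrightarrow> x = 0 \<and> y = 0"
  using el_eq_iff[of x y 0 0] by simp

lemma OI_iff: "u \<in> OI \<longleftrightarrow> u \<in> KK \<and> algebraic_int u"
  by (simp add: quad_integers_def)

lemma el_OI [simp]: "el x y \<in> OI"
proof -
  have "el x y * el x y = el ((2 * x + y) * x + (K * (y * y) - x * x - x * y)) ((2 * x + y) * y)"
    by (simp add: el_mult algebra_simps)
  also have "\<dots> = of_int (2 * x + y) * el x y + of_int (K * (y * y) - x * x - x * y)"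
    by (simp add: el_def algebra_simps)
  finally have "algebraic_int (el x y)" by (rule algebraic_int_quadratic)
  then show ?thesis using KK_el by (simp add: OI_iff)
qed

text \<open>Trace t and norm n are integers, the trace by way of the norm of u + 1. With y = 2 b
  this gives p y^2 = t^2 - 4 n, so y is an integer and, p being odd, has the parity of t.\<close>

lemma OI_E:
  assumes "u \<in> OI"
  obtains x y where "u = el x y"
proof -
  have u: "u \<in> KK" "algebraic_int u" using assms by (simp_all add: OI_iff)
  obtain a b where ab: "u = of_rat a + of_rat b * s" "cj u = of_rat a - of_rat b * s"
    using u(1) by (rule KK_E)
  obtain n where n: "u * cj u = of_int n" using norm_algebraic_int[OF u] by blast
  obtain n' where n': "(u + 1) * cj (u + 1) = of_int n'"
    using norm_algebraic_int[OF _ algebraic_int_add_1[OF u(2)]] u(1) by (auto simp: KK_add)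
  have "(u + 1) * cj (u + 1) = u * cj u + (u + cj u) + 1"
    using u(1) by (simp add: KK_add algebra_simps)
  then have "u + cj u = of_int (n' - n - 1)" using n n' by simp
  moreover have "u + cj u = of_rat (2 * a)" unfolding ab(2) by (subst ab(1)) (simp add: of_rat_mult)
  ultimately have "of_rat (2 * a) = (of_rat (of_int (n' - n - 1)) :: real)" by (metis of_rat_of_int_eq)
  then obtain t where t: "2 * a = of_int t" by (simp only: of_rat_eq_iff)
  have "u * cj u = of_rat (a * a - of_nat p * (b * b))"
  proof -
    have "u * cj u = of_rat a * of_rat a - of_rat b * of_rat b * (s * s)"
      unfolding ab(2) by (subst ab(1)) (simp add: algebra_simps)
    then show ?thesis by (simp add: s_square of_rat_diff of_rat_mult)
  qed
  then have "of_rat (a * a - of_nat p * (b * b)) = (of_rat (of_int n) :: real)" using n by simp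
  then have abn: "a * a - of_nat p * (b * b) = of_int n" by (simp only: of_rat_eq_iff)
  define y where "y = 2 * b"
  have py: "of_nat p * (y * y) = of_int (t * t - 4 * n)"
  proof -
    have "of_nat p * (y * y) = (2 * a) * (2 * a) - 4 * (a * a - of_nat p * (b * b))"
      by (simp add: y_def algebra_simps)
    then show ?thesis by (simp add: t abn)
  qed
  \<comment> \<open>p y is rational with integral square, hence an integer. Its square is divisible
    by p, so p y is as well, and y is an integer.\<close>
  define v :: real where "v = of_rat (of_nat p * y)"
  have "(of_nat p * y) * (of_nat p * y) = of_int (int p * (t * t - 4 * n))"
    using py by (simp add: mult_ac)
  then have "of_rat ((of_nat p * y) * (of_nat p * y)) = (of_rat (of_int (int p * (t * t - 4 * n))) :: real)" by simp
  then have vv: "v * v = of_int (int p * (t * t - 4 * n))"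
    unfolding v_def by (simp only: of_rat_mult of_rat_of_int_eq)
  then have "algebraic_int v"
    by (intro algebraic_int_quadratic[of v 0 "int p * (t * t - 4 * n)"]) simp
  moreover have "v \<in> \<rat>" unfolding v_def by simp
  ultimately have "v \<in> \<int>" by (rule rational_algebraic_int_is_int)
  then obtain k where k: "v = of_int k" by (auto elim: Ints_cases)
  then have "of_int (k * k) = (of_int (int p * (t * t - 4 * n)) :: real)" using vv by simp
  then have "k * k = int p * (t * t - 4 * n)" by (simp only: of_int_eq_iff)
  then have "int p dvd k * k" by simp
  then have "int p dvd k" using prime_int_p prime_dvd_multD by blast
  then obtain z where "k = int p * z" by blast
  then have "of_rat (of_nat p * y) = (of_rat (of_nat p * of_int z) :: real)"
    using k by (simp add: v_def of_rat_mult)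
  then have yz: "y = of_int z" using p_gt_2 by (simp only: of_rat_eq_iff) simp
  have "rat_of_int (int p * (z * z)) = of_int (t * t - 4 * n)" using py yz by simp
  then have "int p * (z * z) = t * t - 4 * n" by (simp only: of_int_eq_iff)
  then have "even (t - z)" unfolding p_eq_K
    by (metis (no_types, opaque_lifting) even_add even_diff even_mult_iff even_numeral odd_one)
  then obtain x where x: "t - z = 2 * x" by blast
  have "u = el x z"
  proof -
    have "of_rat a = (of_int t / 2 :: real)" "of_rat b = (of_int z / 2 :: real)"
    proof -
      have "a = of_int t / 2" "b = of_int z / 2" using t yz by (simp_all add: y_def)
      then show "of_rat a = (of_int t / 2 :: real)" "of_rat b = (of_int z / 2 :: real)"
        by (simp_all only: of_rat_divide of_rat_of_int_eq of_rat_numeral_eq)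
    qed
    moreover have "of_int t = of_int z + 2 * (of_int x :: real)"
      using x by (metis add.commute diff_add_cancel of_int_add of_int_mult of_int_numeral)
    ultimately show ?thesis unfolding ab(1) by (simp add: el_def w_def field_simps)
  qed
  then show ?thesis by (rule that)
qed

lemma OI_closed: "u \<in> OI \<Longrightarrow> v \<in> OI \<Longrightarrow> u + v \<in> OI" "u \<in> OI \<Longrightarrow> v \<in> OI \<Longrightarrow> u * v \<in> OI"
  "u \<in> OI \<Longrightarrow> - u \<in> OI" "of_int k \<in> OI" "0 \<in> OI" "1 \<in> OI" "w \<in> OI"
proof -
  show "u + v \<in> OI" if "u \<in> OI" "v \<in> OI"
    using that by (metis OI_E el_add el_OI)
  show m: "u * v \<in> OI" if "u \<in> OI" "v \<in> OI" for u v
    using that by (metis OI_E el_mult el_OI)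
  show i: "of_int k \<in> OI" for k using el_OI[of k 0] by (simp add: el_def)
  show "- u \<in> OI" if "u \<in> OI" using m[OF i[of "-1"] that] by simp
  show "0 \<in> OI" "1 \<in> OI" "w \<in> OI" using el_OI[of 0 0] el_OI[of 1 0] el_OI[of 0 1] by (simp_all add: el_def)
qed

section \<open>Normal form and norm of ideals\<close>

lemma quad_integers_simps [simp]:
  "x \<otimes>\<^bsub>quad_integers p\<^esub> y = x * y" "x \<oplus>\<^bsub>quad_integers p\<^esub> y = x + y"
  "\<one>\<^bsub>quad_integers p\<^esub> = 1" "\<zero>\<^bsub>quad_integers p\<^esub> = 0"
  by (simp_all add: quad_integers_def)

lemma ring_OI: "ring (quad_integers p)"
proof (rule ringI)
  show "abelian_group (quad_integers p)"
    by (rule abelian_groupI) (auto simp: OI_closed intro!: bexI[of _ "- _"])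
  show "monoid (quad_integers p)"
    by (rule monoidI) (auto simp: OI_closed)
qed (auto simp: algebra_simps)

text \<open>Ideals as plain sets of reals; negatives come from multiplication by -1.\<close>

definition is_ideal :: "real set \<Rightarrow> bool" where
  "is_ideal I \<longleftrightarrow> I \<subseteq> OI \<and> 0 \<in> I \<and> (\<forall>x\<in>I. \<forall>y\<in>I. x + y \<in> I) \<and> (\<forall>x\<in>I. \<forall>a\<in>OI. a * x \<in> I)"

lemma ideal_iff: "ideal I (quad_integers p) \<longleftrightarrow> is_ideal I"
proof
  assume "ideal I (quad_integers p)"
  then interpret ideal I "quad_integers p" .
  show "is_ideal I"
    using a_subset additive_subgroup.zero_closed[OF is_additive_subgroup]
      additive_subgroup.a_closed[OF is_additive_subgroup] I_l_closed by (auto simp: is_ideal_def)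
next
  assume I: "is_ideal I"
  show "ideal I (quad_integers p)"
  proof (rule idealI[OF ring_OI])
    show "subgroup I (add_monoid (quad_integers p))"
    proof
      fix x assume x: "x \<in> I"
      have xO: "x \<in> OI" using I x by (auto simp: is_ideal_def)
      have "(- 1) * x \<in> I" using I x OI_closed(3)[OF OI_closed(6)] unfolding is_ideal_def by blast
      moreover have "inv\<^bsub>add_monoid (quad_integers p)\<^esub> x = - x"
      proof -
        interpret ring "quad_integers p" by (rule ring_OI)
        have "\<ominus>\<^bsub>quad_integers p\<^esub> x = - x"
          using xO OI_closed(3) by (intro minus_equality) auto
        then show ?thesis by (simp add: a_inv_def)
      qed
      ultimately show "inv\<^bsub>add_monoid (quad_integers p)\<^esub> x \<in> I" by simp
    qed (use I in \<open>auto simp: is_ideal_def\<close>)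
  qed (use I in \<open>auto simp: is_ideal_def mult.commute\<close>)
qed

lemma nonzero_ideals_iff: "I \<in> nonzero_ideals p \<longleftrightarrow> is_ideal I \<and> I \<noteq> {0}"
  by (simp add: nonzero_ideals_def ideal_iff)

text \<open>\<open>J d a b\<close> is the lattice \<open>d (\<int> a + \<int> (b + w))\<close>.\<close>

definition J :: "nat \<Rightarrow> nat \<Rightarrow> int \<Rightarrow> real set" where
  "J d a b = {el (int d * (x * int a + y * b)) (int d * y) | x y. True}"

text \<open>Divisibility of \<open>f b\<close> by a makes the lattice stable under multiplication by
  \<open>w\<close>, and the reduction of b modulo a makes the parameters unique.\<close>

definition valid :: "nat \<Rightarrow> nat \<Rightarrow> int \<Rightarrow> bool" where
  "valid d a b \<longleftrightarrow> d > 0 \<and> a > 0 \<and> b \<in> roots a"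

lemma J_iff: "el X Y \<in> J d a b \<longleftrightarrow> (\<exists>x y. X = int d * (x * int a + y * b) \<and> Y = int d * y)"
  by (auto simp: J_def el_eq_iff)

lemma ideal_mult_int: "is_ideal I \<Longrightarrow> x \<in> I \<Longrightarrow> of_int k * x \<in> I"
  by (auto simp: is_ideal_def OI_closed)

lemma ideal_add: "is_ideal I \<Longrightarrow> x \<in> I \<Longrightarrow> y \<in> I \<Longrightarrow> x + y \<in> I"
  by (auto simp: is_ideal_def)

lemma ideal_mult: "is_ideal I \<Longrightarrow> x \<in> I \<Longrightarrow> a \<in> OI \<Longrightarrow> a * x \<in> I"
  by (auto simp: is_ideal_def)

lemma of_int_mult_el: "of_int k * el x y = el (k * x) (k * y)"
  by (simp add: el_def algebra_simps)

text \<open>g generates the integers in I, and d the group of \<open>w\<close>-coordinates of its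
  elements. Multiplication by \<open>w\<close> shows that d divides both coordinates of an element k
  + d w, and multiplication by a conjugate shows that a = g / d divides \<open>f b0\<close>.\<close>

lemma ideal_structure:
  assumes I: "is_ideal I" and ne: "I \<noteq> {0}"
  obtains d a b where "valid d a b" "I = J d a b"
proof -
  have IO: "I \<subseteq> OI" and I0: "0 \<in> I" using I by (auto simp: is_ideal_def)
  have Iadd: "el (x + x') (y + y') \<in> I" if "el x y \<in> I" "el x' y' \<in> I" for x y x' y'
    using ideal_add[OF I that] by (simp add: el_add)
  have Imul: "el (k * x) (k * y) \<in> I" if "el x y \<in> I" for k x y
    using ideal_mult_int[OF I that, of k] by (simp add: of_int_mult_el)
  have Iel: "el (x * x' + K * (y * y')) (x * y' + y * x' + y * y') \<in> I" if "el x' y' \<in> I" for x y x' y'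
    using ideal_mult[OF I that el_OI[of x y]] by (simp add: el_mult)
  obtain u where "u \<in> I" "u \<noteq> 0" using ne I0 by blast
  then obtain x0 y0 where xy0: "el x0 y0 \<in> I" "el x0 y0 \<noteq> 0" using IO OI_E by (metis subsetD)
  \<comment> \<open>The norm of \<open>el x0 y0\<close>, which is its product with the conjugate
    \<open>el (x0 + y0) (- y0)\<close>.\<close>
  define n0 where "n0 = x0 * x0 + x0 * y0 - K * (y0 * y0)"
  have n0: "el n0 0 \<in> I"
    using Iel[OF xy0(1), of "x0 + y0" "- y0"] by (simp add: n0_def algebra_simps)
  have "n0 \<noteq> 0"
  proof
    assume "n0 = 0"
    then have "el (x0 + y0) (- y0) * el x0 y0 = 0"
      by (simp add: el_mult n0_def algebra_simps el_eq_0_iff)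
    then show False using xy0(2) by (auto simp: el_eq_0_iff)
  qed
  obtain g where g: "g > 0" "\<And>x. x \<in> {x. el x 0 \<in> I} \<longleftrightarrow> int g dvd x"
    by (rule int_subgroup_generator[of "{x. el x 0 \<in> I}" n0])
       (use Iadd[of _ 0 _ 0] Imul[of _ 0 "-1"] n0 \<open>n0 \<noteq> 0\<close> in auto)
  have wg: "el 0 (int g) \<in> I" using g(2)[of "int g"] Iel[of "int g" 0 0 1] by simp
  obtain d where d: "d > 0" "\<And>y. y \<in> {y. \<exists>x. el x y \<in> I} \<longleftrightarrow> int d dvd y"
    by (rule int_subgroup_generator[of "{y. \<exists>x. el x y \<in> I}" "int g"])
       (use Iadd Imul[of _ _ "-1"] wg g(1) in \<open>auto, blast, fastforce\<close>)
  obtain k where k: "el k (int d) \<in> I" using d(2)[of "int d"] by auto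
  have "int d dvd int g" using d(2)[of "int g"] wg by auto
  then obtain a where a: "g = d * a" by (auto simp: int_dvd_int_iff)
  then have a0: "a > 0" using g(1) by (cases a) auto
  \<comment> \<open>The product of \<open>el k (int d)\<close> with \<open>w\<close>; its
    \<open>w\<close>-coordinate is k + d.\<close>
  have "el (K * int d) (k + int d) \<in> I" using Iel[OF k, of 0 1] by (simp add: algebra_simps)
  then have "int d dvd k + int d" using d(2)[of "k + int d"] by blast
  then obtain b0 where b0: "k = int d * b0" by (auto simp: dvd_add_left_iff)
  \<comment> \<open>\<open>el (b0 + 1) (-1)\<close> is the conjugate of b0 + w, so its product with
    d (b0 + w) is d times a norm.\<close>
  have "el (int d * f b0) 0 \<in> I"
    using Iel[OF k, of "b0 + 1" "-1"] by (simp add: b0 f_def algebra_simps)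
  then have "int d * int a dvd int d * f b0" using g(2)[of "int d * f b0"] by (simp add: a)
  then have af: "int a dvd f b0" using d(1) by simp
  define b where "b = b0 mod int a"
  have b: "b \<in> roots a" using a0 af by (simp add: b_def roots_def dvd_f_mod)
  have b0b: "b0 = b + int a * (b0 div int a)" by (simp add: b_def)
  have ga: "el (int d * int a) 0 \<in> I" using g(2)[of "int g"] by (simp add: a)
  have gb: "el (int d * b) (int d) \<in> I"
  proof -
    have "el (k + (- (b0 div int a)) * (int d * int a)) (int d + (- (b0 div int a)) * 0) \<in> I"
      by (rule Iadd[OF k Imul[OF ga]])
    moreover have "k + (- (b0 div int a)) * (int d * int a) = int d * b"
      by (subst b0, subst b0b) (simp add: algebra_simps)
    ultimately show ?thesis by simp
  qed
  have "I = J d a b"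
  proof (intro equalityI subsetI)
    fix u assume u: "u \<in> I"
    then obtain X Y where XY: "u = el X Y" using IO OI_E by (metis subsetD)
    obtain y where y: "Y = int d * y" using d(2)[of Y] u XY by (auto elim: dvdE)
    have "el (X + (- y) * (int d * b)) (Y + (- y) * int d) \<in> I"
      using Iadd[OF _ Imul[OF gb]] u XY by blast
    then have "el (X - y * (int d * b)) 0 \<in> I" by (simp add: y mult.commute)
    then have "int d * int a dvd X - y * (int d * b)" using g(2)[of "X - y * (int d * b)"] by (simp add: a)
    then obtain x where "X - y * (int d * b) = int d * int a * x" by blast
    then have "X = int d * (x * int a + y * b)" by (simp add: algebra_simps)
    then show "u \<in> J d a b" unfolding XY J_iff using y by blast
  next
    fix u assume "u \<in> J d a b"
    then obtain x y where u: "u = el (int d * (x * int a + y * b)) (int d * y)" by (auto simp: J_def)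
    have "el (x * (int d * int a) + y * (int d * b)) (x * 0 + y * int d) \<in> I"
      by (rule Iadd[OF Imul[OF ga] Imul[OF gb]])
    then show "u \<in> I" by (simp add: u algebra_simps)
  qed
  moreover have "valid d a b" using d(1) a0 b by (simp add: valid_def)
  ultimately show ?thesis using that by blast
qed

text \<open>Ring elements are integer combinations of 1 and \<open>w\<close>, so stability under
  \<open>w\<close> suffices, and there the divisibility of \<open>f b\<close> by a enters.\<close>

lemma J_ideal:
  assumes "valid d a b"
  shows "is_ideal (J d a b)" "J d a b \<noteq> {0}"
proof -
  obtain c where c: "f b = int a * c" using assms by (auto simp: valid_def roots_def)
  have Jadd: "u + v \<in> J d a b" if uv: "u \<in> J d a b" "v \<in> J d a b" for u v
  proof -
    obtain x y where "u = el (int d * (x * int a + y * b)) (int d * y)" using uv(1) by (auto simp: J_def)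
    moreover obtain x' y' where "v = el (int d * (x' * int a + y' * b)) (int d * y')" using uv(2) by (auto simp: J_def)
    ultimately have "u + v = el (int d * ((x + x') * int a + (y + y') * b)) (int d * (y + y'))"
      by (simp add: el_add algebra_simps)
    then show ?thesis unfolding J_def by blast
  qed
  have Jint: "of_int k * u \<in> J d a b" if u: "u \<in> J d a b" for u k
  proof -
    obtain x y where "u = el (int d * (x * int a + y * b)) (int d * y)" using u by (auto simp: J_def)
    then have "of_int k * u = el (int d * ((k * x) * int a + (k * y) * b)) (int d * (k * y))"
      by (simp add: of_int_mult_el algebra_simps)
    then show ?thesis unfolding J_def by blast
  qed
  have Jw: "w * u \<in> J d a b" if u: "u \<in> J d a b" for u
  proof -
    obtain x y where u: "u = el (int d * (x * int a + y * b)) (int d * y)" using u by (auto simp: J_def)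
    have Ky: "K * y = y * b * b + y * b - y * (int a * c)"
      unfolding c[symmetric] by (simp add: f_def algebra_simps)
    have "w * u = el (int d * (K * y)) (int d * (x * int a + y * b + y))"
      unfolding u el_w[symmetric] el_mult by (simp add: algebra_simps)
    also have "int d * (K * y) = int d * ((- (x * b) - y * c) * int a + (x * int a + y * b + y) * b)"
      unfolding Ky by (simp add: algebra_simps)
    finally show ?thesis unfolding J_def by blast
  qed
  have "z * u \<in> J d a b" if "u \<in> J d a b" "z \<in> OI" for z u
  proof -
    obtain x y where "z = el x y" using \<open>z \<in> OI\<close> by (rule OI_E)
    then have "z * u = of_int x * u + of_int y * (w * u)" by (simp add: el_def algebra_simps)
    then show ?thesis using Jadd Jint Jw that(1) by simp
  qed
  moreover have "0 \<in> J d a b" unfolding J_def by (rule CollectI, rule exI[of _ 0], rule exI[of _ 0]) simp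
  moreover have "J d a b \<subseteq> OI" by (auto simp: J_def)
  ultimately show "is_ideal (J d a b)" using Jadd by (simp add: is_ideal_def)
  have "el (int d * int a) 0 \<in> J d a b" unfolding J_iff by (rule exI[of _ 1], rule exI[of _ 0]) simp
  moreover have "el (int d * int a) 0 \<noteq> 0" using assms by (simp add: valid_def el_eq_0_iff)
  ultimately show "J d a b \<noteq> {0}" by blast
qed

text \<open>d generates the \<open>w\<close>-coordinates and d a the integers of the lattice; b is
  then determined modulo a, hence by its range.\<close>

lemma J_inj:
  assumes v: "valid d a b" "valid d' a' b'" and eq: "J d a b = J d' a' b'"
  shows "d = d' \<and> a = a' \<and> b = b'"
proof -
  have main: "d' dvd d" "d = d' \<Longrightarrow> a' dvd a" "d = d' \<Longrightarrow> a = a' \<Longrightarrow> int a dvd b - b'"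
    if v: "valid d a b" "valid d' a' b'" and eq: "J d a b = J d' a' b'" for d a b d' a' b'
  proof -
    have "el (int d * b) (int d) \<in> J d a b" unfolding J_iff by (rule exI[of _ 0], rule exI[of _ 1]) simp
    then obtain x y where xy: "int d * b = int d' * (x * int a' + y * b')" "int d = int d' * y"
      unfolding eq J_iff by blast
    then show "d' dvd d" by (metis dvd_triv_left int_dvd_int_iff)
    show "a' dvd a" if "d = d'"
    proof -
      have "el (int d * int a) 0 \<in> J d a b" unfolding J_iff by (rule exI[of _ 1], rule exI[of _ 0]) simp
      then obtain x y where "int d * int a = int d' * (x * int a' + y * b')" "0 = int d' * y"
        unfolding eq J_iff by blast
      then have "int a = x * int a'" using that v by (simp add: valid_def)
      then show ?thesis by (metis dvd_triv_right int_dvd_int_iff)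
    qed
    show "int a dvd b - b'" if "d = d'" "a = a'"
    proof -
      have "y = 1" using xy(2) that v by (simp add: valid_def)
      then have "b = x * int a' + b'" using xy(1) that v by (simp add: valid_def)
      then show ?thesis using that by simp
    qed
  qed
  have d: "d = d'" using main(1)[OF v eq] main(1)[OF v(2,1) eq[symmetric]] by (rule dvd_antisym[rotated])
  have a: "a = a'" using main(2)[OF v eq d] main(2)[OF v(2,1) eq[symmetric] d[symmetric]] by (rule dvd_antisym[rotated])
  have "int a dvd b - b'" using main(3)[OF v eq d a] .
  then have "b mod int a = b' mod int a" by (simp add: mod_eq_dvd_iff)
  then have "b = b'" using v a by (simp add: valid_def roots_def)
  then show ?thesis using d a by blast
qed

text \<open>The index of the ideal in the ring of integers, read off from the normal form;
  \<open>J_inj\<close> makes it well defined.\<close>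

definition nrm :: "real set \<Rightarrow> nat" where
  "nrm I = (THE n. \<exists>d a b. valid d a b \<and> I = J d a b \<and> n = d\<^sup>2 * a)"

lemma nrm_J: "valid d a b \<Longrightarrow> nrm (J d a b) = d\<^sup>2 * a"
  unfolding nrm_def by (rule the_equality) (auto dest: J_inj)

section \<open>Counting ideals of bounded norm\<close>

definition ideals_upto :: "nat \<Rightarrow> real set set" where
  "ideals_upto n = {I \<in> nonzero_ideals p. nrm I \<le> n}"

definition ideal_params :: "nat \<Rightarrow> (nat \<times> nat \<times> int) set" where
  "ideal_params k = {(d, a, b). valid d a b \<and> d\<^sup>2 * a = k}"

text \<open>The factor d is determined by a and k. The triples thus correspond to divisors a of k
  with square cofactor, each with a root modulo a, and this is the convolution.\<close>

lemma card_ideal_params: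
  assumes k: "k > 0"
  shows "finite (ideal_params k)" "int (card (ideal_params k)) = dconv rho square_ind k"
proof -
  define A where "A = {a. a dvd k \<and> is_nth_power 2 (k div a)}"
  have finA: "finite A" unfolding A_def using k by (simp add: finite_divisors_nat)
  have inj: "inj_on snd (ideal_params k)"
  proof (rule inj_onI)
    fix x y assume xy: "x \<in> ideal_params k" "y \<in> ideal_params k" "snd x = snd y"
    obtain d a b d' where "x = (d, a, b)" "y = (d', a, b)" using xy(3) by (metis prod.collapse)
    then have "d\<^sup>2 * a = d'\<^sup>2 * a" "a > 0" using xy by (auto simp: ideal_params_def valid_def)
    then have "d = d'" by (simp add: power2_eq_iff_nonneg)
    then show "x = y" using \<open>x = _\<close> \<open>y = _\<close> by simp
  qed
  have img: "snd ` ideal_params k = Sigma A roots"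
  proof (intro equalityI subsetI)
    fix z assume "z \<in> snd ` ideal_params k"
    then obtain d a b where z: "z = (a, b)" "valid d a b" "d\<^sup>2 * a = k" by (auto simp: ideal_params_def)
    then have "k div a = d\<^sup>2" by (auto simp: valid_def)
    then show "z \<in> Sigma A roots" using z by (auto simp: A_def valid_def is_nth_power_def)
  next
    fix z assume "z \<in> Sigma A roots"
    then obtain a b where z: "z = (a, b)" "a dvd k" "is_nth_power 2 (k div a)" "b \<in> roots a" by (auto simp: A_def)
    then obtain d where "k div a = d\<^sup>2" by (auto simp: is_nth_power_def)
    then have dk: "d\<^sup>2 * a = k" using z(2) by (metis dvd_div_mult_self)
    then have "d > 0" "a > 0" using k by (auto intro: Nat.gr0I)
    then have "(d, a, b) \<in> ideal_params k" using z dk by (simp add: ideal_params_def valid_def)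
    then show "z \<in> snd ` ideal_params k" using z(1) by force
  qed
  have "finite (Sigma A roots)" using finA by simp
  then show "finite (ideal_params k)" using inj img by (metis finite_imageD)
  have "card (ideal_params k) = card (Sigma A roots)" using inj img by (metis card_image)
  also have "\<dots> = (\<Sum>a\<in>A. card (roots a))" using finA by (simp add: card_SigmaI)
  finally have "int (card (ideal_params k)) = (\<Sum>a\<in>A. rho a * 1)" by (simp add: rho_def)
  also have "\<dots> = (\<Sum>a | a dvd k. rho a * square_ind (k div a))"
    using k by (intro sum.mono_neutral_cong_left) (auto simp: A_def square_ind_def finite_divisors_nat)
  finally show "int (card (ideal_params k)) = dconv rho square_ind k" by (simp add: dconv_def)
qed

lemma card_ideals_upto: "finite (ideals_upto n)" "int (card (ideals_upto n)) = (\<Sum>k\<in>{1..n}. \<Sum>d | d dvd k. chi (int d))"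
proof -
  define T where "T = (\<Union>k\<in>{1..n}. ideal_params k)"
  have "bij_betw (\<lambda>(d, a, b). J d a b) T (ideals_upto n)"
  proof (rule bij_betwI')
    fix x y assume "x \<in> T" "y \<in> T"
    then show "((case x of (d, a, b) \<Rightarrow> J d a b) = (case y of (d, a, b) \<Rightarrow> J d a b)) = (x = y)"
      by (auto simp: T_def ideal_params_def dest: J_inj)
  next
    fix x assume "x \<in> T"
    then obtain d a b where "x = (d, a, b)" "valid d a b" "d\<^sup>2 * a \<le> n" by (auto simp: T_def ideal_params_def)
    then show "(case x of (d, a, b) \<Rightarrow> J d a b) \<in> ideals_upto n"
      using J_ideal by (simp add: ideals_upto_def nonzero_ideals_iff nrm_J)
  next
    fix I assume I: "I \<in> ideals_upto n"
    then obtain d a b where v: "valid d a b" "I = J d a b"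
      using ideal_structure by (metis ideals_upto_def mem_Collect_eq nonzero_ideals_iff)
    then have "d\<^sup>2 * a \<le> n" using I by (simp add: ideals_upto_def nrm_J)
    moreover have "d\<^sup>2 * a > 0" using v by (simp add: valid_def)
    ultimately have "(d, a, b) \<in> T" using v by (auto simp: T_def ideal_params_def)
    then show "\<exists>x\<in>T. I = (case x of (d, a, b) \<Rightarrow> J d a b)" using v by (intro bexI[of _ "(d, a, b)"]) auto
  qed
  moreover have finT: "finite T" unfolding T_def using card_ideal_params by auto
  ultimately show "finite (ideals_upto n)" "int (card (ideals_upto n)) = (\<Sum>k\<in>{1..n}. \<Sum>d | d dvd k. chi (int d))"
  proof -
    assume bij: "bij_betw (\<lambda>(d, a, b). J d a b) T (ideals_upto n)"
    show "finite (ideals_upto n)" using bij finT bij_betw_finite by blast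
    have "card (ideals_upto n) = card T" using bij by (simp add: bij_betw_same_card)
    also have "\<dots> = (\<Sum>k\<in>{1..n}. card (ideal_params k))"
      unfolding T_def by (rule card_UN_disjoint) (use card_ideal_params in \<open>auto simp: ideal_params_def\<close>)
    finally have "int (card (ideals_upto n)) = (\<Sum>k\<in>{1..n}. dconv rho square_ind k)" by (simp add: card_ideal_params)
    also have "\<dots> = (\<Sum>k\<in>{1..n}. \<Sum>d | d dvd k. chi (int d))"
      by (intro sum.cong refl dconv_rho_square_ind) auto
    finally show "int (card (ideals_upto n)) = (\<Sum>k\<in>{1..n}. \<Sum>d | d dvd k. chi (int d))" .
  qed
qed

end

section \<open>Units, ideal classes and the class number formula\<close>

context prime_1_mod_4
begin

section \<open>Covolumes and inverse ideals\<close>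

lemma w_minus_w': "w - w' = s"
  by (simp add: w_def w'_def field_simps)

definition spn :: "real \<Rightarrow> real \<Rightarrow> real set" where
  "spn \<alpha> \<beta> = {of_int x * \<alpha> + of_int y * \<beta> | x y. True}"

text \<open>The determinant of two numbers and their conjugates. Up to sign it depends only on the
  lattice they span, and scaling by \<gamma> multiplies it by the norm of \<gamma>.\<close>

definition disc :: "real \<Rightarrow> real \<Rightarrow> real" where "disc \<alpha> \<beta> = \<alpha> * cj \<beta> - \<beta> * cj \<alpha>"

lemma J_spn: "J d a b = spn (of_int (int d * int a)) (of_int (int d) * (of_int b + w))"
proof -
  have "el (int d * (x * int a + y * b)) (int d * y) =
      of_int x * of_int (int d * int a) + of_int y * (of_int (int d) * (of_int b + w))" for x y
    by (simp add: el_def algebra_simps)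
  then show ?thesis unfolding J_def spn_def by simp
qed

lemma image_mult_spn: "(*) \<gamma> ` spn \<alpha> \<beta> = spn (\<gamma> * \<alpha>) (\<gamma> * \<beta>)"
proof -
  have eq: "\<gamma> * (of_int x * \<alpha> + of_int y * \<beta>) = of_int x * (\<gamma> * \<alpha>) + of_int y * (\<gamma> * \<beta>)" for x y :: int
    by (simp add: algebra_simps)
  show ?thesis
  proof (intro equalityI subsetI)
    fix v assume "v \<in> (*) \<gamma> ` spn \<alpha> \<beta>"
    then obtain x y where "v = \<gamma> * (of_int x * \<alpha> + of_int y * \<beta>)" unfolding spn_def by blast
    then show "v \<in> spn (\<gamma> * \<alpha>) (\<gamma> * \<beta>)" unfolding eq spn_def by blast
  next
    fix v assume "v \<in> spn (\<gamma> * \<alpha>) (\<gamma> * \<beta>)"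
    then obtain x y where v: "v = \<gamma> * (of_int x * \<alpha> + of_int y * \<beta>)" unfolding spn_def eq by blast
    show "v \<in> (*) \<gamma> ` spn \<alpha> \<beta>" unfolding v by (rule imageI) (auto simp: spn_def)
  qed
qed

lemma spn_generators: "\<alpha> \<in> spn \<alpha> \<beta>" "\<beta> \<in> spn \<alpha> \<beta>"
  unfolding spn_def
  by (rule CollectI, rule exI[of _ 1], rule exI[of _ 0], simp)
     (rule CollectI, rule exI[of _ 0], rule exI[of _ 1], simp)

lemma disc_multiple:
  assumes K: "\<gamma> \<in> KK" "\<delta> \<in> KK" and sub: "spn \<alpha> \<beta> \<subseteq> spn \<gamma> \<delta>"
  obtains M :: int where "disc \<alpha> \<beta> = of_int M * disc \<gamma> \<delta>"
proof -
  obtain x y where \<alpha>: "\<alpha> = of_int x * \<gamma> + of_int y * \<delta>"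
    using spn_generators(1)[of \<alpha> \<beta>] sub unfolding spn_def by blast
  obtain z t where \<beta>: "\<beta> = of_int z * \<gamma> + of_int t * \<delta>"
    using spn_generators(2)[of \<beta> \<alpha>] sub unfolding spn_def by blast
  have "cj \<alpha> = of_int x * cj \<gamma> + of_int y * cj \<delta>" "cj \<beta> = of_int z * cj \<gamma> + of_int t * cj \<delta>"
    using K by (simp_all add: \<alpha> \<beta> KK_add KK_mult)
  then have "disc \<alpha> \<beta> = of_int (x * t - y * z) * disc \<gamma> \<delta>"
    unfolding disc_def by (simp add: \<alpha> \<beta> algebra_simps)
  then show ?thesis by (rule that)
qed

lemma abs_disc_eq:
  assumes "\<alpha> \<in> KK" "\<beta> \<in> KK" "\<gamma> \<in> KK" "\<delta> \<in> KK" and eq: "spn \<alpha> \<beta> = spn \<gamma> \<delta>"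
  shows "\<bar>disc \<alpha> \<beta>\<bar> = \<bar>disc \<gamma> \<delta>\<bar>"
proof -
  obtain M where M: "disc \<alpha> \<beta> = of_int M * disc \<gamma> \<delta>"
    using disc_multiple[of \<gamma> \<delta> \<alpha> \<beta>] assms by auto
  obtain M' where M': "disc \<gamma> \<delta> = of_int M' * disc \<alpha> \<beta>"
    using disc_multiple[of \<alpha> \<beta> \<gamma> \<delta>] assms by auto
  show ?thesis
  proof (cases "disc \<alpha> \<beta> = 0")
    case True
    then show ?thesis using M' by simp
  next
    case False
    have "disc \<alpha> \<beta> = of_int (M * M') * disc \<alpha> \<beta>" using M M' by simp
    then have "of_int (M * M') = (1 :: real)" using False by simp
    then have "M * M' = 1" by (simp only: of_int_eq_1_iff)
    then have "\<bar>M\<bar> = 1" by (metis abs_zmult_eq_1 abs_1)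
    then have "\<bar>real_of_int M\<bar> = 1" by linarith
    then show ?thesis using M by (simp add: abs_mult)
  qed
qed

text \<open>Both bases of the lattice have the same determinant up to sign: d^2 a sqrt p for the
  normal form, and a0 sqrt p times the norm of \<gamma> for the scaled one.\<close>

lemma nrm_scale:
  assumes v: "valid d a b" and \<gamma>: "\<gamma> \<in> KK" and eq: "J d a b = (*) \<gamma> ` J 1 a0 b0"
  shows "real (d\<^sup>2 * a) = \<bar>\<gamma> * cj \<gamma>\<bar> * real a0"
proof -
  have KKb: "of_int c * (of_int b + w) \<in> KK" "cj (of_int c * (of_int b + w)) = of_int c * (of_int b + w')" for b c
    using KK_w by (simp_all only: KK_mult KK_add KK_of_int)
  have D: "disc (of_int (c * a)) (of_int c * (of_int b + w)) = - (of_int (c * c * a) * s)" for c a b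
    unfolding disc_def KKb(2) KK_of_int w_minus_w'[symmetric] by (simp add: algebra_simps)
  have D\<gamma>: "disc (\<gamma> * \<alpha>) (\<gamma> * \<beta>) = \<gamma> * cj \<gamma> * disc \<alpha> \<beta>" if "\<alpha> \<in> KK" "\<beta> \<in> KK" for \<alpha> \<beta>
    using that \<gamma> by (simp add: disc_def KK_mult algebra_simps)
  have "\<bar>disc (of_int (int d * int a)) (of_int (int d) * (of_int b + w))\<bar> =
      \<bar>disc (\<gamma> * of_int (int 1 * int a0)) (\<gamma> * (of_int (int 1) * (of_int b0 + w)))\<bar>"
    using eq unfolding J_spn image_mult_spn
    by (intro abs_disc_eq KKb KK_mult \<gamma> KK_of_int)
  also have "\<dots> = \<bar>\<gamma> * cj \<gamma> * disc (of_int (int 1 * int a0)) (of_int (int 1) * (of_int b0 + w))\<bar>"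
    by (subst D\<gamma>) (simp_all only: KKb KK_of_int)
  finally have "\<bar>of_int (int d * int d * int a) * s\<bar> = \<bar>\<gamma> * cj \<gamma> * (of_int (int 1 * int 1 * int a0) * s)\<bar>"
    unfolding D by (simp only: abs_minus_cancel mult_minus_right)
  then have "real (d\<^sup>2 * a) * s = \<bar>\<gamma> * cj \<gamma>\<bar> * real a0 * s"
    using s_pos by (simp add: abs_mult power2_eq_square)
  then show ?thesis using s_pos by simp
qed

text \<open>Together with 1 it spans the inverse of the ideal \<open>J 1 a b\<close>, that is, the
  conjugate ideal divided by its norm a.\<close>

definition \<theta> :: "nat \<Rightarrow> int \<Rightarrow> real" where "\<theta> a b = (of_int b + w') / of_int (int a)"
definition \<theta>' :: "nat \<Rightarrow> int \<Rightarrow> real" where "\<theta>' a b = (of_int b + w) / of_int (int a)"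

lemma KK_theta: "\<theta> a b \<in> KK" "cj (\<theta> a b) = \<theta>' a b"
proof -
  have "cj w' = w" using KK_w KK_cj by metis
  then show "\<theta> a b \<in> KK" "cj (\<theta> a b) = \<theta>' a b"
    unfolding \<theta>_def \<theta>'_def using KK_w' by (simp_all only: KK_divide KK_add KK_of_int)
qed

lemma KK_lattice: "of_int x + of_int y * \<theta> a b \<in> KK" "cj (of_int x + of_int y * \<theta> a b) = of_int x + of_int y * \<theta>' a b"
  using KK_theta by (simp_all only: KK_add KK_mult KK_of_int)

lemma f_eq_norm: "(of_int b + w) * (of_int b + w') = of_int (f b)"
proof -
  have "(of_int b + w) * (of_int b + w') = of_int b * of_int b + of_int b * (w + w') + w * w'"
    by (simp add: algebra_simps)
  then show ?thesis unfolding w_w' w_add_w' by (simp add: f_def)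
qed

text \<open>The \<gamma> that map the ideal into the ring form its inverse ideal, with basis 1,
  \<open>\<theta> a b\<close>. Counting integral multiples of a class representative thereby becomes
  counting lattice points.\<close>

lemma scaled_subset_iff:
  assumes a: "a > 0" and b: "b \<in> roots a" and \<gamma>: "\<gamma> \<in> KK"
  shows "(*) \<gamma> ` J 1 a b \<subseteq> OI \<longleftrightarrow> (\<exists>x y. \<gamma> = of_int x + of_int y * \<theta> a b)"
proof
  obtain c where c: "f b = int a * c" using b by (auto simp: roots_def)
  assume sub: "(*) \<gamma> ` J 1 a b \<subseteq> OI"
  have "of_int (int 1 * int a) \<in> J 1 a b" "of_int (int 1) * (of_int b + w) \<in> J 1 a b"
    unfolding J_spn by (rule spn_generators)+
  then have m: "\<gamma> * of_int (int a) \<in> OI" "\<gamma> * (of_int b + w) \<in> OI" using sub by auto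
  obtain X Y where XY: "\<gamma> * of_int (int a) = el X Y" using m(1) by (rule OI_E)
  define y where "y = - Y"
  define s0 where "s0 = X + Y - y * b"
  have "el X Y = of_int s0 + of_int y * (of_int b + w')"
  proof -
    have w: "w = 1 - w'" using w_add_w' by simp
    show ?thesis unfolding el_def w by (simp add: s0_def y_def algebra_simps)
  qed
  then have g: "\<gamma> * of_int (int a) = of_int s0 + of_int y * (of_int b + w')" using XY by simp
  obtain X1 Y1 where XY1: "\<gamma> * (of_int b + w) = el X1 Y1" using m(2) by (rule OI_E)
  \<comment> \<open>Expanding a \<gamma> (b + w) in two ways exhibits \<open>s0\<close> as a
    multiple of a, by comparing \<open>w\<close>-coordinates.\<close>
  have "of_int (int a) * el X1 Y1 = (\<gamma> * of_int (int a)) * (of_int b + w)" using XY1 by (simp add: mult_ac)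
  also have "\<dots> = of_int s0 * (of_int b + w) + of_int y * ((of_int b + w) * (of_int b + w'))"
    unfolding g by (simp add: algebra_simps)
  also have "\<dots> = el (s0 * b + y * f b) s0" unfolding f_eq_norm by (simp add: el_def algebra_simps)
  finally have "el (int a * X1) (int a * Y1) = el (s0 * b + y * f b) s0" unfolding of_int_mult_el .
  then have "s0 = int a * Y1" by (simp add: el_eq_iff)
  then have "\<gamma> * of_int (int a) = (of_int Y1 + of_int y * \<theta> a b) * of_int (int a)"
    using g a by (simp add: \<theta>_def field_simps)
  then have "\<gamma> = of_int Y1 + of_int y * \<theta> a b" using a by simp
  then show "\<exists>x y. \<gamma> = of_int x + of_int y * \<theta> a b" by blast
next
  obtain c where c: "f b = int a * c" using b by (auto simp: roots_def)
  assume "\<exists>x y. \<gamma> = of_int x + of_int y * \<theta> a b"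
  then obtain x y where \<gamma>xy: "\<gamma> = of_int x + of_int y * \<theta> a b" by blast
  have "w' = el 1 (-1)" using w_add_w' by (simp add: el_def)
  then have "w' \<in> OI" by simp
  have "\<gamma> * of_int (int a) = of_int (x * int a) + of_int y * (of_int b + w')"
    using a by (simp add: \<gamma>xy \<theta>_def field_simps)
  then have 1: "\<gamma> * of_int (int a) \<in> OI" using \<open>w' \<in> OI\<close> by (simp only: OI_closed)
  have "\<gamma> * (of_int b + w) = of_int x * (of_int b + w) + of_int y * ((of_int b + w) * (of_int b + w')) / of_int (int a)"
    by (simp add: \<gamma>xy \<theta>_def algebra_simps)
  also have "\<dots> = of_int x * (of_int b + w) + of_int (y * c)"
    unfolding f_eq_norm c using a by simp
  finally have 2: "\<gamma> * (of_int b + w) \<in> OI" by (simp only: OI_closed)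
  show "(*) \<gamma> ` J 1 a b \<subseteq> OI"
  proof
    fix v assume "v \<in> (*) \<gamma> ` J 1 a b"
    then obtain x y where "v = of_int x * (\<gamma> * of_int (int a)) + of_int y * (\<gamma> * (of_int b + w))"
      unfolding J_spn image_mult_spn by (auto simp: spn_def)
    then show "v \<in> OI" using 1 2 by (simp only: OI_closed)
  qed
qed

lemma scaled_nonzero_ideal:
  assumes v: "valid 1 a b" and \<gamma>: "\<gamma> \<noteq> 0" and sub: "(*) \<gamma> ` J 1 a b \<subseteq> OI"
  shows "(*) \<gamma> ` J 1 a b \<in> nonzero_ideals p"
proof -
  have I: "is_ideal (J 1 a b)" "J 1 a b \<noteq> {0}" using J_ideal[OF v] by auto
  have "is_ideal ((*) \<gamma> ` J 1 a b)"
    unfolding is_ideal_def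
  proof (intro conjI ballI)
    show "0 \<in> (*) \<gamma> ` J 1 a b" using I(1) by (auto simp: is_ideal_def image_iff intro!: bexI[of _ 0])
    fix x assume x: "x \<in> (*) \<gamma> ` J 1 a b"
    then obtain x1 where x1: "x = \<gamma> * x1" "x1 \<in> J 1 a b" by blast
    { fix y assume "y \<in> (*) \<gamma> ` J 1 a b"
      then obtain y1 where "y = \<gamma> * y1" "y1 \<in> J 1 a b" by blast
      then have "x + y = \<gamma> * (x1 + y1)" "x1 + y1 \<in> J 1 a b"
        using x1 ideal_add[OF I(1)] by (simp_all add: distrib_left)
      then show "x + y \<in> (*) \<gamma> ` J 1 a b" by blast }
    { fix z assume "z \<in> OI"
      then have "z * x = \<gamma> * (z * x1)" "z * x1 \<in> J 1 a b"
        using x1 ideal_mult[OF I(1)] by simp_all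
      then show "z * x \<in> (*) \<gamma> ` J 1 a b" by blast }
  qed (use sub in auto)
  moreover have "(*) \<gamma> ` J 1 a b \<noteq> {0}"
  proof -
    obtain u where "u \<in> J 1 a b" "u \<noteq> 0" using I by (auto simp: is_ideal_def)
    then show ?thesis using \<gamma> by (metis imageI mult_eq_0_iff singletonD)
  qed
  ultimately show ?thesis by (simp add: nonzero_ideals_iff)
qed

lemma nrm_scaled:
  assumes v: "valid 1 a b" and \<gamma>: "\<gamma> \<in> KK" "\<gamma> \<noteq> 0" and sub: "(*) \<gamma> ` J 1 a b \<subseteq> OI"
  shows "real (nrm ((*) \<gamma> ` J 1 a b)) = \<bar>\<gamma> * cj \<gamma>\<bar> * real a"
proof -
  have "is_ideal ((*) \<gamma> ` J 1 a b)" "(*) \<gamma> ` J 1 a b \<noteq> {0}"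
    using scaled_nonzero_ideal[OF v \<gamma>(2) sub] by (auto simp: nonzero_ideals_iff)
  then obtain d a' b' where v': "valid d a' b'" "(*) \<gamma> ` J 1 a b = J d a' b'"
    by (rule ideal_structure)
  then show ?thesis using nrm_scale[OF v'(1) \<gamma>(1), of a b] by (simp add: nrm_J)
qed

section \<open>Units and the lattice points of a sector\<close>

abbreviation UU :: "real set" where "UU \<equiv> Units (quad_integers p)"

lemma UU_iff: "u \<in> UU \<longleftrightarrow> u \<in> OI \<and> (\<exists>v\<in>OI. u * v = 1)"
  by (auto simp: Units_def mult.commute)

lemma UU_KK: "u \<in> UU \<Longrightarrow> u \<in> KK" by (simp add: UU_iff OI_iff)

lemma UU_nz: "u \<in> UU \<Longrightarrow> u \<noteq> 0" by (auto simp: UU_iff)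

lemma UU_mult: "u \<in> UU \<Longrightarrow> v \<in> UU \<Longrightarrow> u * v \<in> UU"
proof -
  assume uv: "u \<in> UU" "v \<in> UU"
  then obtain u' v' where "u' \<in> OI" "v' \<in> OI" "u * u' = 1" "v * v' = 1" by (auto simp: UU_iff)
  then have "(u * v) * (u' * v') = 1" "u' * v' \<in> OI"
    by (simp_all add: OI_closed) (metis (no_types, opaque_lifting) mult.assoc mult.left_commute mult.right_neutral)
  then show ?thesis using uv by (auto simp: UU_iff OI_closed)
qed

lemma UU_inverse: "u \<in> UU \<Longrightarrow> inverse u \<in> UU"
proof -
  assume u: "u \<in> UU"
  then obtain v where v: "v \<in> OI" "u * v = 1" by (auto simp: UU_iff)
  then have "inverse u = v" by (simp add: inverse_unique)
  then show ?thesis using u v by (auto simp: UU_iff mult.commute)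
qed

lemma UU_uminus: "u \<in> UU \<Longrightarrow> - u \<in> UU"
  by (auto simp: UU_iff OI_closed intro!: bexI[of _ "- _"])

lemma UU_1: "1 \<in> UU" by (auto simp: UU_iff OI_closed)

lemma UU_power_int: "u \<in> UU \<Longrightarrow> u powi k \<in> UU"
proof -
  assume u: "u \<in> UU"
  have "v ^ n \<in> UU" if "v \<in> UU" for v n
    using that UU_1 UU_mult by (induction n) auto
  then show ?thesis using u UU_inverse by (simp add: power_int_def)
qed

lemma UU_norm:
  assumes "u \<in> UU"
  shows "\<bar>u * cj u\<bar> = 1"
proof -
  obtain v where v: "u \<in> OI" "v \<in> OI" "u * v = 1" using assms by (auto simp: UU_iff)
  then have K: "u \<in> KK" "v \<in> KK" "algebraic_int u" "algebraic_int v" by (simp_all add: OI_iff)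
  obtain z z' where z: "u * cj u = of_int z" "v * cj v = of_int z'" using norm_algebraic_int K by blast
  have "(u * cj u) * (v * cj v) = (u * v) * cj (u * v)" using K by (simp add: KK_mult)
  also have "\<dots> = 1" by (simp add: v)
  finally have "of_int (z * z') = (1 :: real)" by (simp add: z)
  then have "z * z' = 1" by (simp only: of_int_eq_1_iff)
  then have "\<bar>z\<bar> = 1" by (metis abs_zmult_eq_1 abs_1)
  then show ?thesis unfolding z by linarith
qed

text \<open>Multiplication by u has an integer matrix on a basis of the lattice, so u is a root of
  its monic characteristic polynomial.\<close>

lemma stable_imp_OI:
  assumes v: "valid 1 a b" and u: "u \<in> KK" and sub: "(*) u ` J 1 a b \<subseteq> J 1 a b"
  shows "u \<in> OI"
proof -
  define \<beta> where "\<beta> = of_int b + w"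
  have a: "a > 0" using v by (simp add: valid_def)
  have J: "J 1 a b = spn (of_int (int a)) \<beta>" unfolding J_spn \<beta>_def by simp
  have "u * of_int (int a) \<in> spn (of_int (int a)) \<beta>" "u * \<beta> \<in> spn (of_int (int a)) \<beta>"
    using sub spn_generators[of _ \<beta>] spn_generators(2)[of \<beta> "of_int (int a)"] unfolding J by auto
  then obtain x y z t where
    1: "u * of_int (int a) = of_int x * of_int (int a) + of_int y * \<beta>" and
    2: "u * \<beta> = of_int z * of_int (int a) + of_int t * \<beta>"
    unfolding spn_def by blast
  have "(u - of_int x) * of_int (int a) = of_int y * \<beta>" using 1 by (simp add: algebra_simps)
  then have "(u - of_int x) * (u - of_int t) * of_int (int a) = (u - of_int t) * (of_int y * \<beta>)"
    by (metis mult.assoc mult.left_commute)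
  also have "\<dots> = of_int y * (u * \<beta> - of_int t * \<beta>)" by (simp add: algebra_simps)
  also have "\<dots> = of_int (y * z) * of_int (int a)" unfolding 2 by simp
  finally have "(u - of_int x) * (u - of_int t) = of_int (y * z)" using a by simp
  then have "u * u = of_int (x + t) * u + of_int (y * z - x * t)" by (simp add: algebra_simps)
  then have "algebraic_int u" by (rule algebraic_int_quadratic)
  then show ?thesis using u by (simp add: OI_iff)
qed

lemma image_mult_mult: "(*) (x :: real) ` (*) y ` A = (*) (x * y) ` A"
  by (simp add: image_image mult.assoc)

lemma scaled_eq_imp_unit:
  assumes v: "valid 1 a b" and \<gamma>: "\<gamma> \<in> KK" "\<gamma> \<noteq> 0" and \<delta>: "\<delta> \<in> KK" "\<delta> \<noteq> 0"
    and eq: "(*) \<gamma> ` J 1 a b = (*) \<delta> ` J 1 a b"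
  shows "\<gamma> / \<delta> \<in> UU"
proof -
  have main: "x / y \<in> OI" if "x \<in> KK" "y \<in> KK" "y \<noteq> 0" "(*) x ` J 1 a b = (*) y ` J 1 a b" for x y
  proof (rule stable_imp_OI[OF v])
    show "x / y \<in> KK" using that by (simp add: KK_divide)
    have "(*) (x / y) ` J 1 a b = (*) (1 / y) ` (*) x ` J 1 a b" unfolding image_mult_mult by simp
    also have "\<dots> = (*) (1 / y * y) ` J 1 a b" unfolding that(4) image_mult_mult ..
    also have "\<dots> = J 1 a b" using that(3) by simp
    finally show "(*) (x / y) ` J 1 a b \<subseteq> J 1 a b" by simp
  qed
  have "\<gamma> / \<delta> \<in> OI" "\<delta> / \<gamma> \<in> OI" using main \<gamma> \<delta> eq by simp_all
  moreover have "\<gamma> / \<delta> * (\<delta> / \<gamma>) = 1" using \<gamma> \<delta> by simp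
  ultimately show ?thesis unfolding UU_iff by blast
qed

text \<open>For \<open>E = \<epsilon>\<^sup>2\<close> the inequalities on \<open>\<gamma>\<close> and its conjugate cut out a fundamental domain for the
  action of the units.\<close>

definition sector :: "nat \<Rightarrow> int \<Rightarrow> real \<Rightarrow> nat \<Rightarrow> real set" where
  "sector a b E n = {\<gamma> \<in> KK. (*) \<gamma> ` J 1 a b \<subseteq> OI \<and> 0 < \<gamma> \<and> \<bar>cj \<gamma>\<bar> \<le> \<gamma> \<and> \<gamma> < E * \<bar>cj \<gamma>\<bar> \<and>
    \<gamma> * \<bar>cj \<gamma>\<bar> * real a \<le> real n}"

lemma sector_ideals_upto:
  assumes v: "valid 1 a b" and \<gamma>: "\<gamma> \<in> sector a b E n"
  shows "(*) \<gamma> ` J 1 a b \<in> ideals_upto n"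
proof -
  have g: "\<gamma> \<in> KK" "\<gamma> \<noteq> 0" "(*) \<gamma> ` J 1 a b \<subseteq> OI" "\<gamma> * \<bar>cj \<gamma>\<bar> * real a \<le> real n" "0 < \<gamma>"
    using \<gamma> by (auto simp: sector_def)
  have "real (nrm ((*) \<gamma> ` J 1 a b)) \<le> real n"
    using nrm_scaled[OF v g(1-3)] g(4,5) by (simp add: abs_mult)
  then show ?thesis using scaled_nonzero_ideal[OF v g(2,3)] by (simp add: ideals_upto_def)
qed

text \<open>Norms scale quadratically, so the scaling factor is sqrt ((n + 1) / a). The difference s
  / a of the two slopes cancels the remaining a, and the limit does not depend on the ideal. The
  shift to n + 1 keeps the scaling factor bounded away from 0.\<close>

lemma sector_limit:
  assumes v: "valid 1 a b" and E: "E > 1"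
  shows "finite (sector a b E (Suc n))" "(\<lambda>n. card (sector a b E (Suc n)) / real (Suc n)) \<longlonglongrightarrow> ln E / s"
proof -
  have a: "a > 0" and b: "b \<in> roots a" using v by (auto simp: valid_def)
  have dth: "\<theta>' a b - \<theta> a b = s / real a"
    using w_minus_w' by (simp add: \<theta>_def \<theta>'_def flip: diff_divide_distrib)
  then have th: "\<theta>' a b \<noteq> \<theta> a b" using s_pos a by auto
  define q where "q n = sqrt (real (Suc n) / real a)" for n
  have q2: "(q n)\<^sup>2 = real (Suc n) / real a" for n unfolding q_def by simp
  have q0: "q n > 0" for n unfolding q_def using a by simp
  define S where "S n = {(x :: int, y :: int). ((of_int x + of_int y * \<theta> a b) / q n,
    (of_int x + of_int y * \<theta>' a b) / q n) \<in> hyp_sector E}" for n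
  have qc: "sqrt (1 / real a) \<le> q n" for n
    unfolding q_def by (simp add: divide_right_mono)
  have ql: "filterlim q at_top sequentially"
  proof -
    have "filterlim (\<lambda>n. 1 / real a * real (Suc n)) at_top sequentially"
      using a by (intro filterlim_tendsto_pos_mult_at_top[OF tendsto_const]
          filterlim_compose[OF filterlim_real_sequentially filterlim_Suc]) auto
    then have "filterlim (\<lambda>n. real (Suc n) / real a) at_top sequentially" by simp
    then show ?thesis unfolding q_def by (rule filterlim_compose[OF sqrt_at_top])
  qed
  have lim: "finite (S n)" "(\<lambda>n. card (S n) / (q n)\<^sup>2) \<longlonglongrightarrow> ln E / \<bar>\<theta>' a b - \<theta> a b\<bar>" for n
    unfolding S_def using lattice_points_hyp_sector[OF E th _ qc ql] a by simp_all
  have bij: "bij_betw (\<lambda>(x, y). of_int x + of_int y * \<theta> a b) (S n) (sector a b E (Suc n))" for n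
  proof (rule bij_betw_imageI)
    show "inj_on (\<lambda>(x, y). of_int x + of_int y * \<theta> a b) (S n)"
    proof (rule inj_onI, clarify)
      fix x y x' y' :: int
      assume eq: "of_int x + of_int y * \<theta> a b = of_int x' + of_int y' * \<theta> a b"
      then have "of_int x + of_int y * \<theta>' a b = of_int x' + of_int y' * \<theta>' a b"
        by (metis KK_lattice(2))
      then have "(of_int y - of_int y') * (\<theta>' a b - \<theta> a b) = 0" using eq by (simp add: algebra_simps)
      then have "y = y'" using th by simp
      then show "x = x' \<and> y = y'" using eq by simp
    qed
    have iff: "(u / q n, v / q n) \<in> hyp_sector E \<longleftrightarrow>
        0 < u \<and> \<bar>v\<bar> \<le> u \<and> u < E * \<bar>v\<bar> \<and> u * \<bar>v\<bar> * real a \<le> real (Suc n)" for u v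
    proof -
      have "u / q n * \<bar>v / q n\<bar> = u * \<bar>v\<bar> / (q n)\<^sup>2" using q0[of n] by (simp add: power2_eq_square)
      then have "u / q n * \<bar>v / q n\<bar> \<le> 1 \<longleftrightarrow> u * \<bar>v\<bar> \<le> (q n)\<^sup>2"
        using q0[of n] by (simp only: divide_le_eq_1_pos zero_less_power)
      also have "\<dots> \<longleftrightarrow> u * \<bar>v\<bar> * real a \<le> real (Suc n)"
        unfolding q2 using a by (simp add: pos_le_divide_eq del: of_nat_Suc)
      finally have "u / q n * \<bar>v / q n\<bar> \<le> 1 \<longleftrightarrow> u * \<bar>v\<bar> * real a \<le> real (Suc n)" .
      moreover have "u / q n < E * \<bar>v / q n\<bar> \<longleftrightarrow> u < E * \<bar>v\<bar>" "\<bar>v / q n\<bar> \<le> u / q n \<longleftrightarrow> \<bar>v\<bar> \<le> u"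
        "0 < u / q n \<longleftrightarrow> 0 < u"
      proof -
        have 1: "\<bar>v / q n\<bar> = \<bar>v\<bar> / q n" using q0[of n] by (simp add: abs_divide)
        have 2: "E * (\<bar>v\<bar> / q n) = (E * \<bar>v\<bar>) / q n" by simp
        show "u / q n < E * \<bar>v / q n\<bar> \<longleftrightarrow> u < E * \<bar>v\<bar>" "\<bar>v / q n\<bar> \<le> u / q n \<longleftrightarrow> \<bar>v\<bar> \<le> u"
          "0 < u / q n \<longleftrightarrow> 0 < u"
          unfolding 1 2 using q0[of n] by (simp_all add: divide_less_cancel divide_le_cancel zero_less_divide_iff)
      qed
      ultimately show ?thesis unfolding hyp_sector_def mem_Collect_eq prod.case by blast
    qed
    show "(\<lambda>(x, y). of_int x + of_int y * \<theta> a b) ` S n = sector a b E (Suc n)"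
    proof (intro equalityI subsetI)
      fix \<gamma> assume "\<gamma> \<in> (\<lambda>(x, y). of_int x + of_int y * \<theta> a b) ` S n"
      then obtain x y where xy: "\<gamma> = of_int x + of_int y * \<theta> a b" "(x, y) \<in> S n" by auto
      have g: "\<gamma> \<in> KK" "cj \<gamma> = of_int x + of_int y * \<theta>' a b" unfolding xy(1) by (rule KK_lattice)+
      have "(*) \<gamma> ` J 1 a b \<subseteq> OI" using scaled_subset_iff[OF a b g(1)] xy(1) by blast
      then show "\<gamma> \<in> sector a b E (Suc n)"
        using xy(2) g unfolding S_def sector_def xy(1)[symmetric] g(2)[symmetric] by (simp add: iff xy(1)[symmetric] g(2)[symmetric])
    next
      fix \<gamma> assume \<gamma>: "\<gamma> \<in> sector a b E (Suc n)"
      then have "\<gamma> \<in> KK" "(*) \<gamma> ` J 1 a b \<subseteq> OI" by (auto simp: sector_def)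
      then obtain x y where xy: "\<gamma> = of_int x + of_int y * \<theta> a b" using scaled_subset_iff[OF a b] by blast
      have "cj \<gamma> = of_int x + of_int y * \<theta>' a b" unfolding xy by (rule KK_lattice)
      then have "(x, y) \<in> S n" using \<gamma> unfolding S_def sector_def by (simp add: iff xy[symmetric])
      then show "\<gamma> \<in> (\<lambda>(x, y). of_int x + of_int y * \<theta> a b) ` S n" using xy by force
    qed
  qed
  show "finite (sector a b E (Suc n))" using bij_betw_finite[OF bij] lim(1) by blast
  have "card (sector a b E (Suc n)) = card (S n)" for n using bij_betw_same_card[OF bij] by simp
  then have "card (sector a b E (Suc n)) / real (Suc n) = card (S n) / (q n)\<^sup>2 / real a" for n
    unfolding q2 using a by simp
  moreover have "(\<lambda>n. card (S n) / (q n)\<^sup>2 / real a) \<longlonglongrightarrow> ln E / \<bar>\<theta>' a b - \<theta> a b\<bar> / real a"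
    by (rule tendsto_divide[OF lim(2) tendsto_const]) (use a in simp)
  moreover have "ln E / \<bar>\<theta>' a b - \<theta> a b\<bar> / real a = ln E / s"
    unfolding dth using a s_pos by simp
  ultimately show "(\<lambda>n. card (sector a b E (Suc n)) / real (Suc n)) \<longlonglongrightarrow> ln E / s" by (simp only:)
qed

lemma ideals_upto_limit: "(\<lambda>n. card (ideals_upto (Suc n)) / real (Suc n)) \<longlonglongrightarrow> L1"
proof -
  have "(\<lambda>n. real_of_int (\<Sum>k\<in>{1..n}. \<Sum>d | d dvd k. chi (int d)) / real n) = (\<lambda>n. real (card (ideals_upto n)) / real n)"
    by (simp only: card_ideals_upto(2)[symmetric] of_int_of_nat_eq)
  then have "(\<lambda>n. card (ideals_upto n) / real n) \<longlonglongrightarrow> L1" using sum_divisor_chi_limit by simp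
  then show ?thesis by (rule LIMSEQ_Suc)
qed

section \<open>Existence and uniqueness of the fundamental unit\<close>

lemma ln_power_int_real: "(u :: real) > 0 \<Longrightarrow> ln (u powi k) = of_int k * ln u"
  by (simp add: ln_powr flip: powr_real_of_int')

lemma valid_1_1_0: "valid 1 1 0"
  by (simp add: valid_def roots_def)

text \<open>If \<open>1\<close> and \<open>- 1\<close> were the only units, the lattice points of arbitrarily large sectors would inject
  into the ideals of bounded norm, whose number grows only like \<open>L1\<close> times the bound.\<close>

lemma exists_nontrivial_unit: "\<exists>u\<in>UU. u \<noteq> 1 \<and> u \<noteq> - 1"
proof (rule ccontr)
  assume "\<not> ?thesis"
  then have triv: "u = 1 \<or> u = - 1" if "u \<in> UU" for u using that by blast
  \<comment> \<open>Chosen so that ln E / s = |L1| + 1, which exceeds the density L1 of all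
    ideals.\<close>
  define E where "E = exp (s * (\<bar>L1\<bar> + 1))"
  have E: "E > 1" using s_pos by (simp add: E_def)
  have "card (sector 1 0 E n) \<le> card (ideals_upto n)" for n
  proof (rule card_inj_on_le)
    show "inj_on (\<lambda>\<gamma>. (*) \<gamma> ` J 1 1 0) (sector 1 0 E n)"
    proof (rule inj_onI)
      fix \<gamma> \<delta> assume g: "\<gamma> \<in> sector 1 0 E n" "\<delta> \<in> sector 1 0 E n" "(*) \<gamma> ` J 1 1 0 = (*) \<delta> ` J 1 1 0"
      then have p: "\<gamma> \<in> KK" "\<delta> \<in> KK" "\<gamma> > 0" "\<delta> > 0" by (auto simp: sector_def)
      then have "\<gamma> / \<delta> \<in> UU" using scaled_eq_imp_unit[OF valid_1_1_0] g(3) by simp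
      then have "\<gamma> / \<delta> = 1 \<or> \<gamma> / \<delta> = - 1" by (rule triv)
      moreover have "\<gamma> / \<delta> > 0" using p by simp
      ultimately show "\<gamma> = \<delta>" using p by auto
    qed
    show "(\<lambda>\<gamma>. (*) \<gamma> ` J 1 1 0) ` sector 1 0 E n \<subseteq> ideals_upto n" using sector_ideals_upto[OF valid_1_1_0] by blast
  qed (rule card_ideals_upto)
  then have "card (sector 1 0 E (Suc n)) / real (Suc n) \<le> card (ideals_upto (Suc n)) / real (Suc n)" for n
    by (intro divide_right_mono) auto
  then have "ln E / s \<le> L1"
    using sector_limit(2)[OF valid_1_1_0 E] ideals_upto_limit by (intro LIMSEQ_le) auto
  then have "\<bar>L1\<bar> + 1 \<le> L1" using s_pos by (simp add: E_def)
  then show False by linarith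
qed

lemma exists_unit_gt_1: "\<exists>u\<in>UU. u > 1"
proof -
  obtain u where u: "u \<in> UU" "u \<noteq> 1" "u \<noteq> - 1" using exists_nontrivial_unit by blast
  define v where "v = \<bar>u\<bar>"
  have v: "v \<in> UU" "v > 0" "v \<noteq> 1" using u UU_uminus[of u] UU_nz[of u] by (auto simp: v_def abs_if)
  show ?thesis
  proof (cases "v > 1")
    case True
    then show ?thesis using v by blast
  next
    case False
    then have "inverse v > 1" using v by (simp add: one_less_inverse_iff)
    then show ?thesis using UU_inverse[OF v(1)] by blast
  qed
qed

text \<open>The conjugate of such a unit has absolute value less than 1, so its sum and difference
  with the unit are bounded, and with them both coordinates.\<close>

lemma finite_units_le: "finite {u\<in>UU. 1 < u \<and> u \<le> B}"
proof (rule finite_subset)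
  define N where "N = \<lceil>B\<rceil> + 1"
  show "{u\<in>UU. 1 < u \<and> u \<le> B} \<subseteq> (\<lambda>(x, y). el x y) ` ({-N..N} \<times> {-N..N})"
  proof
    fix u assume "u \<in> {u\<in>UU. 1 < u \<and> u \<le> B}"
    then have u: "u \<in> UU" "1 < u" "u \<le> B" by auto
    then obtain x y where xy: "u = el x y" by (auto simp: UU_iff elim: OI_E)
    have "u * \<bar>cj u\<bar> = 1" using UU_norm[OF u(1)] u(2) by (simp add: abs_mult)
    then have "\<bar>cj u\<bar> = 1 / u" using u(2) by (simp add: field_simps)
    then have c: "\<bar>cj u\<bar> < 1" using u(2) by simp
    have c1: "u - cj u = of_int y * s" unfolding xy KK_el(2) w_minus_w'[symmetric] by (simp add: el_def algebra_simps)
    have "u + cj u = 2 * of_int x + of_int y * (w + w')" unfolding xy KK_el(2) by (simp add: el_def algebra_simps)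
    then have c2: "u + cj u = 2 * of_int x + of_int y" unfolding w_add_w' by simp
    have "1 \<le> s" using p_gt_2 by simp
    then have "\<bar>of_int y :: real\<bar> * 1 \<le> \<bar>of_int y\<bar> * s" by (intro mult_left_mono) auto
    also have "\<dots> = \<bar>u - cj u\<bar>" unfolding c1 using s_pos by (simp add: abs_mult)
    also have "\<dots> \<le> B + 1" using u c by linarith
    finally have y: "\<bar>of_int y :: real\<bar> \<le> B + 1" by simp
    have "real_of_int y \<le> B + 1" "- (B + 1) \<le> real_of_int y" "cj u < 1" "- 1 < cj u"
      using y c by (simp_all add: abs_le_iff abs_less_iff)
    then have "real_of_int x \<le> B + 1" "- (B + 1) \<le> real_of_int x"
      using c2 u(2,3) by (simp_all add: field_simps)
    then have x: "\<bar>of_int x :: real\<bar> \<le> B + 1" by (simp add: abs_le_iff)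
    have "x \<in> {-N..N}" "y \<in> {-N..N}" using x y unfolding N_def by (auto; linarith)+
    then show "u \<in> (\<lambda>(x, y). el x y) ` ({-N..N} \<times> {-N..N})" unfolding xy by force
  qed
qed auto

text \<open>The property under the description in \<open>fundamental_unit\<close>, named so that
  existence and uniqueness can be proved first.\<close>

definition is_fund :: "real \<Rightarrow> bool" where
  "is_fund u \<longleftrightarrow> u \<in> UU \<and> u > 1 \<and> (\<forall>v\<in>UU. \<exists>k::int. v = u powi k \<or> v = - (u powi k))"

text \<open>The least unit u above 1 generates the positive units: dividing by the power of u given
  by the integer part of a quotient of logarithms leaves a unit in [1, u), which must be 1.\<close>

lemma exists_fund: "\<exists>u. is_fund u"
proof -
  obtain u0 where u0: "u0 \<in> UU" "u0 > 1" using exists_unit_gt_1 by blast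
  define A where "A = {u\<in>UU. 1 < u \<and> u \<le> u0}"
  have A: "finite A" "A \<noteq> {}" using finite_units_le[of u0] u0 by (auto simp: A_def)
  define u where "u = Min A"
  have uA: "u \<in> A" unfolding u_def using A by (rule Min_in)
  have min: "u \<le> v" if "v \<in> UU" "v > 1" for v
  proof (cases "v \<le> u0")
    case True
    then show ?thesis unfolding u_def using A that by (intro Min_le) (auto simp: A_def)
  next
    case False
    then show ?thesis using uA by (auto simp: A_def)
  qed
  have u: "u \<in> UU" "u > 1" using uA by (auto simp: A_def)
  have pos: "\<exists>k::int. v = u powi k" if v: "v \<in> UU" "v > 0" for v
  proof -
    define k where "k = \<lfloor>ln v / ln u\<rfloor>"
    have lu: "ln u > 0" using u by simp
    have "of_int k \<le> ln v / ln u" "ln v / ln u < of_int k + 1" unfolding k_def by linarith+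
    then have k: "of_int k * ln u \<le> ln v" "ln v < (of_int k + 1) * ln u"
      using lu by (simp_all add: pos_le_divide_eq pos_divide_less_eq)
    define x where "x = v * u powi (- k)"
    have x: "x \<in> UU" "x > 0" using v u UU_mult UU_power_int by (simp_all add: x_def)
    have "ln (u powi (- k)) = - of_int k * ln u"
      using ln_power_int_real[of u "- k"] u by simp
    then have "ln x = ln v - of_int k * ln u" using v u by (simp add: x_def ln_mult)
    then have "0 \<le> ln x" "ln x < ln u" using k by (simp_all add: algebra_simps)
    then have "1 \<le> x" "x < u" using x u by simp_all
    then have "x = 1" using min[OF x(1)] by linarith
    then have "v * (u powi (- k) * u powi k) = u powi k" unfolding x_def by (simp add: mult.assoc[symmetric])
    then have "v = u powi k" using u by (simp add: power_int_minus)
    then show ?thesis by blast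
  qed
  have "\<exists>k::int. v = u powi k \<or> v = - (u powi k)" if v: "v \<in> UU" for v
  proof (cases "v > 0")
    case True
    then show ?thesis using pos v by blast
  next
    case False
    then have "- v > 0" using UU_nz[OF v] by simp
    then obtain k :: int where "- v = u powi k" using pos UU_uminus[OF v] by blast
    then have "v = - (u powi k)" by simp
    then show ?thesis by blast
  qed
  then show ?thesis using u by (auto simp: is_fund_def)
qed

lemma powi_gt_1_imp:
  fixes u :: real
  assumes "u > 1" "u powi k > 1"
  shows "k \<ge> 1"
proof (rule ccontr)
  assume "\<not> k \<ge> 1"
  then have "u powi k \<le> u powi 0" using assms by (intro power_int_increasing) auto
  then show False using assms by simp
qed

lemma fund_unique:
  assumes "is_fund u" "is_fund v"
  shows "u = v"
proof -
  have le: "u \<le> v" if uv: "is_fund u" "is_fund v" for u v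
  proof -
    have u: "u > 1" and v: "v > 1" "v \<in> UU" using uv by (auto simp: is_fund_def)
    obtain k :: int where k: "v = u powi k \<or> v = - (u powi k)" using uv(1) v unfolding is_fund_def by blast
    have "u powi k > 0" using u by simp
    then have vk: "v = u powi k" using k v by linarith
    then have "k \<ge> 1" using powi_gt_1_imp[OF u, of k] v by simp
    then have "u powi 1 \<le> u powi k" using u by (intro power_int_increasing) auto
    then show ?thesis using vk by simp
  qed
  show ?thesis using le[OF assms] le[OF assms(2,1)] by simp
qed

definition \<epsilon> :: real where "\<epsilon> = fundamental_unit p"

lemma fund_eps: "is_fund \<epsilon>"
proof -
  have "\<exists>!u. is_fund u" using exists_fund fund_unique by blast
  then have "is_fund (THE u. is_fund u)" by (rule theI')
  then show ?thesis by (simp add: \<epsilon>_def fundamental_unit_def is_fund_def)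
qed

lemma eps: "\<epsilon> \<in> UU" "\<epsilon> > 1" "\<epsilon> \<in> KK"
  using fund_eps UU_KK by (auto simp: is_fund_def)

lemma eps_units: "v \<in> UU \<Longrightarrow> v > 0 \<Longrightarrow> \<exists>k::int. v = \<epsilon> powi k"
proof -
  assume v: "v \<in> UU" "v > 0"
  then obtain k :: int where k: "v = \<epsilon> powi k \<or> v = - (\<epsilon> powi k)" using fund_eps by (auto simp: is_fund_def)
  have "\<epsilon> powi k > 0" using eps by simp
  then have "v = \<epsilon> powi k" using k v by linarith
  then show ?thesis by blast
qed

section \<open>Ideal classes and their densities\<close>

lemma equiv_class_rel: "equiv (nonzero_ideals p) (ideal_class_rel p)"
proof (rule equivI)
  show "ideal_class_rel p \<subseteq> nonzero_ideals p \<times> nonzero_ideals p" by (auto simp: ideal_class_rel_def)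
  show "refl_on (nonzero_ideals p) (ideal_class_rel p)"
  proof (rule refl_onI)
    fix I assume "I \<in> nonzero_ideals p"
    then show "(I, I) \<in> ideal_class_rel p"
      unfolding ideal_class_rel_def using OI_closed(6) by (auto intro!: bexI[of _ 1])
  qed
  show "sym (ideal_class_rel p)"
  proof (rule symI)
    fix I J assume "(I, J) \<in> ideal_class_rel p"
    then obtain a b where "I \<in> nonzero_ideals p" "J \<in> nonzero_ideals p"
      "a \<in> OI - {0}" "b \<in> OI - {0}" "(*) b ` J = (*) a ` I"
      unfolding ideal_class_rel_def by blast
    then show "(J, I) \<in> ideal_class_rel p" unfolding ideal_class_rel_def by blast
  qed
  show "trans (ideal_class_rel p)"
  proof (rule transI)
    fix I J M assume IJ: "(I, J) \<in> ideal_class_rel p" and JM: "(J, M) \<in> ideal_class_rel p"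
    obtain a b where ab: "a \<in> OI - {0}" "b \<in> OI - {0}" "(*) a ` I = (*) b ` J"
      using IJ unfolding ideal_class_rel_def by blast
    obtain c d where cd: "c \<in> OI - {0}" "d \<in> OI - {0}" "(*) c ` J = (*) d ` M"
      using JM unfolding ideal_class_rel_def by blast
    have "(*) (c * a) ` I = (*) c ` (*) b ` J" unfolding ab(3)[symmetric] image_mult_mult ..
    also have "\<dots> = (*) b ` (*) c ` J" unfolding image_mult_mult by (simp add: mult.commute)
    also have "\<dots> = (*) (b * d) ` M" unfolding cd(3) image_mult_mult ..
    finally have "(*) (c * a) ` I = (*) (b * d) ` M" .
    moreover have "c * a \<in> OI - {0}" "b * d \<in> OI - {0}" using ab cd by (auto simp: OI_closed)
    ultimately show "(I, M) \<in> ideal_class_rel p"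
      using IJ JM unfolding ideal_class_rel_def by blast
  qed
qed

lemma J_nonzero_ideal: "valid d a b \<Longrightarrow> J d a b \<in> nonzero_ideals p"
  using J_ideal by (simp add: nonzero_ideals_iff)

text \<open>The quotient of the two integral factors in the class relation is \<gamma>; conversely a
  denominator of \<gamma> recovers such factors. The lattice count works with the single field
  element.\<close>

lemma class_rel_J_iff:
  assumes v: "valid 1 a b" and I: "I \<in> nonzero_ideals p"
  shows "(J 1 a b, I) \<in> ideal_class_rel p \<longleftrightarrow> (\<exists>\<gamma>\<in>KK. \<gamma> \<noteq> 0 \<and> I = (*) \<gamma> ` J 1 a b)"
proof
  assume "(J 1 a b, I) \<in> ideal_class_rel p"
  then obtain c d where cd: "c \<in> OI - {0}" "d \<in> OI - {0}" "(*) c ` J 1 a b = (*) d ` I"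
    unfolding ideal_class_rel_def by blast
  have "(*) (c / d) ` J 1 a b = (*) (1 / d) ` (*) c ` J 1 a b" unfolding image_mult_mult by simp
  also have "\<dots> = (*) (1 / d * d) ` I" unfolding cd(3) image_mult_mult ..
  also have "\<dots> = I" using cd by simp
  finally have "I = (*) (c / d) ` J 1 a b" ..
  moreover have "c / d \<in> KK" "c / d \<noteq> 0" using cd by (auto simp: OI_iff KK_divide)
  ultimately show "\<exists>\<gamma>\<in>KK. \<gamma> \<noteq> 0 \<and> I = (*) \<gamma> ` J 1 a b" by blast
next
  assume "\<exists>\<gamma>\<in>KK. \<gamma> \<noteq> 0 \<and> I = (*) \<gamma> ` J 1 a b"
  then obtain \<gamma> where \<gamma>: "\<gamma> \<in> KK" "\<gamma> \<noteq> 0" "I = (*) \<gamma> ` J 1 a b" by blast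
  obtain d x y where d: "d > 0" "of_int d * \<gamma> = of_int x + of_int y * s" using KK_denominator[OF \<gamma>(1)] .
  have "of_int d * \<gamma> = el (x - y) (2 * y)" unfolding d(2) by (simp add: el_def w_def algebra_simps)
  then have "of_int d * \<gamma> \<in> OI - {0}" using d(1) \<gamma>(2) by auto
  moreover have "of_int d \<in> OI - {0}" using d(1) by (simp add: OI_closed)
  moreover have "(*) (of_int d * \<gamma>) ` J 1 a b = (*) (of_int d) ` I"
    unfolding \<gamma>(3) image_mult_mult ..
  ultimately show "(J 1 a b, I) \<in> ideal_class_rel p"
    unfolding ideal_class_rel_def using I J_nonzero_ideal[OF v] by blast
qed

text \<open>The factor d of a normal form is principal, so each class contains an ideal with d =
  1.\<close>

lemma class_representative:
  assumes "C \<in> nonzero_ideals p // ideal_class_rel p"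
  obtains a b where "valid 1 a b" "C = ideal_class_rel p `` {J 1 a b}"
proof -
  obtain I where I: "I \<in> nonzero_ideals p" "C = ideal_class_rel p `` {I}"
    using assms by (auto elim: quotientE)
  then obtain d a b where dab: "valid d a b" "I = J d a b" using ideal_structure by (metis nonzero_ideals_iff)
  then have v: "valid 1 a b" and d: "d > 0" by (auto simp: valid_def)
  have "J d a b = (*) (of_int (int d)) ` J 1 a b" unfolding J_spn image_mult_spn by simp
  then have "\<exists>\<gamma>\<in>KK. \<gamma> \<noteq> 0 \<and> I = (*) \<gamma> ` J 1 a b"
    unfolding dab(2) using d KK_of_int(1)[of "int d"] by (intro bexI[of _ "of_int (int d)"]) auto
  then have "(J 1 a b, I) \<in> ideal_class_rel p" using class_rel_J_iff[OF v I(1)] by blast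
  then have "ideal_class_rel p `` {J 1 a b} = C" unfolding I(2) by (rule equiv_class_eq[OF equiv_class_rel])
  then show ?thesis using that v by blast
qed

text \<open>An ideal of the class determines \<gamma> up to a unit. The sign is fixed by \<gamma> >
  0, and multiplication by \<open>\<epsilon> powi k\<close> changes the ratio of \<gamma> to its
  conjugate, in absolute value, by \<open>\<epsilon> powi (2 * k)\<close>; so exactly one choice has
  its ratio in the interval from 1 to \<open>\<epsilon>\<^sup>2\<close>, right end excluded.\<close>

lemma class_ideals_upto_bij:
  assumes v: "valid 1 a b"
  shows "bij_betw (\<lambda>\<gamma>. (*) \<gamma> ` J 1 a b) (sector a b (\<epsilon>\<^sup>2) n) (ideal_class_rel p `` {J 1 a b} \<inter> ideals_upto n)"
proof (rule bij_betw_imageI)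
  \<comment> \<open>A unit has norm 1 or -1, so its conjugate is its inverse up to sign.\<close>
  have ratio: "\<bar>\<epsilon> powi k\<bar> = \<epsilon> powi (2 * k) * \<bar>cj (\<epsilon> powi k)\<bar>" for k
  proof -
    have "\<epsilon> powi k \<in> UU" using eps UU_power_int by blast
    then have n: "\<epsilon> powi k * \<bar>cj (\<epsilon> powi k)\<bar> = 1" using UU_norm[of "\<epsilon> powi k"] eps by (simp add: abs_mult)
    have "\<epsilon> powi (2 * k) = \<epsilon> powi (k + k)" by (simp only: mult_2)
    also have "\<dots> = \<epsilon> powi k * \<epsilon> powi k" using eps by (intro power_int_add) auto
    finally have "\<epsilon> powi (2 * k) * \<bar>cj (\<epsilon> powi k)\<bar> = \<epsilon> powi k"
      by (simp only: mult.assoc n mult_1_right)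
    then show ?thesis using eps by simp
  qed
  show "inj_on (\<lambda>\<gamma>. (*) \<gamma> ` J 1 a b) (sector a b (\<epsilon>\<^sup>2) n)"
  proof (rule inj_onI)
    fix \<gamma> \<delta> assume g: "\<gamma> \<in> sector a b (\<epsilon>\<^sup>2) n" "\<delta> \<in> sector a b (\<epsilon>\<^sup>2) n" "(*) \<gamma> ` J 1 a b = (*) \<delta> ` J 1 a b"
    have K: "\<gamma> \<in> KK" "\<gamma> > 0" "\<bar>cj \<gamma>\<bar> \<le> \<gamma>" "\<gamma> < \<epsilon>\<^sup>2 * \<bar>cj \<gamma>\<bar>"
      "\<delta> \<in> KK" "\<delta> > 0" "\<bar>cj \<delta>\<bar> \<le> \<delta>" "\<delta> < \<epsilon>\<^sup>2 * \<bar>cj \<delta>\<bar>"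
      using g by (auto simp: sector_def)
    then have "\<gamma> / \<delta> \<in> UU" "\<gamma> / \<delta> > 0" using scaled_eq_imp_unit[OF v] g(3) by simp_all
    then obtain k :: int where k: "\<gamma> / \<delta> = \<epsilon> powi k" using eps_units by blast
    have le: "k \<le> 0" if K: "\<gamma> \<in> KK" "\<gamma> < \<epsilon>\<^sup>2 * \<bar>cj \<gamma>\<bar>"
      "\<delta> \<in> KK" "\<delta> > 0" "\<bar>cj \<delta>\<bar> \<le> \<delta>" and k: "\<gamma> / \<delta> = \<epsilon> powi k" for \<gamma> \<delta> k
    proof (rule ccontr)
      assume "\<not> k \<le> 0"
      then have "\<epsilon> powi 2 \<le> \<epsilon> powi (2 * k)" using eps by (intro power_int_increasing) auto
      then have e2: "\<epsilon>\<^sup>2 \<le> \<epsilon> powi (2 * k)" by simp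
      have \<gamma>: "\<gamma> = \<epsilon> powi k * \<delta>" using k K by (simp add: field_simps)
      have "\<epsilon> powi k \<in> KK" using eps UU_power_int UU_KK by blast
      then have cg: "cj \<gamma> = cj (\<epsilon> powi k) * cj \<delta>" unfolding \<gamma> using K by (simp add: KK_mult)
      have "\<epsilon>\<^sup>2 * \<bar>cj \<gamma>\<bar> \<le> \<epsilon> powi (2 * k) * \<bar>cj \<gamma>\<bar>" using e2 by (rule mult_right_mono) simp
      also have "\<dots> = \<bar>\<epsilon> powi k\<bar> * \<bar>cj \<delta>\<bar>" unfolding cg ratio[of k] by (simp add: abs_mult)
      also have "\<dots> \<le> \<epsilon> powi k * \<delta>" using K eps by (simp add: mult_left_mono)
      also have "\<dots> = \<gamma>" using \<gamma> by simp
      finally show False using K(2) by linarith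
    qed
    have "k \<le> 0" using le[OF K(1,4,5,6,7) k] .
    moreover have "\<delta> / \<gamma> = \<epsilon> powi (- k)" using k by (simp add: power_int_minus flip: k)
    then have "- k \<le> 0" using le[of \<delta> \<gamma> "- k"] K by blast
    ultimately have "k = 0" by simp
    then show "\<gamma> = \<delta>" using k K by simp
  qed
  show "(\<lambda>\<gamma>. (*) \<gamma> ` J 1 a b) ` sector a b (\<epsilon>\<^sup>2) n = ideal_class_rel p `` {J 1 a b} \<inter> ideals_upto n"
  proof (intro equalityI subsetI)
    fix I assume "I \<in> (\<lambda>\<gamma>. (*) \<gamma> ` J 1 a b) ` sector a b (\<epsilon>\<^sup>2) n"
    then obtain \<gamma> where \<gamma>: "I = (*) \<gamma> ` J 1 a b" "\<gamma> \<in> sector a b (\<epsilon>\<^sup>2) n" by blast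
    then have "I \<in> ideals_upto n" using sector_ideals_upto[OF v] by blast
    moreover have "(J 1 a b, I) \<in> ideal_class_rel p"
      using \<gamma> \<open>I \<in> ideals_upto n\<close> by (subst class_rel_J_iff[OF v]) (auto simp: ideals_upto_def sector_def intro!: bexI[of _ \<gamma>])
    ultimately show "I \<in> ideal_class_rel p `` {J 1 a b} \<inter> ideals_upto n" by blast
  next
    fix I assume I: "I \<in> ideal_class_rel p `` {J 1 a b} \<inter> ideals_upto n"
    then have nz: "I \<in> nonzero_ideals p" "nrm I \<le> n" by (auto simp: ideals_upto_def)
    then obtain \<gamma>0 where \<gamma>0: "\<gamma>0 \<in> KK" "\<gamma>0 \<noteq> 0" "I = (*) \<gamma>0 ` J 1 a b"
      using I class_rel_J_iff[OF v] by blast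
    have IO: "I \<subseteq> OI" using nz by (simp add: nonzero_ideals_iff is_ideal_def)
    define t where "t = \<bar>\<gamma>0\<bar> / \<bar>cj \<gamma>0\<bar>"
    have c0: "\<bar>cj \<gamma>0\<bar> > 0" using \<gamma>0 cj_eq_0_iff by simp
    have t: "t > 0" using \<gamma>0 c0 by (simp add: t_def)
    \<comment> \<open>The number of factors \<open>\<epsilon>\<^sup>2\<close> to be split off from
      the ratio t.\<close>
    define k where "k = \<lfloor>ln t / (2 * ln \<epsilon>)\<rfloor>"
    have lu: "2 * ln \<epsilon> > 0" using eps by simp
    have "of_int k \<le> ln t / (2 * ln \<epsilon>)" "ln t / (2 * ln \<epsilon>) < of_int k + 1" unfolding k_def by linarith+
    then have "of_int k * (2 * ln \<epsilon>) \<le> ln t" "ln t < (of_int k + 1) * (2 * ln \<epsilon>)"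
      using lu by (simp_all add: pos_le_divide_eq pos_divide_less_eq)
    moreover have "ln (\<epsilon> powi (2 * k)) = of_int k * (2 * ln \<epsilon>)" "ln (\<epsilon>\<^sup>2 * \<epsilon> powi (2 * k)) = (of_int k + 1) * (2 * ln \<epsilon>)"
      using eps by (simp_all add: ln_power_int_real ln_mult ln_realpow algebra_simps)
    ultimately have "ln (\<epsilon> powi (2 * k)) \<le> ln t" "ln t < ln (\<epsilon>\<^sup>2 * \<epsilon> powi (2 * k))" by simp_all
    then have tk: "\<epsilon> powi (2 * k) \<le> t" "t < \<epsilon>\<^sup>2 * \<epsilon> powi (2 * k)"
      using t eps by simp_all
    \<comment> \<open>The power of \<epsilon> moves the ratio into the fundamental interval, and the
      sign makes \<gamma> positive.\<close>
    define \<eta> where "\<eta> = (if \<gamma>0 > 0 then \<epsilon> powi (- k) else - (\<epsilon> powi (- k)))"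
    have \<eta>: "\<eta> \<in> UU" using eps UU_power_int UU_uminus by (simp add: \<eta>_def)
    have \<eta>K: "\<eta> \<in> KK" "\<eta> \<noteq> 0" using \<eta> UU_KK UU_nz by auto
    define \<gamma> where "\<gamma> = \<eta> * \<gamma>0"
    have \<gamma>: "\<gamma> \<in> KK" "cj \<gamma> = cj \<eta> * cj \<gamma>0" using \<eta>K \<gamma>0 by (simp_all add: \<gamma>_def KK_mult)
    have "\<epsilon> powi (- k) > 0" using eps by simp
    then have \<gamma>pos: "\<gamma> > 0"
      using \<gamma>0(2) by (auto simp: \<gamma>_def \<eta>_def mult_pos_neg not_less order_le_less)
    have "(*) \<gamma> ` J 1 a b = (*) \<eta> ` I" unfolding \<gamma>_def \<gamma>0(3) image_mult_mult ..
    also have "\<dots> = I"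
    proof
      have "(*) u ` I \<subseteq> I" if "u \<in> UU" for u
        using that nz by (auto simp: UU_iff nonzero_ideals_iff is_ideal_def)
      from this[OF \<eta>] show "(*) \<eta> ` I \<subseteq> I" .
      have "(*) (inverse \<eta>) ` I \<subseteq> I" using \<open>\<And>u. u \<in> UU \<Longrightarrow> (*) u ` I \<subseteq> I\<close> UU_inverse[OF \<eta>] by blast
      then have "(*) \<eta> ` (*) (inverse \<eta>) ` I \<subseteq> (*) \<eta> ` I" by (rule image_mono)
      then show "I \<subseteq> (*) \<eta> ` I" using \<eta>K by (simp add: image_mult_mult)
    qed
    finally have \<gamma>I: "(*) \<gamma> ` J 1 a b = I" .
    have abs_eq: "\<bar>\<gamma>\<bar> = \<epsilon> powi (- 2 * k) * t * \<bar>cj \<gamma>\<bar>"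
    proof -
      have "\<bar>\<eta>\<bar> = \<epsilon> powi (2 * (- k)) * \<bar>cj \<eta>\<bar>"
      proof (cases "\<gamma>0 > 0")
        case True
        then show ?thesis using ratio[of "- k"] by (simp add: \<eta>_def)
      next
        case False
        have "\<epsilon> powi (- k) \<in> KK" using eps UU_power_int UU_KK by blast
        then show ?thesis using ratio[of "- k"] False by (simp add: \<eta>_def KK_uminus)
      qed
      moreover have "\<bar>\<gamma>0\<bar> = t * \<bar>cj \<gamma>0\<bar>" using c0 by (simp add: t_def)
      ultimately have "\<bar>\<eta>\<bar> * \<bar>\<gamma>0\<bar> = \<epsilon> powi (- 2 * k) * \<bar>cj \<eta>\<bar> * (t * \<bar>cj \<gamma>0\<bar>)" by simp
      then show ?thesis unfolding \<gamma>(2) by (simp add: \<gamma>_def abs_mult mult_ac)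
    qed
    have inv: "\<epsilon> powi (- 2 * k) * \<epsilon> powi (2 * k) = 1" using eps by (simp add: power_int_minus)
    have e0: "\<epsilon> powi (- 2 * k) > 0" using eps by simp
    have "\<epsilon> powi (- 2 * k) * \<epsilon> powi (2 * k) \<le> \<epsilon> powi (- 2 * k) * t" using tk(1) e0 by (intro mult_left_mono) auto
    then have r1: "1 \<le> \<epsilon> powi (- 2 * k) * t" using inv by simp
    have "\<epsilon> powi (- 2 * k) * t < \<epsilon> powi (- 2 * k) * (\<epsilon>\<^sup>2 * \<epsilon> powi (2 * k))" using tk(2) e0 by (intro mult_strict_left_mono) auto
    also have "\<dots> = \<epsilon>\<^sup>2 * (\<epsilon> powi (- 2 * k) * \<epsilon> powi (2 * k))" by (simp only: mult_ac)
    finally have r2: "\<epsilon> powi (- 2 * k) * t < \<epsilon>\<^sup>2" unfolding inv by simp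
    have cpos: "\<bar>cj \<gamma>\<bar> > 0" using \<gamma> \<gamma>pos cj_eq_0_iff by auto
    have "1 * \<bar>cj \<gamma>\<bar> \<le> \<epsilon> powi (- 2 * k) * t * \<bar>cj \<gamma>\<bar>" using r1 by (intro mult_right_mono) auto
    then have "\<bar>cj \<gamma>\<bar> \<le> \<gamma>" using abs_eq \<gamma>pos by simp
    moreover have "\<epsilon> powi (- 2 * k) * t * \<bar>cj \<gamma>\<bar> < \<epsilon>\<^sup>2 * \<bar>cj \<gamma>\<bar>" using r2 cpos by (intro mult_strict_right_mono) auto
    then have "\<gamma> < \<epsilon>\<^sup>2 * \<bar>cj \<gamma>\<bar>" using abs_eq \<gamma>pos by simp
    moreover have "\<gamma> * \<bar>cj \<gamma>\<bar> * real a \<le> real n"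
    proof -
      have "real (nrm I) = \<bar>\<gamma> * cj \<gamma>\<bar> * real a"
        using nrm_scaled[OF v \<gamma>(1)] \<gamma>pos \<gamma>I IO by simp
      then show ?thesis using nz(2) \<gamma>pos by (simp add: abs_mult)
    qed
    ultimately have "\<gamma> \<in> sector a b (\<epsilon>\<^sup>2) n" using \<gamma>(1) \<gamma>pos \<gamma>I IO by (simp add: sector_def)
    then show "I \<in> (\<lambda>\<gamma>. (*) \<gamma> ` J 1 a b) ` sector a b (\<epsilon>\<^sup>2) n" using \<gamma>I by blast
  qed
qed

lemma class_limit:
  assumes "C \<in> nonzero_ideals p // ideal_class_rel p"
  shows "(\<lambda>n. card (C \<inter> ideals_upto (Suc n)) / real (Suc n)) \<longlonglongrightarrow> 2 * ln \<epsilon> / s"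
proof -
  obtain a b where ab: "valid 1 a b" "C = ideal_class_rel p `` {J 1 a b}"
    using class_representative[OF assms] .
  have "card (C \<inter> ideals_upto n) = card (sector a b (\<epsilon>\<^sup>2) n)" for n
    using bij_betw_same_card[OF class_ideals_upto_bij[OF ab(1), of n]] ab(2) by simp
  moreover have "\<epsilon>\<^sup>2 > 1" using eps by simp
  moreover have "ln (\<epsilon>\<^sup>2) = 2 * ln \<epsilon>" using eps by (simp add: ln_realpow)
  ultimately show ?thesis using sector_limit(2)[OF ab(1), of "\<epsilon>\<^sup>2"] by simp
qed

text \<open>All classes have the same positive density \<kappa>, and since they are disjoint,
  finitely many of them have total density at most L1. This bounds every finite set of classes, so
  the class group is finite; only then can the densities be summed over all classes. Without
  finiteness \<open>card\<close> would return 0.\<close>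

lemma class_number_formula: "real (class_number p) * (2 * ln \<epsilon>) = s * L1"
proof -
  define Q where "Q = nonzero_ideals p // ideal_class_rel p"
  define \<kappa> where "\<kappa> = 2 * ln \<epsilon> / s"
  have \<kappa>: "\<kappa> > 0" using eps s_pos by (simp add: \<kappa>_def)
  have lim: "(\<lambda>n. real (\<Sum>C\<in>F. card (C \<inter> ideals_upto (Suc n))) / real (Suc n)) \<longlonglongrightarrow> real (card F) * \<kappa>" if "F \<subseteq> Q" for F
  proof -
    have "(\<lambda>n. \<Sum>C\<in>F. card (C \<inter> ideals_upto (Suc n)) / real (Suc n)) \<longlonglongrightarrow> (\<Sum>C\<in>F. \<kappa>)"
      unfolding \<kappa>_def using that by (intro tendsto_sum class_limit) (auto simp: Q_def)
    then show ?thesis by (simp add: sum_divide_distrib)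
  qed
  have disj: "C \<inter> ideals_upto n \<inter> (C' \<inter> ideals_upto n) = {}" if "C \<in> Q" "C' \<in> Q" "C \<noteq> C'" for C C' n
    using quotient_disj[OF equiv_class_rel, of C C'] that by (auto simp: Q_def)
  have card_Un: "(\<Sum>C\<in>F. card (C \<inter> ideals_upto n)) = card (\<Union>C\<in>F. C \<inter> ideals_upto n)" if "F \<subseteq> Q" "finite F" for F n
  proof (rule card_UN_disjoint[symmetric])
    show "finite F" by fact
    show "\<forall>C\<in>F. finite (C \<inter> ideals_upto n)" using card_ideals_upto(1) by simp
    show "\<forall>C\<in>F. \<forall>C'\<in>F. C \<noteq> C' \<longrightarrow> C \<inter> ideals_upto n \<inter> (C' \<inter> ideals_upto n) = {}" using disj that(1) by blast
  qed
  have bound: "real (card F) * \<kappa> \<le> L1" if F: "F \<subseteq> Q" "finite F" for F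
  proof -
    have "(\<Sum>C\<in>F. card (C \<inter> ideals_upto n)) \<le> card (ideals_upto n)" for n
      unfolding card_Un[OF F] by (rule card_mono[OF card_ideals_upto(1)]) auto
    then have "real (\<Sum>C\<in>F. card (C \<inter> ideals_upto (Suc n))) / real (Suc n) \<le> card (ideals_upto (Suc n)) / real (Suc n)" for n
      by (intro divide_right_mono) (auto simp only: of_nat_le_iff of_nat_0_le_iff)
    then show ?thesis using lim[OF F(1)] ideals_upto_limit by (intro LIMSEQ_le) auto
  qed
  have fin: "finite Q"
  proof (rule ccontr)
    assume inf: "infinite Q"
    obtain N :: nat where N: "L1 / \<kappa> < real N" using reals_Archimedean2 by blast
    obtain F where F: "F \<subseteq> Q" "finite F" "card F = N" using infinite_arbitrarily_large[OF inf, of N] by blast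
    then show False using bound[OF F(1,2)] N \<kappa> by (simp add: field_simps)
  qed
  have "(\<Union>C\<in>Q. C \<inter> ideals_upto n) = ideals_upto n" for n
    using Union_quotient[OF equiv_class_rel] by (auto simp: Q_def ideals_upto_def)
  then have "(\<Sum>C\<in>Q. card (C \<inter> ideals_upto n)) = card (ideals_upto n)" for n using card_Un[of Q n] fin by simp
  then have "(\<lambda>n. card (ideals_upto (Suc n)) / real (Suc n)) \<longlonglongrightarrow> real (card Q) * \<kappa>" using lim[of Q] by simp
  then have "real (card Q) * \<kappa> = L1" using ideals_upto_limit by (rule LIMSEQ_unique)
  then show ?thesis using s_pos by (simp add: class_number_def Q_def \<kappa>_def field_simps)
qed

text \<open>p / FR^2 is the square of sqrt p / FR, which absorbs the factor 2 of the class number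
  formula; \<open>ln\<close> is then cancelled.\<close>

lemma eps_power_class_number:
  assumes \<zeta>: "prime_root p \<zeta>" "prime_root.g p \<zeta> = of_real s"
  shows "\<epsilon> ^ class_number p = s / prime_root.FR p \<zeta>"
proof -
  interpret prime_root p \<zeta> by (rule \<zeta>(1))
  have "2 * ln (\<epsilon> ^ class_number p) = real (class_number p) * (2 * ln \<epsilon>)"
    using eps by (simp add: ln_realpow)
  also have "\<dots> = ln (real p / FR\<^sup>2)"
    using class_number_formula sqrt_p_L1_eq_ln[OF \<zeta>(2)] by simp
  also have "real p / FR\<^sup>2 = (s / FR)\<^sup>2" by (simp add: power_divide)
  also have "ln \<dots> = 2 * ln (s / FR)" using FR_pos s_pos by (simp add: ln_realpow)
  finally have "ln (\<epsilon> ^ class_number p) = ln (s / FR)" by simp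
  then show ?thesis
    using ln_inj_iff[of "\<epsilon> ^ class_number p" "s / FR"] eps FR_pos s_pos by simp
qed

text \<open>Linear independence of 1 and sqrt p makes the description in \<open>unit_coeffs\<close>
  unique; a solution exists because the power lies in the field.\<close>

lemma unit_coeffs_eq: "\<epsilon> ^ class_number p = of_rat (a_coeff p) + of_rat (b_coeff p) * s"
proof -
  obtain a b where "\<epsilon> ^ class_number p = of_rat a + of_rat b * s"
    using KK_power(1)[OF eps(3), of "class_number p"] unfolding KK_iff by blast
  then have "\<exists>!c. fundamental_unit p ^ class_number p = of_rat (fst c) + of_rat (snd c) * s"
    using rat_coords_unique unfolding \<epsilon>_def[symmetric] by (intro ex1I[of _ "(a, b)"]) (auto simp: prod_eq_iff)
  then have "fundamental_unit p ^ class_number p = of_rat (fst (unit_coeffs p)) + of_rat (snd (unit_coeffs p)) * s"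
    unfolding unit_coeffs_def by (rule theI')
  then show ?thesis by (simp add: \<epsilon>_def a_coeff_def b_coeff_def)
qed

end

theorem theorem1p1:
  fixes p :: nat
  assumes "prime p" and "p > 3"
  shows "([p = 1] (mod 4) \<longrightarrow>
           map_poly rat_of_int (det (A_mat p)) =
             Polynomial.smult (2 ^ ((p - 3) div 2) * rat_of_int (Legendre 2 (int p)))
               [:a_coeff p - b_coeff p, a_coeff p - of_nat p * b_coeff p:]) \<and>
         ([p = 3] (mod 4) \<longrightarrow>
           det (A_mat p) = Polynomial.smult (2 ^ ((p - 3) div 2)) [:- 1, 1:])"
proof (intro conjI impI)
  interpret odd_prime p using assms by unfold_locales auto
  have m1: "m - 1 = (p - 3) div 2" using assms(2) by auto
  {
    assume "[p = 1] (mod 4)"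
    then have p1: "p mod 4 = 1" by (simp add: cong_def)
    interpret prime_1_mod_4 p using p1 by unfold_locales
    obtain \<zeta> where \<zeta>: "prime_root p \<zeta>" "prime_root.g p \<zeta> = of_real s"
      using exists_prime_root_gauss_sum[OF p1] by blast
    interpret prime_root p \<zeta> by (rule \<zeta>(1))
    have "s / FR = of_rat (a_coeff p) + of_rat (b_coeff p) * s"
      using unit_coeffs_eq eps_power_class_number[OF \<zeta>] by simp
    then have "map_poly rat_of_int (det (A_mat p)) =
        Polynomial.smult (2 ^ (m - 1) * rat_of_int (chi 2)) [:a_coeff p - b_coeff p, a_coeff p - of_nat p * b_coeff p:]"
      using det_A_mat_1[OF assms(2) p1 \<zeta>(2) F_R_eq_FR[OF p1]] FR_pos by simp
    then show "map_poly rat_of_int (det (A_mat p)) =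
        Polynomial.smult (2 ^ ((p - 3) div 2) * rat_of_int (Legendre 2 (int p)))
          [:a_coeff p - b_coeff p, a_coeff p - of_nat p * b_coeff p:]"
      by (simp only: m1 chi_def)
  next
    assume "[p = 3] (mod 4)"
    then have p3: "p mod 4 = 3" by (simp add: cong_def)
    obtain \<zeta> where \<zeta>: "prime_root p \<zeta>" using exists_prime_root by blast
    interpret prime_root p \<zeta> by (rule \<zeta>)
    show "det (A_mat p) = Polynomial.smult (2 ^ ((p - 3) div 2)) [:- 1, 1:]"
      using det_A_mat_3[OF assms(2) p3] by (simp only: m1)
  }
qed

end
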